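(* Let $p$ be a prime number and $n\geqslant2$. Let $f,g$ be nonzero polynomials in $\mathbf{Z}_p[x_1,\ldots,x_n]$ with $f(0)=0$ and $g(0)=0$. Suppose that $f$ and $g$ are both non-degenerated over $\mathbf{F}_p$ with respect to all the faces of their Newton polyhedron and that the pair $(f,g)$ is non-degenerated over $\mathbf{F}_p$ with respect to all the cones in the partition $\Delta_{f,g}$ of $\mathbf{R}_{\geqslant0}^n$ associated to $f$ and $g$. For $s\in\mathbf{C}$ with $\Re(s)>0$ put $$Z_{f,gdx}(s)=\int_{\mathbf{Z}_p^n}|f(x)|^s|g(x)||dx|.$$ Then $$Z_{f,gdx}(s)=\sum_{\delta\in\Delta_{f,g}}L_\delta S_\delta,$$ where, for every cone $\delta\in\Delta_{f,g}$, $$L_\delta=p^{-n}\left((p-1)^n-pN_\delta\frac{p^s-1}{p^{s+1}-1}-P_\delta\frac{p}{p+1}-pQ_\delta\frac{p^s(p+1)-2}{(p^{s+1}-1)(p+1)}\right)$$ and $$S_\delta=\sum_{k\in\mathbf{Z}_{\geqslant0}^n\cap\delta}p^{-m_f(k)s-m_g(k)-\sigma(k)}.$$ Moreover, for each $\delta\in\Delta_{f,g}$, given a partition of $\delta$ into rational simplicial cones $\delta_i$, $i\in I$, without introducing new rays, where $\delta_i$ is the cone strictly positively spanned by the linearly independent primitive vectors $k_{i,1},\ldots,k_{i,r_i}\in\mathbf{Z}_{\geqslant0}^n\setminus\{0\}$, one has $$S_\delta=\sum_{i\in I}\frac{\sum_h p^{m_f(h)s+m_g(h)+\sigma(h)}}{\prod_{j=1}^{r_i}\left(p^{m_f(k_{i,j})s+m_g(k_{i,j})+\sigma(k_{i,j})}-1\right)},$$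 where $h$ runs through the elements of the set $\mathbf{Z}^n\cap\left\{\sum_{j=1}^{r_i}\lambda_jk_{i,j}\mid 0\leqslant\lambda_j<1\text{ for }j=1,\ldots,r_i\right\}$. Consequently, the real parts of the candidate poles of (the meromorphic continuation to $\mathbf{C}$ of) $Z_{f,gdx}$ are given by the rational numbers $-1$ and $$-\frac{m_g(k)+\sigma(k)}{m_f(k)},$$ for $k$ a primitive generator of a ray in $\Delta_{f,g}$ with $m_f(k)\neq0$; that is, the real part of every pole is one of these numbers.
   Context: $|\cdot|$ is the $p$-adic norm on $\mathbf{Q}_p$ (with $|p|=p^{-1}$) and $|dx|$ is the Haar measure on $\mathbf{Q}_p^n$ normalized so that $\mathbf{Z}_p^n$ has measure one. A bar denotes reduction of coefficients modulo $p\mathbf{Z}_p$. For $\omega\in\mathbf{Z}_{\geqslant0}^n$, $x^\omega=x_1^{\omega_1}\cdots x_n^{\omega_n}$. Newton polyhedra: for a nonzero polynomial $f=\sum_\omega a_\omega x^\omega$ over $\mathbf{Z}_p$ with $f(0)=0$, $\Gamma_f$ is the convex hull of $\bigcup_{\omega:\,a_\omega\neq0}(\omega+\mathbf{R}_{\geqslant0}^n)$. A face of $\Gamma_f$ is $\Gamma_f$ itself or the intersection of $\Gamma_f$ with a supporting hyperplane. For a face $\tau$ of $\Gamma_f$ put $f_\tau=\sum_{\omega\in\tau}a_\omega x^\omega$. The polynomial $f$ is non-degenerated over $\mathbf{F}_p$ with respect to all the faces of $\Gamma_f$ if for every face $\tau$ of $\Gamma_f$ (including $\Gamma_f$ itself)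 there is no $a\in(\mathbf{F}_p^\times)^n$ with $\overline{f_\tau}(a)=0$ and $\frac{\partial\overline{f_\tau}}{\partial x_i}(a)=0$ for $i=1,\ldots,n$. For $k\in\mathbf{R}_{\geqslant0}^n$ put $m_f(k)=\inf_{x\in\Gamma_f}k\cdot x$, $F_f(k)=\{x\in\Gamma_f\mid k\cdot x=m_f(k)\}$ and $\sigma(k)=k_1+\cdots+k_n$; for a face $\tau$ of $\Gamma_f$ put $\Delta_f(\tau)=\{k\in\mathbf{R}_{\geqslant0}^n\mid F_f(k)=\tau\}$. The same definitions are used for $g$. The partition $\Delta_{f,g}$ of $\mathbf{R}_{\geqslant0}^n$ is the set of all nonempty intersections $\delta=\Delta_f(\tau)\cap\Delta_g(\tau')$ with $\tau$ a face of $\Gamma_f$ and $\tau'$ a face of $\Gamma_g$. Each $\delta\in\Delta_{f,g}$ determines $\tau$ and $\tau'$ uniquely; put $f_\delta=f_\tau$, $g_\delta=g_{\tau'}$ and $N_\delta=\#\{a\in(\mathbf{F}_p^\times)^n\mid\overline{f_\delta}(a)=0,\ \overline{g_\delta}(a)\neq0\}$, $P_\delta=\#\{a\in(\mathbf{F}_p^\times)^n\mid\overline{f_\delta}(a)\neq0,\ \overline{g_\delta}(a)=0\}$, $Q_\delta=\#\{a\in(\mathbf{F}_p^\times)^n\mid\overline{f_\delta}(a)=\overline{g_\delta}(a)=0\}$. The pair $(f,g)$ is non-degenerated over $\mathbf{F}_p$ with respect to all the cones in $\Delta_{f,g}$ if for every $\delta\in\Delta_{f,g}$ and all $a\in(\mathbf{Z}_p^\times)^n$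 with $f_\delta(a)\equiv g_\delta(a)\equiv0\bmod p$, the $2\times n$ Jacobian matrix of $(f_\delta,g_\delta)$ at $a$ has rank $2$ modulo $p$. Cones: the cone strictly positively spanned by $k_1,\ldots,k_r$ is $\{\lambda_1k_1+\cdots+\lambda_rk_r\mid\lambda_i>0\}$ (equal to $\{0\}$ if $r=0$). It is rational if the spanning vectors can be chosen in $\mathbf{Z}^n$, and simplicial if they can be chosen linearly independent over $\mathbf{R}$. A vector is primitive if its components are integers with greatest common divisor one. A ray is a cone of dimension one. Each $\delta\in\Delta_{f,g}$ is a rational cone strictly positively spanned by the primitive generators of the one-dimensional faces of its closure (which give rays in $\Delta_{f,g}$); a partition of $\delta$ into simplicial cones is without introducing new rays if each of its cones is strictly positively spanned by a linearly independent subset of these generators. For $\delta=\{0\}$ the trivial partition ($r=0$, $h=0$, empty product equal to $1$) is used. *)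

theory Defs
  imports
    "HOL-Complex_Analysis.Complex_Analysis"
    "HOL-Probability.Probability_Mass_Function"
    "HOL-Probability.Infinite_Product_Measure"
    "HOL-Library.Poly_Mapping"
    "Berlekamp_Zassenhaus.Finite_Field"
begin

unbundle no fps_syntax

section \<open>The ring of p-adic integers\<close>

text \<open>The prime is \<open>p = CARD('p)\<close> for a type \<open>'p :: prime_card\<close>, so that \<open>'p mod_ring\<close> is the
  field with \<open>p\<close> elements. A p-adic integer \<open>x\<close> is the coherent sequence of its residues
  \<open>x mod p^k\<close>, that is, an element of the inverse limit of the rings \<open>\<int>/p^k\<close>.\<close>

typedef (overloaded) ('p :: prime_card) padic_int =
  "{x :: nat \<Rightarrow> int. \<forall>k. x k \<in> {0..<int CARD('p) ^ k} \<and> x (Suc k) mod int CARD('p) ^ k = x k}"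
  morphisms residue Abs_padic_int
  by (rule exI[of _ "\<lambda>_. 0"]) (simp add: prime_gt_0_int prime_card_int)

setup_lifting type_definition_padic_int

lemma CARD_prime_gt: "1 < int CARD('p :: prime_card)"
  using prime_card_int[where ?'a = 'p] prime_gt_1_int by blast

lemma coherent_reduce:
  fixes h :: "nat \<Rightarrow> int"
  assumes "\<And>k. h (Suc k) mod int CARD('p :: prime_card) ^ k = h k mod int CARD('p) ^ k"
  shows "h k mod int CARD('p) ^ k \<in> {0..<int CARD('p) ^ k} \<and>
    h (Suc k) mod int CARD('p) ^ Suc k mod int CARD('p) ^ k = h k mod int CARD('p) ^ k"
  using assms[of k] CARD_prime_gt[where ?'p = 'p]
  by (auto simp: mod_mod_cancel)

instantiation padic_int :: (prime_card) comm_ring_1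
begin

lift_definition zero_padic_int :: "'a padic_int" is "\<lambda>k. 0"
  using CARD_prime_gt[where ?'p = 'a] by simp

lift_definition one_padic_int :: "'a padic_int" is "\<lambda>k. 1 mod int CARD('a) ^ k"
  by (rule coherent_reduce) simp

lift_definition plus_padic_int :: "'a padic_int \<Rightarrow> 'a padic_int \<Rightarrow> 'a padic_int"
  is "\<lambda>x y k. (x k + y k) mod int CARD('a) ^ k"
  by (rule coherent_reduce) (metis mod_add_eq)

lift_definition minus_padic_int :: "'a padic_int \<Rightarrow> 'a padic_int \<Rightarrow> 'a padic_int"
  is "\<lambda>x y k. (x k - y k) mod int CARD('a) ^ k"
  by (rule coherent_reduce) (metis mod_diff_eq)

lift_definition uminus_padic_int :: "'a padic_int \<Rightarrow> 'a padic_int"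
  is "\<lambda>x k. (- x k) mod int CARD('a) ^ k"
  by (rule coherent_reduce) (metis mod_minus_eq)

lift_definition times_padic_int :: "'a padic_int \<Rightarrow> 'a padic_int \<Rightarrow> 'a padic_int"
  is "\<lambda>x y k. (x k * y k) mod int CARD('a) ^ k"
  by (rule coherent_reduce) (metis mod_mult_eq)

instance
proof
  fix a b c :: "'a padic_int"
  show "a * b * c = a * (b * c)"
    by transfer (auto simp: fun_eq_iff mod_simps algebra_simps)
  show "a * b = b * a"
    by transfer (auto simp: fun_eq_iff algebra_simps)
  show "1 * a = a"
    by transfer (auto simp: fun_eq_iff mod_simps)
  show "a + b + c = a + (b + c)"
    by transfer (auto simp: fun_eq_iff mod_simps algebra_simps)
  show "a + b = b + a"
    by transfer (auto simp: fun_eq_iff algebra_simps)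
  show "0 + a = a"
    by transfer (auto simp: fun_eq_iff)
  show "- a + a = 0"
    by transfer (auto simp: fun_eq_iff mod_simps)
  show "a - b = a + - b"
    by transfer (auto simp: fun_eq_iff mod_simps)
  show "(a + b) * c = a * c + b * c"
    by transfer (auto simp: fun_eq_iff mod_simps algebra_simps)
  show "(0 :: 'a padic_int) \<noteq> 1"
  proof transfer
    show "(\<lambda>k. 0) \<noteq> (\<lambda>k. 1 mod int CARD('a) ^ k)"
      using CARD_prime_gt[where ?'p = 'a] by (auto simp: fun_eq_iff intro!: exI[of _ 1])
  qed
qed

end

text \<open>The p-adic norm \<open>p^(-v)\<close>, where \<open>v\<close> is the largest \<open>k\<close> with \<open>x \<equiv> 0 mod p^k\<close>.\<close>

definition padic_abs :: "'p :: prime_card padic_int \<Rightarrow> real" where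
  "padic_abs x = (if x = 0 then 0 else 1 / real CARD('p) ^ (GREATEST k. residue x k = 0))"

lemma residue_range: "0 \<le> residue (x :: 'p :: prime_card padic_int) k"
    "residue x k < int CARD('p) ^ k"
  and residue_Suc: "residue x (Suc k) mod int CARD('p) ^ k = residue x k"
  using residue[of x] by auto

lemma residue_le:
  assumes "j \<le> k" "residue (x :: 'p :: prime_card padic_int) k = 0"
  shows "residue x j = 0"
  using assms by (induction k rule: dec_induct) (metis residue_Suc mod_0)+

lemma residue_eq_0_iff:
  fixes x :: "'p :: prime_card padic_int"
  assumes "x \<noteq> 0"
  shows "residue x k = 0 \<longleftrightarrow> k \<le> (GREATEST k. residue x k = 0)"
proof -
  have "residue x \<noteq> residue (0 :: 'p padic_int)"
    using assms by (simp add: residue_inject)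
  then obtain N where N: "residue x N \<noteq> 0"
    by (auto simp: fun_eq_iff zero_padic_int.rep_eq)
  have bound: "\<And>j. residue x j = 0 \<Longrightarrow> j \<le> N"
    using N residue_le[of N _ x] by (meson linear)
  have "residue x 0 = 0"
    using residue_range[of x 0] by simp
  then have "residue x (GREATEST k. residue x k = 0) = 0"
    using bound by (rule GreatestI_nat)
  with bound show ?thesis
    using residue_le by (auto intro: Greatest_le_nat)
qed

lemma padic_abs_le_iff:
  fixes x :: "'p :: prime_card padic_int"
  shows "padic_abs x \<le> 1 / real CARD('p) ^ k \<longleftrightarrow> residue x k = 0"
proof (cases "x = 0")
  case True
  then show ?thesis by (simp add: padic_abs_def zero_padic_int.rep_eq)
next
  case False
  have "1 < real CARD('p)"
    using CARD_prime_gt[where ?'p = 'p] by simp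
  then show ?thesis
    unfolding residue_eq_0_iff[OF False, of k] padic_abs_def
    using False by (simp add: divide_simps)
qed

lemma padic_abs_pos: "0 < padic_abs x" if "x \<noteq> 0" for x :: "'p :: prime_card padic_int"
  using that CARD_prime_gt[where ?'p = 'p] by (simp add: padic_abs_def)

lemma padic_abs_ultra: "padic_abs (x - y) \<le> max (padic_abs (x - z)) (padic_abs (y - z))"
  for x y z :: "'p :: prime_card padic_int"
proof -
  have key: "padic_abs (x - y) \<le> padic_abs (u :: 'p padic_int)"
    if le: "padic_abs (x - z) \<le> padic_abs u" "padic_abs (y - z) \<le> padic_abs u" for u
  proof (cases "u = 0")
    case True
    with le have "x - z = 0" "y - z = 0"
      using padic_abs_pos[of "x - z"] padic_abs_pos[of "y - z"]
      by (force simp: padic_abs_def[of 0])+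
    then show ?thesis using True by simp
  next
    case False
    define k where "k = (GREATEST k. residue u k = 0)"
    have u: "padic_abs u = 1 / real CARD('p) ^ k"
      using False by (simp add: padic_abs_def k_def)
    have "residue (x - z) k = 0" "residue (y - z) k = 0"
      using le by (simp_all add: u padic_abs_le_iff)
    moreover have "x - y = (x - z) - (y - z)" by simp
    ultimately have "residue (x - y) k = 0"
      by (metis minus_padic_int.rep_eq diff_self mod_0)
    then show ?thesis by (simp add: u padic_abs_le_iff)
  qed
  show ?thesis
    using key[of "x - z"] key[of "y - z"] by linarith
qed

instantiation padic_int :: (prime_card) metric_space
begin

definition dist_padic_int :: "'a padic_int \<Rightarrow> 'a padic_int \<Rightarrow> real" where
  "dist_padic_int x y = padic_abs (x - y)"

definition uniformity_padic_int :: "('a padic_int \<times> 'a padic_int) filter" where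
  "uniformity_padic_int = (INF e\<in>{0 <..}. principal {(x, y). dist x y < e})"

definition open_padic_int :: "'a padic_int set \<Rightarrow> bool" where
  "open_padic_int U \<longleftrightarrow> (\<forall>x\<in>U. eventually (\<lambda>(x', y). x' = x \<longrightarrow> y \<in> U) uniformity)"

instance
proof
  fix x y z :: "'a padic_int"
  have nn: "padic_abs w \<ge> 0" for w :: "'a padic_int"
    by (simp add: padic_abs_def)
  show "dist x y = 0 \<longleftrightarrow> x = y"
    by (simp add: dist_padic_int_def padic_abs_def)
  show "dist x y \<le> dist x z + dist y z"
    unfolding dist_padic_int_def
    using padic_abs_ultra[of x y z] nn[of "x - z"] nn[of "y - z"] by linarith
qed (simp_all add: uniformity_padic_int_def open_padic_int_def)

end

definition red :: "'p :: prime_card padic_int \<Rightarrow> 'p mod_ring" where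
  "red x = of_int (residue x 1)"

text \<open>The normalized Haar measure: a Borel measure on the compact group of n-tuples of p-adic
  integers, invariant under translations and of total mass one. It is the restriction of the
  Haar measure on n-tuples of p-adic numbers that gives this open subgroup measure one.\<close>

definition normalized_haar :: "('p :: prime_card padic_int ^ 'n) measure \<Rightarrow> bool" where
  "normalized_haar M \<longleftrightarrow> sets M = sets borel \<and> (\<forall>a. distr M M (\<lambda>x. a + x) = M)
     \<and> emeasure M UNIV = 1"

text \<open>Such a measure exists: it is the distribution of tuples of p-adic integers with independent
  uniformly distributed digits.\<close>

definition cylinder :: "nat \<Rightarrow> 'p :: prime_card padic_int ^ 'n :: finite \<Rightarrow> ('p padic_int ^ 'n) set" where
  "cylinder k a = {x. \<forall>i. residue (x $ i) k = residue (a $ i) k}"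

lemma residue_mod:
  assumes "j \<le> k"
  shows "residue (x :: 'p :: prime_card padic_int) k mod int CARD('p) ^ j = residue x j"
  using assms
proof (induction k rule: dec_induct)
  case base
  show ?case using residue_range[of x j] by simp
next
  case (step m)
  have "residue x (Suc m) mod int CARD('p) ^ j = residue x (Suc m) mod int CARD('p) ^ m mod int CARD('p) ^ j"
    using step.hyps by (simp add: mod_mod_cancel le_imp_power_dvd)
  then show ?case using step.IH by (simp add: residue_Suc)
qed

lemma residue_diff_eq_0_iff:
  "residue (x - y) k = 0 \<longleftrightarrow> residue x k = residue (y :: 'p :: prime_card padic_int) k"
proof -
  have "residue x k = residue x k mod int CARD('p) ^ k" "residue y k = residue y k mod int CARD('p) ^ k"
    using residue_mod[of k k x] residue_mod[of k k y] by auto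
  then show ?thesis
    by (metis minus_padic_int.rep_eq mod_eq_dvd_iff mod_eq_0_iff_dvd)
qed

lemma dist_padic_le_iff:
  "dist x y \<le> 1 / real CARD('p) ^ k \<longleftrightarrow> residue x k = residue (y :: 'p :: prime_card padic_int) k"
  by (simp add: dist_padic_int_def padic_abs_le_iff residue_diff_eq_0_iff)

lemma open_residue: "open {y :: 'p :: prime_card padic_int. residue y k = c}"
  unfolding open_dist
proof clarify
  fix y :: "'p padic_int" assume "c = residue y k"
  then have "\<forall>z. dist z y < 1 / real CARD('p) ^ k \<longrightarrow> residue z k = residue y k"
    by (meson dist_padic_le_iff less_imp_le)
  moreover have "0 < 1 / real CARD('p) ^ k"
    using CARD_prime_gt[where ?'p = 'p] by simp
  ultimately show "\<exists>e>0. \<forall>z. dist z y < e \<longrightarrow> z \<in> {z. residue z k = residue y k}"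
    by blast
qed

lemma open_cylinder: "open (cylinder k a)"
  unfolding open_vec_def
proof
  fix x assume "x \<in> cylinder k a"
  then show "\<exists>A. (\<forall>i. open (A i) \<and> x $ i \<in> A i) \<and> (\<forall>y. (\<forall>i. y $ i \<in> A i) \<longrightarrow> y \<in> cylinder k a)"
    by (intro exI[of _ "\<lambda>i. {y. residue y k = residue (a $ i) k}"]) (auto simp: cylinder_def open_residue)
qed

lemma cylinder_mono: "j \<le> k \<Longrightarrow> cylinder k x \<subseteq> cylinder j x"
  unfolding cylinder_def by (clarsimp) (metis residue_mod)

lemma cylinder_eq: "x \<in> cylinder k a \<Longrightarrow> cylinder k a = cylinder k x"
  unfolding cylinder_def by auto

lemma open_contains_cylinder:
  fixes U :: "('p :: prime_card padic_int ^ 'n :: finite) set"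
  assumes "open U" "x \<in> U"
  shows "\<exists>k. cylinder k x \<subseteq> U"
proof -
  obtain A where A: "\<And>i. open (A i)" "\<And>i. x $ i \<in> A i" "\<And>y. (\<forall>i. y $ i \<in> A i) \<Longrightarrow> y \<in> U"
    using assms unfolding open_vec_def by metis
  have "\<exists>k. \<forall>z. residue z k = residue (x $ i) k \<longrightarrow> z \<in> A i" for i
  proof -
    obtain e where e: "e > 0" "\<And>z. dist z (x $ i) < e \<Longrightarrow> z \<in> A i"
      using A(1)[of i] A(2)[of i] unfolding open_dist by metis
    have "1 < real CARD('p)"
      using CARD_prime_gt[where ?'p = 'p] by simp
    then obtain k where "1 / e < real CARD('p) ^ k"
      using real_arch_pow by blast
    then have small: "1 / real CARD('p) ^ k < e"
      using e(1) \<open>1 < real CARD('p)\<close> by (simp add: field_simps)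
    show ?thesis
    proof (intro exI allI impI)
      fix z :: "'p padic_int" assume "residue z k = residue (x $ i) k"
      then have "dist z (x $ i) \<le> 1 / real CARD('p) ^ k"
        by (simp only: dist_padic_le_iff)
      also note small
      finally show "z \<in> A i" by (rule e(2))
    qed
  qed
  then obtain k where k: "\<And>i z. residue z (k i) = residue (x $ i) (k i) \<Longrightarrow> z \<in> A i"
    by metis
  have "cylinder (Max (range k)) x \<subseteq> U"
  proof
    fix y assume "y \<in> cylinder (Max (range k)) x"
    then have "residue (y $ i) (k i) = residue (x $ i) (k i)" for i
      unfolding cylinder_def
      using residue_mod[of "k i" "Max (range k)" "x $ i"] residue_mod[of "k i" "Max (range k)" "y $ i"]
      by simp
    then show "y \<in> U" using A(3) k by blast
  qed
  then show ?thesis by blast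
qed

definition cylinders :: "('p :: prime_card padic_int ^ 'n :: finite) set set" where
  "cylinders = (\<Union>k. range (cylinder k))"

lemma countable_cylinders: "countable (cylinders :: ('p :: prime_card padic_int ^ 'n :: finite) set set)"
proof -
  have "countable (range (cylinder k :: 'p padic_int ^ 'n \<Rightarrow> _))" for k
  proof (rule countable_subset)
    define S where "S = (\<lambda>c :: 'n \<Rightarrow> int. {x :: 'p padic_int ^ 'n. \<forall>i. residue (x $ i) k = c i})"
    have "cylinder k a = S (\<lambda>i. residue (a $ i) k)" for a
      by (simp add: S_def cylinder_def)
    then show "range (cylinder k :: 'p padic_int ^ 'n \<Rightarrow> _) \<subseteq> range S" by blast
    show "countable (range S)" by (intro countable_image countableI_type)
  qed
  then show ?thesis unfolding cylinders_def by (intro countable_UN countableI_type)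
qed

lemma sets_borel_cylinders:
  "sets (borel :: ('p :: prime_card padic_int ^ 'n :: finite) measure) = sigma_sets UNIV (insert {} cylinders)"
proof -
  let ?E = "insert {} cylinders :: ('p padic_int ^ 'n) set set"
  have "sigma_sets UNIV {U :: ('p padic_int ^ 'n) set. open U} = sigma_sets UNIV ?E"
  proof (rule sigma_sets_eqI)
    fix U :: "('p padic_int ^ 'n) set" assume "U \<in> {U. open U}"
    then have U: "open U" by simp
    have "\<exists>C\<in>cylinders. x \<in> C \<and> C \<subseteq> U" if x: "x \<in> U" for x
    proof -
      obtain k where "cylinder k x \<subseteq> U" using open_contains_cylinder[OF U x] by blast
      moreover have "x \<in> cylinder k x" by (simp add: cylinder_def)
      ultimately show ?thesis unfolding cylinders_def by blast
    qed
    then have "U = \<Union>{C \<in> cylinders. C \<subseteq> U}" by blast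
    moreover have "\<Union>{C \<in> cylinders. C \<subseteq> U} \<in> sigma_sets UNIV ?E"
    proof (rule sigma_sets_UNION)
      show "countable {C \<in> cylinders. C \<subseteq> U}"
        by (rule countable_subset[OF _ countable_cylinders]) blast
    qed (auto intro: sigma_sets.Basic)
    ultimately show "U \<in> sigma_sets UNIV ?E" by simp
  next
    fix U assume "U \<in> ?E"
    then have "open U" using open_cylinder by (auto simp: cylinders_def)
    then show "U \<in> sigma_sets UNIV {U. open U}" by (auto intro: sigma_sets.Basic)
  qed
  then show ?thesis by (simp add: borel_def)
qed

lemma digit_sum_eq_iff:
  fixes d :: "nat \<Rightarrow> int" and x :: "'p :: prime_card padic_int"
  assumes d: "\<And>j. 0 \<le> d j" "\<And>j. d j < int CARD('p)"
  shows "0 \<le> (\<Sum>j<k. d j * int CARD('p) ^ j)" (is ?lo)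
    and "(\<Sum>j<k. d j * int CARD('p) ^ j) < int CARD('p) ^ k" (is ?hi)
    and "(\<Sum>j<k. d j * int CARD('p) ^ j) = residue x k \<longleftrightarrow>
           (\<forall>j<k. d j = residue x (Suc j) div int CARD('p) ^ j)" (is ?eq)
proof -
  let ?p = "int CARD('p)"
  have p: "1 < ?p" by (rule CARD_prime_gt)
  have lo: "0 \<le> (\<Sum>j<k. d j * ?p ^ j)" for k using d p by (intro sum_nonneg) simp
  have hi: "(\<Sum>j<k. d j * ?p ^ j) < ?p ^ k" for k
  proof (induction k)
    case (Suc k)
    have "d k * ?p ^ k \<le> (?p - 1) * ?p ^ k"
      using d(2)[of k] p by (intro mult_right_mono) auto
    then show ?case using Suc by (simp add: algebra_simps)
  qed simp
  show ?lo ?hi by (fact lo hi)+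
  show ?eq
  proof (induction k)
    case 0
    show ?case using residue_range[of x 0] by simp
  next
    case (Suc k)
    let ?s = "\<Sum>j<k. d j * ?p ^ j"
    have pk: "?p ^ k > 0" using p by simp
    have s: "?s mod ?p ^ k = ?s" "?s div ?p ^ k = 0" using lo[of k] hi[of k] by auto
    have "?s + d k * ?p ^ k = residue x (Suc k) \<longleftrightarrow> ?s = residue x k \<and> d k = residue x (Suc k) div ?p ^ k"
    proof
      assume *: "?s + d k * ?p ^ k = residue x (Suc k)"
      have "residue x k = ?s"
        using residue_Suc[of x k] s(1) by (simp flip: *)
      moreover have "residue x (Suc k) div ?p ^ k = d k"
        using s(2) pk by (simp flip: *)
      ultimately show "?s = residue x k \<and> d k = residue x (Suc k) div ?p ^ k" by simp
    next
      assume "?s = residue x k \<and> d k = residue x (Suc k) div ?p ^ k"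
      then show "?s + d k * ?p ^ k = residue x (Suc k)"
        using residue_Suc[of x k] by (metis mod_div_mult_eq)
    qed
    then show ?case using Suc by (simp add: less_Suc_eq) blast
  qed
qed

definition from_digits :: "(nat \<times> 'n :: finite \<Rightarrow> nat) \<Rightarrow> 'p :: prime_card padic_int ^ 'n" where
  "from_digits \<omega> = (\<chi> i. Abs_padic_int (\<lambda>k. \<Sum>j<k. int (\<omega> (j, i) mod CARD('p)) * int CARD('p) ^ j))"

lemma residue_from_digits:
  "residue ((from_digits \<omega> :: 'p :: prime_card padic_int ^ 'n :: finite) $ i) k =
     (\<Sum>j<k. int (\<omega> (j, i) mod CARD('p)) * int CARD('p) ^ j)"
proof -
  have p: "1 < int CARD('p)" by (rule CARD_prime_gt)
  define d where "d = (\<lambda>j. int (\<omega> (j, i) mod CARD('p)))"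
  have d: "0 \<le> d j" "d j < int CARD('p)" for j
    using p by (simp_all add: d_def)
  have "(\<lambda>k. \<Sum>j<k. d j * int CARD('p) ^ j)
      \<in> {x. \<forall>k. x k \<in> {0..<int CARD('p) ^ k} \<and> x (Suc k) mod int CARD('p) ^ k = x k}"
    using digit_sum_eq_iff(1,2)[of d, where ?'p = 'p, OF d] by (auto simp: mod_add_eq)
  then show ?thesis
    by (simp add: from_digits_def Abs_padic_int_inverse d_def)
qed

lemma normalized_haar_exists:
  "\<exists>M :: ('p :: prime_card padic_int ^ 'n :: finite) measure. normalized_haar M"
proof -
  let ?p = "CARD('p)"
  have p: "1 < ?p" using CARD_prime_gt[where ?'p = 'p] by simp
  let ?U = "\<lambda>_ :: nat \<times> 'n. measure_pmf (pmf_of_set {0..<?p})"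
  interpret D: product_prob_space ?U UNIV
    by (intro product_prob_spaceI prob_space_measure_pmf)
  let ?D = "Pi\<^sub>M UNIV ?U"
  let ?\<phi> = "from_digits :: _ \<Rightarrow> 'p padic_int ^ 'n"
  have preimage: "?\<phi> -` cylinder k a = {\<omega>. \<forall>ji\<in>{..<k} \<times> UNIV. \<omega> ji \<in>
      {e. int (e mod ?p) = residue (a $ snd ji) (Suc (fst ji)) div int ?p ^ fst ji}}" for k a
    using p by (auto simp: cylinder_def residue_from_digits
        digit_sum_eq_iff(3)[where d = "\<lambda>j. int (_ (j, _) mod ?p)"])
  have space: "space ?D = UNIV" by (simp add: space_PiM)
  have meas_preimage: "?\<phi> -` cylinder k a \<in> sets ?D" for k a
  proof -
    have "{\<omega> \<in> space ?D. \<forall>ji\<in>{..<k} \<times> UNIV. \<omega> ji \<in>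
        {e. int (e mod ?p) = residue (a $ snd ji) (Suc (fst ji)) div int ?p ^ fst ji}} \<in> sets ?D"
      by (intro sets.sets_Collect_finite_All sets_Collect_single) auto
    then show ?thesis unfolding preimage space by simp
  qed
  have \<phi>: "?\<phi> \<in> measurable ?D borel"
    by (rule measurable_sigma_sets[OF sets_borel_cylinders]) (use meas_preimage space in \<open>auto simp: cylinders_def\<close>)
  define M where "M = distr ?D borel ?\<phi>"
  have sets_M: "sets M = sets borel" by (simp add: M_def)
  have cyl_borel: "cylinder k a \<in> sets borel" for k and a :: "'p padic_int ^ 'n"
    by (intro borel_open open_cylinder)
  have digit: "emeasure (?U ji) {e. int (e mod ?p) = residue x (Suc j) div int ?p ^ j} = ennreal (1 / ?p)"
    for ji j and x :: "'p padic_int"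
  proof -
    define c where "c = residue x (Suc j) div int ?p ^ j"
    have pj: "0 < int ?p ^ j" using p by simp
    have "0 \<le> c"
      using residue_range[of x "Suc j"] pj by (simp add: c_def pos_imp_zdiv_nonneg_iff)
    moreover have "c < int ?p"
    proof (rule ccontr)
      assume "\<not> c < int ?p"
      then have "int ?p * int ?p ^ j \<le> c * int ?p ^ j"
        using pj by (intro mult_right_mono) auto
      also have "\<dots> \<le> residue x (Suc j)"
        using div_mult_mod_eq[of "residue x (Suc j)" "int ?p ^ j"]
          pos_mod_sign[OF pj, of "residue x (Suc j)"] unfolding c_def by linarith
      finally show False using residue_range(2)[of x "Suc j"] by simp
    qed
    ultimately have "0 \<le> c" "c < int ?p" .
    then have "{0..<?p} \<inter> {e. int (e mod ?p) = c} = {nat c}" by (auto intro: nat_less_iff[THEN iffD2])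
    then show ?thesis
      using p by (simp add: c_def[symmetric] emeasure_pmf_of_set)
  qed
  have emeasure_cyl: "emeasure M (cylinder k a) = ennreal (1 / ?p) ^ (k * CARD('n))" for k a
  proof -
    have "emeasure M (cylinder k a) = emeasure ?D {\<omega> \<in> space ?D. \<forall>ji\<in>{..<k} \<times> UNIV. \<omega> ji \<in>
        {e. int (e mod ?p) = residue (a $ snd ji) (Suc (fst ji)) div int ?p ^ fst ji}}"
      unfolding M_def emeasure_distr[OF \<phi> cyl_borel] preimage space by simp
    also have "\<dots> = (\<Prod>ji\<in>{..<k} \<times> (UNIV :: 'n set). ennreal (1 / ?p))"
      by (subst D.emeasure_PiM_Collect) (auto simp: digit intro!: prod.cong)
    finally show ?thesis by simp
  qed
  have shift: "(\<lambda>x. b + x) -` cylinder k a = cylinder k (a - b)" for k and a b :: "'p padic_int ^ 'n"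
  proof -
    have "residue (b $ i + x $ i) k = residue (a $ i) k \<longleftrightarrow> residue (x $ i) k = residue (a $ i - b $ i) k" for x i
      by (simp add: algebra_simps flip: residue_diff_eq_0_iff)
    then show ?thesis by (auto simp: cylinder_def)
  qed
  have meas_shift: "(\<lambda>x. b + x) \<in> measurable M M" for b
    by (rule measurable_sigma_sets[OF sets_M[unfolded sets_borel_cylinders]])
      (use cyl_borel shift[of b] sets_M sets_eq_imp_space_eq[OF sets_M] in \<open>auto simp: cylinders_def\<close>)
  have "distr M M (\<lambda>x. b + x) = M" for b
  proof (rule measure_eqI_generator_eq[where \<Omega> = UNIV and A = "\<lambda>_. cylinder 0 0"])
    let ?E = "insert {} (cylinders :: ('p padic_int ^ 'n) set set)"
    have int: "cylinder k a \<inter> cylinder l c \<in> ?E" if "k \<le> l" for k l and a c :: "'p padic_int ^ 'n"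
    proof (cases "cylinder k a \<inter> cylinder l c = {}")
      case False
      then obtain x where "x \<in> cylinder k a" "x \<in> cylinder l c" by blast
      then have "cylinder k a \<inter> cylinder l c = cylinder l x"
        using cylinder_eq[of x k a] cylinder_eq[of x l c] cylinder_mono[OF that, of x] by auto
      then show ?thesis by (auto simp: cylinders_def)
    qed simp
    show "Int_stable ?E"
    proof (rule Int_stableI)
      fix A B assume "A \<in> ?E" "B \<in> ?E"
      then consider "A \<inter> B = {}" | k l a c where "A = cylinder k a" "B = cylinder l c"
        by (auto simp: cylinders_def)
      then show "A \<inter> B \<in> ?E"
      proof cases
        case 2
        then show ?thesis
          using int[of k l a c] int[of l k c a] by (metis inf_commute linear)
      qed simp
    qed
    have eq: "emeasure (distr M M (\<lambda>x. b + x)) (cylinder k a) = emeasure M (cylinder k a)" for k a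
      using cyl_borel[of k a] sets_M sets_eq_imp_space_eq[OF sets_M]
      by (simp add: emeasure_distr[OF meas_shift] shift emeasure_cyl)
    show "emeasure (distr M M (\<lambda>x. b + x)) X = emeasure M X" if "X \<in> ?E" for X
      using that eq by (auto simp: cylinders_def)
    show "emeasure (distr M M (\<lambda>x. b + x)) (cylinder 0 0) \<noteq> \<infinity>" for i :: nat
      by (simp add: eq emeasure_cyl)
    show "(\<Union>i :: nat. cylinder 0 0) = (UNIV :: ('p padic_int ^ 'n) set)"
    proof -
      have "residue (x :: 'p padic_int) 0 = 0" for x
        using residue_range[of x 0] by simp
      then show ?thesis by (auto simp: cylinder_def)
    qed
  qed (auto simp: emeasure_cyl sets_M sets_borel_cylinders cylinders_def)
  moreover have "emeasure M UNIV = 1"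
    using D.emeasure_space_1 \<phi> by (simp add: M_def emeasure_distr space)
  ultimately show ?thesis
    using sets_M unfolding normalized_haar_def by blast
qed

section \<open>Polynomials in several variables\<close>

text \<open>Variables are indexed by the finite type \<open>'n\<close>; a polynomial is the finitely supported family
  of its coefficients \<open>lookup f \<omega>\<close>, indexed by exponents \<open>\<omega> :: nat ^ 'n\<close>.\<close>

type_synonym ('a, 'n) mpoly = "(nat ^ 'n) \<Rightarrow>\<^sub>0 'a"

definition mpoly_eval :: "('a :: comm_semiring_1, 'n :: finite) mpoly \<Rightarrow> 'a ^ 'n \<Rightarrow> 'a" where
  "mpoly_eval f x = (\<Sum>\<omega>\<in>Poly_Mapping.keys f. Poly_Mapping.lookup f \<omega> * (\<Prod>i\<in>UNIV. x $ i ^ (\<omega> $ i)))"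

definition mpoly_pderiv ::
    "'n :: finite \<Rightarrow> ('a :: comm_semiring_1, 'n) mpoly \<Rightarrow> ('a, 'n) mpoly" where
  "mpoly_pderiv i f =
     (\<Sum>\<omega>\<in>Poly_Mapping.keys f. Poly_Mapping.single (\<omega> - axis i 1) (of_nat (\<omega> $ i) * Poly_Mapping.lookup f \<omega>))"

definition mpoly_red ::
    "('p :: prime_card padic_int, 'n :: finite) mpoly \<Rightarrow> ('p mod_ring, 'n) mpoly" where
  "mpoly_red f = Poly_Mapping.map red f"

section \<open>Newton polyhedra\<close>

definition exponent_vec :: "nat ^ 'n :: finite \<Rightarrow> real ^ 'n" where
  "exponent_vec \<omega> = (\<chi> i. real (\<omega> $ i))"

definition orthant :: "(real ^ 'n :: finite) set" where
  "orthant = {k. \<forall>i. 0 \<le> k $ i}"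

definition newton_polyhedron :: "('a :: zero, 'n :: finite) mpoly \<Rightarrow> (real ^ 'n) set" where
  "newton_polyhedron f = convex hull (\<Union>\<omega>\<in>{\<omega>. Poly_Mapping.lookup f \<omega> \<noteq> 0}. (\<lambda>x. exponent_vec \<omega> + x) ` orthant)"

definition supporting_hyperplane :: "(real ^ 'n :: finite) set \<Rightarrow> (real ^ 'n) set \<Rightarrow> bool" where
  "supporting_hyperplane H \<Gamma> \<longleftrightarrow>
     (\<exists>a b. a \<noteq> 0 \<and> H = {x. a \<bullet> x = b} \<and> \<Gamma> \<subseteq> {x. a \<bullet> x \<ge> b} \<and> \<Gamma> \<inter> H \<noteq> {})"

definition newton_faces :: "('a :: zero, 'n :: finite) mpoly \<Rightarrow> (real ^ 'n) set set" where
  "newton_faces f =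
     insert (newton_polyhedron f)
       {newton_polyhedron f \<inter> H | H. supporting_hyperplane H (newton_polyhedron f)}"

definition face_poly :: "('a :: comm_monoid_add, 'n :: finite) mpoly \<Rightarrow> (real ^ 'n) set \<Rightarrow> ('a, 'n) mpoly" where
  "face_poly f \<tau> =
     (\<Sum>\<omega>\<in>{\<omega> \<in> Poly_Mapping.keys f. exponent_vec \<omega> \<in> \<tau>}. Poly_Mapping.single \<omega> (Poly_Mapping.lookup f \<omega>))"

definition nondegenerate :: "('p :: prime_card padic_int, 'n :: finite) mpoly \<Rightarrow> bool" where
  "nondegenerate f \<longleftrightarrow>
     (\<forall>\<tau>\<in>newton_faces f. \<not> (\<exists>a :: 'p mod_ring ^ 'n. (\<forall>i. a $ i \<noteq> 0) \<and>
        mpoly_eval (mpoly_red (face_poly f \<tau>)) a = 0 \<and>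
        (\<forall>i. mpoly_eval (mpoly_pderiv i (mpoly_red (face_poly f \<tau>))) a = 0)))"

section \<open>The partition of the orthant associated with two polynomials\<close>

definition newton_m :: "('a :: zero, 'n :: finite) mpoly \<Rightarrow> real ^ 'n \<Rightarrow> real" where
  "newton_m f k = (INF x\<in>newton_polyhedron f. k \<bullet> x)"

definition newton_F :: "('a :: zero, 'n :: finite) mpoly \<Rightarrow> real ^ 'n \<Rightarrow> (real ^ 'n) set" where
  "newton_F f k = {x \<in> newton_polyhedron f. k \<bullet> x = newton_m f k}"

definition sigma :: "real ^ 'n :: finite \<Rightarrow> real" where
  "sigma k = (\<Sum>i\<in>UNIV. k $ i)"

definition face_cone :: "('a :: zero, 'n :: finite) mpoly \<Rightarrow> (real ^ 'n) set \<Rightarrow> (real ^ 'n) set" where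
  "face_cone f \<tau> = {k \<in> orthant. newton_F f k = \<tau>}"

definition cone_partition ::
    "('a :: zero, 'n :: finite) mpoly \<Rightarrow> ('a, 'n) mpoly \<Rightarrow> (real ^ 'n) set set" where
  "cone_partition f g =
     {\<delta>. \<delta> \<noteq> {} \<and> (\<exists>\<tau>\<in>newton_faces f. \<exists>\<tau>'\<in>newton_faces g. \<delta> = face_cone f \<tau> \<inter> face_cone g \<tau>')}"

text \<open>For \<open>\<delta>\<close> in the partition, exactly one face \<open>\<tau>\<close> of the polyhedron of \<open>f\<close> satisfies the
  condition below, because the sets \<open>face_cone f \<tau>\<close> are pairwise disjoint and \<open>\<delta>\<close> is nonempty.\<close>

definition cone_poly ::
    "('a :: comm_monoid_add, 'n :: finite) mpoly \<Rightarrow> (real ^ 'n) set \<Rightarrow> ('a, 'n) mpoly" where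
  "cone_poly f \<delta> = face_poly f (THE \<tau>. \<tau> \<in> newton_faces f \<and> \<delta> \<subseteq> face_cone f \<tau>)"

definition nondegenerate_pair ::
    "('p :: prime_card padic_int, 'n :: finite) mpoly \<Rightarrow> ('p padic_int, 'n) mpoly \<Rightarrow> bool" where
  "nondegenerate_pair f g \<longleftrightarrow>
     (\<forall>\<delta>\<in>cone_partition f g. \<forall>a :: 'p padic_int ^ 'n.
        (\<forall>i. a $ i dvd 1) \<and>
        of_nat CARD('p) dvd mpoly_eval (cone_poly f \<delta>) a \<and>
        of_nat CARD('p) dvd mpoly_eval (cone_poly g \<delta>) a \<longrightarrow>
        rank (vector [\<chi> i. red (mpoly_eval (mpoly_pderiv i (cone_poly f \<delta>)) a),
                      \<chi> i. red (mpoly_eval (mpoly_pderiv i (cone_poly g \<delta>)) a)]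
                :: 'p mod_ring ^ 'n ^ 2) = 2)"

definition N_count ::
    "('p :: prime_card padic_int, 'n :: finite) mpoly \<Rightarrow> ('p padic_int, 'n) mpoly \<Rightarrow> (real ^ 'n) set \<Rightarrow> nat"
  where "N_count f g \<delta> = card {a :: 'p mod_ring ^ 'n. (\<forall>i. a $ i \<noteq> 0) \<and>
     mpoly_eval (mpoly_red (cone_poly f \<delta>)) a = 0 \<and> mpoly_eval (mpoly_red (cone_poly g \<delta>)) a \<noteq> 0}"

definition P_count ::
    "('p :: prime_card padic_int, 'n :: finite) mpoly \<Rightarrow> ('p padic_int, 'n) mpoly \<Rightarrow> (real ^ 'n) set \<Rightarrow> nat"
  where "P_count f g \<delta> = card {a :: 'p mod_ring ^ 'n. (\<forall>i. a $ i \<noteq> 0) \<and>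
     mpoly_eval (mpoly_red (cone_poly f \<delta>)) a \<noteq> 0 \<and> mpoly_eval (mpoly_red (cone_poly g \<delta>)) a = 0}"

definition Q_count ::
    "('p :: prime_card padic_int, 'n :: finite) mpoly \<Rightarrow> ('p padic_int, 'n) mpoly \<Rightarrow> (real ^ 'n) set \<Rightarrow> nat"
  where "Q_count f g \<delta> = card {a :: 'p mod_ring ^ 'n. (\<forall>i. a $ i \<noteq> 0) \<and>
     mpoly_eval (mpoly_red (cone_poly f \<delta>)) a = 0 \<and> mpoly_eval (mpoly_red (cone_poly g \<delta>)) a = 0}"

section \<open>Rational simplicial cones\<close>

definition pos_cone :: "'j set \<Rightarrow> ('j \<Rightarrow> real ^ 'n :: finite) \<Rightarrow> (real ^ 'n) set" where
  "pos_cone J k = {\<Sum>j\<in>J. l j *\<^sub>R k j | l. \<forall>j\<in>J. 0 < l j}"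

definition primitive :: "real ^ 'n :: finite \<Rightarrow> bool" where
  "primitive k \<longleftrightarrow> (\<exists>z :: int ^ 'n. k = (\<chi> i. of_int (z $ i)) \<and> Gcd (range (\<lambda>i. z $ i)) = 1)"

text \<open>The primitive generators of the one-dimensional faces of the closure of \<open>\<delta>\<close>.\<close>

definition ray_generators :: "(real ^ 'n :: finite) set \<Rightarrow> (real ^ 'n) set" where
  "ray_generators \<delta> = {k. primitive k \<and> {t *\<^sub>R k | t. 0 \<le> t} face_of closure \<delta>}"

text \<open>A partition of \<open>\<delta>\<close>, without new rays, into the simplicial cones \<open>\<delta>\<^sub>i\<close> (\<open>i \<in> I\<close>) strictly
  positively spanned by the linearly independent primitive vectors \<open>k i 1, \<dots>, k i (r i)\<close>.\<close>

definition simplicial_partition ::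
    "(real ^ 'n :: finite) set \<Rightarrow> 'i set \<Rightarrow> ('i \<Rightarrow> nat) \<Rightarrow> ('i \<Rightarrow> nat \<Rightarrow> real ^ 'n) \<Rightarrow> bool" where
  "simplicial_partition \<delta> I r k \<longleftrightarrow>
     finite I \<and>
     (\<Union>i\<in>I. pos_cone {1..r i} (k i)) = \<delta> \<and>
     disjoint_family_on (\<lambda>i. pos_cone {1..r i} (k i)) I \<and>
     (\<forall>i\<in>I.
        (\<forall>j\<in>{1..r i}. primitive (k i j) \<and> k i j \<in> orthant) \<and>
        inj_on (k i) {1..r i} \<and> independent (k i ` {1..r i}) \<and>
        (\<exists>G \<subseteq> ray_generators \<delta>. independent G \<and> pos_cone {1..r i} (k i) = pos_cone G (\<lambda>v. v)))"

definition half_open_parallelepiped_points ::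
    "nat \<Rightarrow> (nat \<Rightarrow> real ^ 'n :: finite) \<Rightarrow> (real ^ 'n) set" where
  "half_open_parallelepiped_points r k =
     {h. (\<forall>i. h $ i \<in> \<int>) \<and> (\<exists>l. (\<forall>j\<in>{1..r}. 0 \<le> l j \<and> l j < 1) \<and> h = (\<Sum>j=1..r. l j *\<^sub>R k j))}"

section \<open>The zeta function and the terms of its formula\<close>

definition zeta_integrand ::
    "('p :: prime_card padic_int, 'n :: finite) mpoly \<Rightarrow> ('p padic_int, 'n) mpoly \<Rightarrow> complex \<Rightarrow>
       'p padic_int ^ 'n \<Rightarrow> complex" where
  "zeta_integrand f g s x =
     of_real (padic_abs (mpoly_eval f x)) powr s * of_real (padic_abs (mpoly_eval g x))"

definition zeta_fun ::
    "('p :: prime_card padic_int ^ 'n :: finite) measure \<Rightarrow>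
       ('p padic_int, 'n) mpoly \<Rightarrow> ('p padic_int, 'n) mpoly \<Rightarrow> complex \<Rightarrow> complex" where
  "zeta_fun \<mu> f g s = (\<integral>x. zeta_integrand f g s x \<partial>\<mu>)"

definition L_term ::
    "('p :: prime_card padic_int, 'n :: finite) mpoly \<Rightarrow> ('p padic_int, 'n) mpoly \<Rightarrow>
       (real ^ 'n) set \<Rightarrow> complex \<Rightarrow> complex" where
  "L_term f g \<delta> s = (let p = of_nat CARD('p) :: complex; n = CARD('n) in
     (1 / p ^ n) *
       ((p - 1) ^ n
        - p * of_nat (N_count f g \<delta>) * ((p powr s - 1) / (p powr (s + 1) - 1))
        - of_nat (P_count f g \<delta>) * (p / (p + 1))
        - p * of_nat (Q_count f g \<delta>) *
            ((p powr s * (p + 1) - 2) / ((p powr (s + 1) - 1) * (p + 1)))))"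

definition cone_exponent ::
    "('a :: zero, 'n :: finite) mpoly \<Rightarrow> ('a, 'n) mpoly \<Rightarrow> complex \<Rightarrow> real ^ 'n \<Rightarrow> complex" where
  "cone_exponent f g s k = of_real (newton_m f k) * s + of_real (newton_m g k) + of_real (sigma k)"

definition natural_points :: "(real ^ 'n :: finite) set" where
  "natural_points = {k. \<forall>i. k $ i \<in> \<nat>}"

definition S_summand ::
    "('p :: prime_card padic_int, 'n :: finite) mpoly \<Rightarrow> ('p padic_int, 'n) mpoly \<Rightarrow> complex \<Rightarrow>
       real ^ 'n \<Rightarrow> complex" where
  "S_summand f g s k = of_nat CARD('p) powr (- cone_exponent f g s k)"

definition S_term ::
    "('p :: prime_card padic_int, 'n :: finite) mpoly \<Rightarrow> ('p padic_int, 'n) mpoly \<Rightarrow>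
       (real ^ 'n) set \<Rightarrow> complex \<Rightarrow> complex" where
  "S_term f g \<delta> s = (\<Sum>\<^sub>\<infinity>k\<in>natural_points \<inter> \<delta>. S_summand f g s k)"

text \<open>The real numbers \<open>-1\<close> and \<open>-(m_g(k) + \<sigma>(k)) / m_f(k)\<close>; the condition
  \<open>pos_cone {k} (\<lambda>v. v) \<in> cone_partition f g\<close> says that \<open>k\<close> generates a ray of the partition.\<close>

definition candidate_real_parts :: "('a :: zero, 'n :: finite) mpoly \<Rightarrow> ('a, 'n) mpoly \<Rightarrow> real set" where
  "candidate_real_parts f g =
     insert (- 1) {- (newton_m g k + sigma k) / newton_m f k | k.
       primitive k \<and> pos_cone {k} (\<lambda>v. v) \<in> cone_partition f g \<and> newton_m f k \<noteq> 0}"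

end

theory Submission
  imports
    Defs
    "HOL-Analysis.Kronecker_Approximation_Theorem"
begin

no_notation fps_nth (infixl "$" 75)

text \<open>Up to a null set, \<open>\<int>\<^sub>p\<^sup>n\<close> is the disjoint union of the shells of points \<open>x = p\<^sup>k u\<close> where \<open>u\<close>
  has a fixed reduction \<open>a\<close> with nonzero coordinates. On such a shell \<open>f(x) = p\<^bsup>m\<^esup> F(u)\<close> with
  \<open>m = m\<^sub>f(k)\<close>, and \<open>F\<close> reduces to the polynomial of the face \<open>F\<^sub>f(k)\<close>; likewise \<open>g\<close> gives \<open>G\<close>. By
  non-degeneracy there are directions in which a translation by a multiple of \<open>p\<^sup>j\<close> permutes the
  \<open>j\<close>-th digit of \<open>F\<close> cyclically and leaves the relevant digits of \<open>G\<close> alone, and conversely.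
  Translation invariance of the Haar measure then shows that the valuations of those among \<open>F\<close> and
  \<open>G\<close> that vanish modulo \<open>p\<close> are independent and geometrically distributed. Summing over \<open>a\<close> gives
  \<open>L\<^sub>\<delta>\<close>, summing over \<open>k\<close> gives \<open>S\<^sub>\<delta>\<close>.

  For a simplicial cone, every lattice point is uniquely \<open>\<Sum> n\<^sub>j k\<^sub>j - h\<close> with \<open>n\<^sub>j \<ge> 1\<close> and \<open>h\<close> in the
  half-open parallelepiped, which reduces \<open>S\<^sub>\<delta>\<close> to geometric series. The continuation does not need a
  triangulation: the lattice points of \<open>\<delta>\<close> are a module over the monoid generated by the primitive
  generators \<open>v\<close> of the rays in the closure of \<open>\<delta>\<close>, finitely generated by Dickson's lemma, so that
  \<open>S\<^sub>\<delta>\<close> times the product of the \<open>1 - p\<^bsup>-e(v)\<^esup>\<close> is a finite sum of exponentials. These rays are spanned by the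
  extreme points of the section of the closure by the hyperplane \<open>\<sigma> = 1\<close>.\<close>

section \<open>Arithmetic of p-adic integers\<close>

text \<open>Faces are infinite sets, unbounded in the directions of the orthant, so they are first
  replaced by finite data: \<open>newton_F f k\<close> is determined by the exponents of
  \<open>f\<close> that minimize \<open>k\<close> together with the set of coordinates at which
  \<open>k\<close> vanishes. In these terms a cone of the partition is cut out by finitely many
  strict inequalities and equations with integer coefficients, its closure arises by weakening the
  strict ones, and \<open>newton_m f\<close> is one linear form on that closure. Hence the terms of
  the sum over a cone are values of a character of the additive group, and the rationality of the
  rays becomes a question of Diophantine approximation.

  On the analytic side a first-order Taylor expansion takes the place of a p-adic change of
  coordinates. Its price is that a translation which moves one digit of the first polynomial
  controls the second only one digit further; this constrains the order in which the joint law of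
  the two valuations can be computed.\<close>

lemma residue_0 [simp]: "residue (0 :: 'p :: prime_card padic_int) k = 0"
  by (simp add: zero_padic_int.rep_eq)

lemma residue_of_nat: "residue (of_nat m :: 'p :: prime_card padic_int) k = int m mod int CARD('p) ^ k"
  by (induction m) (simp_all add: zero_padic_int.rep_eq plus_padic_int.rep_eq one_padic_int.rep_eq mod_simps algebra_simps)

lemma residue_CARD_power: "residue (of_nat CARD('p) ^ j :: 'p :: prime_card padic_int) k = int CARD('p) ^ j mod int CARD('p) ^ k"
  using residue_of_nat[of "CARD('p) ^ j" k, where ?'p = 'p] by simp

lemma dvd_iff_residue:
  fixes x :: "'p :: prime_card padic_int"
  shows "of_nat CARD('p) ^ k dvd x \<longleftrightarrow> residue x k = 0"
proof
  assume "of_nat CARD('p) ^ k dvd x"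
  then show "residue x k = 0"
    by (auto simp: times_padic_int.rep_eq residue_CARD_power)
next
  assume x: "residue x k = 0"
  let ?p = "int CARD('p)"
  have p: "0 < ?p ^ j" for j using CARD_prime_gt[where ?'p = 'p] by simp
  have dvd: "?p ^ k dvd residue x (k + j)" for j
    using residue_mod[of k "k + j" x] x by (simp add: mod_eq_0_iff_dvd)
  \<comment> \<open>Division by \<open>p^k\<close> shifts the sequence of residues: the quotient
    modulo \<open>p^j\<close> is read off from \<open>x\<close> modulo
    \<open>p^(k+j)\<close>.\<close>
  define y :: "'p padic_int" where "y = Abs_padic_int (\<lambda>j. residue x (k + j) div ?p ^ k) "
  have y: "residue y j = residue x (k + j) div ?p ^ k" for j
  proof -
    have "(\<lambda>j. residue x (k + j) div ?p ^ k)
       \<in> {x. \<forall>k. x k \<in> {0..<?p ^ k} \<and> x (Suc k) mod ?p ^ k = x k}"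
    proof (intro CollectI allI conjI)
      fix j
      have "0 \<le> residue x (k + j)" "residue x (k + j) < ?p ^ j * ?p ^ k"
        using residue_range[of x "k+j"] by (simp_all add: power_add mult.commute)
      moreover obtain d where "residue x (k + j) = ?p ^ k * d" using dvd[of j] by (auto simp: dvd_def)
      ultimately show "residue x (k + j) div ?p ^ k \<in> {0..<?p ^ j}"
        using p[of k] by (simp add: mult.commute[of "?p ^ k"] zero_le_mult_iff)
      obtain c where c: "residue x (k + Suc j) = ?p ^ k * c" using dvd[of "Suc j"] by (auto simp: dvd_def)
      have "residue x (k + j) = ?p ^ k * c mod ?p ^ (k + j)"
        using residue_Suc[of x "k + j"] unfolding c[unfolded add_Suc_right] by (rule sym)
      also have "\<dots> = ?p ^ k * (c mod ?p ^ j)" unfolding power_add by (rule mult_mod_right[symmetric])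
      finally show "residue x (k + Suc j) div ?p ^ k mod ?p ^ j = residue x (k + j) div ?p ^ k"
        using c p[of k] by simp
    qed
    then show ?thesis unfolding y_def by (subst Abs_padic_int_inverse) auto
  qed
  have "x = of_nat CARD('p) ^ k * y"
  proof (rule residue_inject[THEN iffD1], rule ext)
    fix j
    have "residue (of_nat CARD('p) ^ k * y) j = ?p ^ k * residue y j mod ?p ^ j"
      by (simp only: times_padic_int.rep_eq residue_CARD_power mod_mult_left_eq)
    also have "\<dots> = residue x (k + j) mod ?p ^ j"
      using dvd[of j] by (simp add: y)
    also have "\<dots> = residue x j" by (simp add: residue_mod)
    finally show "residue x j = residue (of_nat CARD('p) ^ k * y) j" by simp
  qed
  then show "of_nat CARD('p) ^ k dvd x" by simp
qed

lemma residue_CARD_power_mult: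
  fixes y :: "'p :: prime_card padic_int"
  shows "residue (of_nat CARD('p) ^ k * y) (k + j) = int CARD('p) ^ k * residue y j"
proof -
  have "residue (of_nat CARD('p) ^ k * y) (k + j) = int CARD('p) ^ k * residue y (k + j) mod int CARD('p) ^ (k + j)"
    by (simp only: times_padic_int.rep_eq residue_CARD_power mod_mult_left_eq)
  also have "\<dots> = int CARD('p) ^ k * residue y j"
    unfolding power_add mult_mod_right[symmetric] using residue_mod[of j "k + j" y] by simp
  finally show ?thesis .
qed

text \<open>The instance \<open>comm_ring_1\<close> carries no cancellation law; cancelling powers
  of \<open>p\<close> is what allows the common factor \<open>p^m\<close> to be divided out of
  \<open>f\<close> on a shell.\<close>

lemma CARD_power_mult_eq_0:
  fixes y :: "'p :: prime_card padic_int"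
  assumes "of_nat CARD('p) ^ k * y = 0"
  shows "y = 0"
proof (rule residue_inject[THEN iffD1], rule ext)
  fix j
  show "residue y j = residue 0 j"
    using residue_CARD_power_mult[of k y j] CARD_prime_gt[where ?'p = 'p] by (simp add: assms)
qed

lemma CARD_power_mult_cancel:
  fixes x y :: "'p :: prime_card padic_int"
  shows "of_nat CARD('p) ^ k * x = of_nat CARD('p) ^ k * y \<longleftrightarrow> x = y"
  using CARD_power_mult_eq_0[of k "x - y"] by (auto simp: right_diff_distrib)

lemma CARD_power_dvd_cancel:
  fixes x :: "'p :: prime_card padic_int"
  shows "of_nat CARD('p) ^ (k + j) dvd of_nat CARD('p) ^ k * x \<longleftrightarrow> of_nat CARD('p) ^ j dvd x"
  by (auto simp: dvd_def power_add mult.assoc CARD_power_mult_cancel)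

lemma of_int_mod_ring_eq_iff:
  "(of_int a :: 'p :: prime_card mod_ring) = of_int b \<longleftrightarrow> a mod int CARD('p) = b mod int CARD('p)"
  by (metis of_int_of_int_mod_ring to_int_mod_ring_of_int_mod_ring of_int_mod_ring.rep_eq of_int_mod_ring.abs_eq to_int_mod_ring.rep_eq)

lemma red_eq_iff: "red x = red y \<longleftrightarrow> residue x 1 = residue (y :: 'p :: prime_card padic_int) 1"
  unfolding red_def of_int_mod_ring_eq_iff using residue_range[of x 1] residue_range[of y 1] by simp

lemma red_of_int_mod: "(of_int (a mod int CARD('p)) :: 'p :: prime_card mod_ring) = of_int a"
  by (simp add: of_int_mod_ring_eq_iff)

lemma red_0 [simp]: "red 0 = 0"
  by (simp add: red_def)
lemma red_1 [simp]: "red (1 :: 'p :: prime_card padic_int) = 1"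
  using red_of_int_mod[of 1, where ?'p = 'p] by (simp add: red_def one_padic_int.rep_eq)
lemma red_add [simp]: "red (x + y) = red x + red (y :: 'p :: prime_card padic_int)"
  by (simp add: red_def plus_padic_int.rep_eq red_of_int_mod)
lemma red_mult [simp]: "red (x * y) = red x * red (y :: 'p :: prime_card padic_int)"
  by (simp add: red_def times_padic_int.rep_eq red_of_int_mod)
lemma red_minus [simp]: "red (- x) = - red (x :: 'p :: prime_card padic_int)"
  by (simp add: red_def uminus_padic_int.rep_eq red_of_int_mod)
lemma red_diff [simp]: "red (x - y) = red x - red (y :: 'p :: prime_card padic_int)"
  using red_add[of x "-y"] by simp
lemma red_power [simp]: "red (x ^ n) = red (x :: 'p :: prime_card padic_int) ^ n"
  by (induction n) auto
lemma red_of_nat [simp]: "red (of_nat n :: 'p :: prime_card padic_int) = of_nat n"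
  by (induction n) auto
lemma red_sum [simp]: "red (sum h S) = (\<Sum>i\<in>S. red (h i :: 'p :: prime_card padic_int))"
  by (induction S rule: infinite_finite_induct) auto
lemma red_prod [simp]: "red (prod h S) = (\<Prod>i\<in>S. red (h i :: 'p :: prime_card padic_int))"
  by (induction S rule: infinite_finite_induct) auto

lemma red_eq_0_iff: "red (x :: 'p :: prime_card padic_int) = 0 \<longleftrightarrow> of_nat CARD('p) dvd x"
  using red_eq_iff[of x 0] dvd_iff_residue[of 1 x] by simp

lemma red_surj: "\<exists>x :: 'p :: prime_card padic_int. red x = c"
proof -
  have "red (of_nat (nat (to_int_mod_ring c)) :: 'p padic_int) = of_int (to_int_mod_ring c)"
    unfolding red_of_nat by (simp add: to_int_mod_ring.rep_eq) (metis of_int_of_nat_eq nat_0_le Rep_mod_ring atLeastLessThan_iff)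
  then show ?thesis by (metis of_int_mod_ring_to_int_mod_ring of_int_of_int_mod_ring)
qed

text \<open>The inverse is assembled from inverses modulo every \<open>p^k\<close>. They can be
  chosen independently of each other: an inverse modulo \<open>p^k\<close> is unique in its range,
  and uniqueness makes the sequence coherent.\<close>

lemma dvd_1_iff_red: "x dvd 1 \<longleftrightarrow> red (x :: 'p :: prime_card padic_int) \<noteq> 0"
proof
  assume "x dvd 1"
  then obtain y where "1 = x * y" by (auto simp: dvd_def)
  then have "red x * red y = 1" by (metis red_1 red_mult)
  then show "red x \<noteq> 0" by auto
next
  assume "red x \<noteq> 0"
  let ?p = "int CARD('p)"
  have pr: "prime ?p" by (rule prime_card_int)
  have p: "1 < ?p" by (rule CARD_prime_gt)
  have "residue x 1 \<noteq> 0" using \<open>red x \<noteq> 0\<close> by (auto simp: red_def)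
  then have nd: "\<not> ?p dvd residue x (Suc k)" for k
    using residue_mod[of 1 "Suc k" x] by auto
  have cop: "coprime (residue x k) (?p ^ k)" for k
  proof (cases k)
    case (Suc j)
    then show ?thesis using pr nd[of j] by (simp add: prime_imp_coprime coprime_commute)
  qed simp
  have "\<exists>y. 0 \<le> y \<and> y < ?p ^ k \<and> (residue x k * y) mod ?p ^ k = 1 mod ?p ^ k" for k
  proof -
    obtain y where "(residue x k * y) mod ?p ^ k = 1 mod ?p ^ k"
      using cop[of k] by (metis coprime_iff_invertible_int cong_def)
    then show ?thesis using p
      by (intro exI[of _ "y mod ?p ^ k"]) (simp add: mod_simps)
  qed
  then obtain y where y: "\<And>k. 0 \<le> y k" "\<And>k. y k < ?p ^ k" "\<And>k. (residue x k * y k) mod ?p ^ k = 1 mod ?p ^ k"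
    by metis
  have "y (Suc k) mod ?p ^ k = y k" for k
  proof -
    have "(residue x k * y (Suc k)) mod ?p ^ k = (residue x (Suc k) * y (Suc k)) mod ?p ^ k"
      using residue_Suc[of x k] by (metis mod_mult_left_eq)
    also have "\<dots> = (residue x (Suc k) * y (Suc k)) mod ?p ^ Suc k mod ?p ^ k"
      by (simp add: mod_mod_cancel)
    also have "\<dots> = 1 mod ?p ^ k" by (simp add: y(3) mod_mod_cancel del: power_Suc) (simp add: mod_mod_cancel)
    finally have "(residue x k * y (Suc k)) mod ?p ^ k = (residue x k * y k) mod ?p ^ k"
      using y(3)[of k] by simp
    then have "y (Suc k) mod ?p ^ k = y k mod ?p ^ k"
      using cop[of k] by (metis cong_def cong_mult_lcancel)
    then show ?thesis using y by simp
  qed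
  then have R: "residue (Abs_padic_int y :: 'p padic_int) k = y k" for k
    using y by (subst Abs_padic_int_inverse) auto
  have "x * Abs_padic_int y = 1"
    by (rule residue_inject[THEN iffD1], rule ext) (simp add: times_padic_int.rep_eq R y one_padic_int.rep_eq)
  then show "x dvd 1" by (metis dvd_triv_left)
qed

lemma padic_abs_unit_mult:
  fixes u :: "'p :: prime_card padic_int"
  assumes "red u \<noteq> 0"
  shows "padic_abs (of_nat CARD('p) ^ k * u) = 1 / real CARD('p) ^ k"
proof -
  have p: "1 < real CARD('p)" using CARD_prime_gt[where ?'p = 'p] by simp
  let ?x = "of_nat CARD('p) ^ k * u"
  have "\<not> of_nat CARD('p) ^ (k + 1) dvd ?x"
    unfolding CARD_power_dvd_cancel using assms by (simp add: red_eq_0_iff)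
  then have gt: "\<not> residue ?x (Suc k) = 0" using dvd_iff_residue[of "Suc k" ?x] by simp
  have le: "residue ?x k = 0" using dvd_iff_residue[of k ?x] by simp
  have "?x \<noteq> 0" using gt by (metis residue_0)
  then have "(GREATEST j. residue ?x j = 0) = k"
    using residue_eq_0_iff[of ?x] gt le by (metis le_antisym not_less_eq_eq)
  then show ?thesis using \<open>?x \<noteq> 0\<close> by (simp add: padic_abs_def)
qed

lemma padic_cases:
  fixes x :: "'p :: prime_card padic_int"
  assumes "x \<noteq> 0"
  obtains k u where "x = of_nat CARD('p) ^ k * u" "red u \<noteq> 0"
proof -
  define k where "k = (GREATEST k. residue x k = 0)"
  have *: "of_nat CARD('p) ^ j dvd x \<longleftrightarrow> j \<le> k" for j
    using residue_eq_0_iff[OF assms, of j] by (simp add: k_def dvd_iff_residue)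
  then have "of_nat CARD('p) ^ k dvd x" by simp
  then obtain u where u: "x = of_nat CARD('p) ^ k * u" by (auto simp: dvd_def)
  have "\<not> of_nat CARD('p) ^ (k + 1) dvd x" unfolding * by simp
  then have "red u \<noteq> 0" unfolding u CARD_power_dvd_cancel by (simp add: red_eq_0_iff)
  show ?thesis by (rule that[OF u \<open>red u \<noteq> 0\<close>])
qed

lemma padic_abs_le_1: "padic_abs (x :: 'p :: prime_card padic_int) \<le> 1"
  using padic_abs_le_iff[of x 0] residue_range[of x 0] by simp

lemma padic_abs_nonneg: "0 \<le> padic_abs (x :: 'p :: prime_card padic_int)"
  by (simp add: padic_abs_def)

section \<open>Newton polyhedra and the cone partition\<close>

abbreviation pkeys :: "('a::zero,'n::finite) mpoly \<Rightarrow> (nat^'n) set" where "pkeys \<equiv> Poly_Mapping.keys"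

text \<open>The vertices and further exponents of \<open>f\<close> on the face belonging to
  \<open>k\<close>: the finite trace of \<open>newton_F f k\<close> on the support of
  \<open>f\<close>.\<close>

definition min_exponents :: "('a::zero,'n::finite) mpoly \<Rightarrow> real^'n \<Rightarrow> (nat^'n) set" where
  "min_exponents f k = {\<omega> \<in> pkeys f. \<forall>\<omega>'\<in>pkeys f. k \<bullet> exponent_vec \<omega> \<le> k \<bullet> exponent_vec \<omega>'}"

text \<open>The axis directions in which the face of \<open>k\<close> is unbounded. They cannot be
  recovered from \<open>min_exponents\<close>: for a monomial \<open>f\<close> all \<open>k\<close>
  have the same minimal exponents, but their faces differ.\<close>

definition zero_coords :: "real^'n::finite \<Rightarrow> 'n set" where
  "zero_coords k = {i. k $ i = 0}"

lemma finite_min_exponents: "finite (min_exponents f k)"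
  unfolding min_exponents_def by simp

lemma min_exponents_nonempty:
  assumes "f \<noteq> 0"
  obtains \<omega> where "\<omega> \<in> min_exponents f k"
proof -
  have ne: "pkeys f \<noteq> {}" using assms by simp
  have "arg_min_on (\<lambda>\<omega>. k \<bullet> exponent_vec \<omega>) (pkeys f) \<in> min_exponents f k"
    unfolding min_exponents_def using arg_min_if_finite[OF finite_keys ne, of "\<lambda>\<omega>. k \<bullet> exponent_vec \<omega>"]
    by (auto simp: not_less)
  then show ?thesis by (rule that)
qed

lemma orthant_0 [simp]: "0 \<in> orthant" by (simp add: orthant_def)

lemma orthant_axis [simp]: "axis i 1 \<in> orthant" by (simp add: orthant_def axis_def)

lemma orthant_add: "a \<in> orthant \<Longrightarrow> b \<in> orthant \<Longrightarrow> a + b \<in> orthant" by (simp add: orthant_def)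

lemma orthant_scaleR: "a \<in> orthant \<Longrightarrow> 0 \<le> c \<Longrightarrow> c *\<^sub>R a \<in> orthant" by (simp add: orthant_def)

lemma orthant_inner_nonneg: "a \<in> orthant \<Longrightarrow> b \<in> orthant \<Longrightarrow> 0 \<le> a \<bullet> b"
  by (auto simp: orthant_def inner_vec_def intro!: sum_nonneg)

lemma newton_polyhedron_le:
  assumes "\<And>\<omega> y. \<omega> \<in> pkeys f \<Longrightarrow> y \<in> orthant \<Longrightarrow> b \<le> a \<bullet> (exponent_vec \<omega> + y)"
    and "x \<in> newton_polyhedron f"
  shows "b \<le> a \<bullet> x"
proof -
  have "newton_polyhedron f \<subseteq> {x. a \<bullet> x \<ge> b}"
    unfolding newton_polyhedron_def
    by (rule hull_minimal) (use assms(1) in \<open>auto simp: convex_halfspace_ge in_keys_iff\<close>)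
  then show ?thesis using assms(2) by blast
qed

lemma newton_polyhedron_mem: "\<omega> \<in> pkeys f \<Longrightarrow> y \<in> orthant \<Longrightarrow> exponent_vec \<omega> + y \<in> newton_polyhedron f"
  unfolding newton_polyhedron_def by (rule hull_inc) (auto simp: in_keys_iff)

lemma newton_polyhedron_exponent: "\<omega> \<in> pkeys f \<Longrightarrow> exponent_vec \<omega> \<in> newton_polyhedron f"
  using newton_polyhedron_mem[of \<omega> f 0] by simp

lemma newton_polyhedron_min_exponents_le:
  fixes k :: "real ^ 'n :: finite"
  assumes "k \<in> orthant" "\<omega> \<in> min_exponents f k" "x \<in> newton_polyhedron f"
  shows "k \<bullet> exponent_vec \<omega> \<le> k \<bullet> x"
proof (rule newton_polyhedron_le[OF _ assms(3)])
  fix \<omega>' y assume "\<omega>' \<in> pkeys f" "(y :: real^'n) \<in> orthant"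
  then show "k \<bullet> exponent_vec \<omega> \<le> k \<bullet> (exponent_vec \<omega>' + y)"
    using assms(2) orthant_inner_nonneg[OF assms(1), of y] by (force simp: min_exponents_def inner_add_right)
qed

lemma newton_m_eq:
  assumes "k \<in> orthant" "\<omega> \<in> min_exponents f k"
  shows "newton_m f k = k \<bullet> exponent_vec \<omega>"
  unfolding newton_m_def
proof (rule cInf_eq_minimum)
  show "k \<bullet> exponent_vec \<omega> \<in> (\<bullet>) k ` newton_polyhedron f"
    using assms(2) newton_polyhedron_exponent[of \<omega> f] by (auto simp: min_exponents_def)
  show "k \<bullet> exponent_vec \<omega> \<le> x" if "x \<in> (\<bullet>) k ` newton_polyhedron f" for x
    using that newton_polyhedron_min_exponents_le[OF assms] by auto
qed

lemma newton_m_nonneg: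
  assumes "f \<noteq> 0" "k \<in> orthant"
  shows "0 \<le> newton_m f k"
proof -
  obtain \<omega> where "\<omega> \<in> min_exponents f k" using min_exponents_nonempty[OF assms(1)] .
  moreover have "(exponent_vec \<omega> :: real^_) \<in> orthant" by (simp add: orthant_def exponent_vec_def)
  ultimately show ?thesis using orthant_inner_nonneg[OF assms(2)] newton_m_eq[OF assms(2)] by metis
qed

lemma min_exponents_iff_newton_F:
  assumes "f \<noteq> 0" "k \<in> orthant"
  shows "\<omega> \<in> min_exponents f k \<longleftrightarrow> \<omega> \<in> pkeys f \<and> exponent_vec \<omega> \<in> newton_F f k"
proof
  assume "\<omega> \<in> min_exponents f k"
  then show "\<omega> \<in> pkeys f \<and> exponent_vec \<omega> \<in> newton_F f k"
    using newton_m_eq[OF assms(2)] newton_polyhedron_exponent by (auto simp: min_exponents_def newton_F_def)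
next
  assume R: "\<omega> \<in> pkeys f \<and> exponent_vec \<omega> \<in> newton_F f k"
  obtain \<omega>0 where "\<omega>0 \<in> min_exponents f k" using min_exponents_nonempty[OF assms(1)] .
  with R newton_m_eq[OF assms(2) this] show "\<omega> \<in> min_exponents f k"
    by (auto simp: min_exponents_def newton_F_def)
qed

lemma zero_coords_iff_newton_F:
  assumes "k \<in> orthant" "\<omega> \<in> min_exponents f k"
  shows "i \<in> zero_coords k \<longleftrightarrow> exponent_vec \<omega> + axis i 1 \<in> newton_F f k"
  using assms newton_polyhedron_mem[of \<omega> f "axis i 1"] newton_m_eq[OF assms]
  by (auto simp: zero_coords_def newton_F_def inner_add_right inner_axis min_exponents_def)

text \<open>A large multiple of \<open>k\<close> dominates \<open>k'\<close> on the whole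
  polyhedron, both measured from a common minimal exponent, because \<open>k'\<close> vanishes on
  every generator (exponent or axis) on which \<open>k\<close> does. Where \<open>k\<close> attains
  its minimum, \<open>k'\<close> is then squeezed to its own.\<close>

lemma newton_F_mono:
  fixes k :: "real ^ 'n :: finite"
  assumes f: "f \<noteq> 0" and k: "k \<in> orthant" "k' \<in> orthant"
    and M: "min_exponents f k \<subseteq> min_exponents f k'" and Z: "zero_coords k \<subseteq> zero_coords k'"
  shows "newton_F f k \<subseteq> newton_F f k'"
proof
  fix x assume x: "x \<in> newton_F f k"
  obtain \<omega>0 where w0: "\<omega>0 \<in> min_exponents f k" using min_exponents_nonempty[OF f] .
  note w0' = subsetD[OF M w0]
  define h where "h = (\<lambda>\<omega>. k \<bullet> exponent_vec \<omega> - k \<bullet> exponent_vec \<omega>0)"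
  define h' where "h' = (\<lambda>\<omega>. k' \<bullet> exponent_vec \<omega> - k' \<bullet> exponent_vec \<omega>0)"
  have nn: "0 \<le> h \<omega>" "0 \<le> h' \<omega>" if "\<omega> \<in> pkeys f" for \<omega>
    using that w0 w0' by (auto simp: h_def h'_def min_exponents_def)
  have pos: "h' \<omega> = 0" if "\<omega> \<in> pkeys f" "h \<omega> = 0" for \<omega>
  proof -
    have "\<omega> \<in> min_exponents f k" using that w0 by (auto simp: h_def min_exponents_def)
    then have "\<omega> \<in> min_exponents f k'" using M by blast
    then show ?thesis using w0' by (auto simp: h'_def min_exponents_def intro: antisym)
  qed
  \<comment> \<open>The constant must exceed every ratio \<open>h' / h\<close> at the exponents and
    every ratio of coordinates; sums of the nonnegative ratios do. Division by zero gives
    \<open>0\<close>, so generators on which \<open>k\<close> vanishes contribute nothing.\<close>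
  define c1 where "c1 = (\<Sum>\<omega>\<in>pkeys f. h' \<omega> / h \<omega>)"
  define c2 where "c2 = (\<Sum>i\<in>UNIV. k' $ i / k $ i)"
  have kn: "0 \<le> k $ i" "0 \<le> k' $ i" for i using k by (auto simp: orthant_def)
  have c0: "0 \<le> c1" "0 \<le> c2" unfolding c1_def c2_def using nn kn by (auto intro!: sum_nonneg)
  have 1: "h' \<omega> \<le> (c1 + c2) * h \<omega>" if w: "\<omega> \<in> pkeys f" for \<omega>
  proof (cases "h \<omega> = 0")
    case True then show ?thesis using pos[OF w] by simp
  next
    case False
    have "h' \<omega> / h \<omega> \<le> c1" unfolding c1_def using nn w by (intro member_le_sum) auto
    then have "h' \<omega> / h \<omega> \<le> c1 + c2" using c0 by simp
    then show ?thesis using nn[OF w] False by (simp add: field_simps)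
  qed
  have 2: "k' $ i \<le> (c1 + c2) * k $ i" for i
  proof (cases "k $ i = 0")
    case True then show ?thesis using Z by (auto simp: zero_coords_def)
  next
    case False
    have "k' $ i / k $ i \<le> c2" unfolding c2_def using kn by (intro member_le_sum) auto
    then have "k' $ i / k $ i \<le> c1 + c2" using c0 by simp
    then show ?thesis using kn[of i] False by (simp add: field_simps)
  qed
  \<comment> \<open>The form \<open>(c1 + c2) k - k'\<close> is minimal at \<open>\<omega>0\<close>
    over the polyhedron. On the face of \<open>k\<close> the first part is constant, which bounds
    \<open>k'\<close> from above.\<close>
  have "(c1 + c2) * (k \<bullet> exponent_vec \<omega>0) - k' \<bullet> exponent_vec \<omega>0 \<le> ((c1 + c2) *\<^sub>R k - k') \<bullet> x"
  proof (rule newton_polyhedron_le[of f])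
    fix \<omega> y assume w: "\<omega> \<in> pkeys f" and y: "(y :: real^'n) \<in> orthant"
    have "(c1 + c2) *\<^sub>R k - k' \<in> orthant" using 2 by (simp add: orthant_def)
    from orthant_inner_nonneg[OF this y] 1[OF w]
    show "(c1 + c2) * (k \<bullet> exponent_vec \<omega>0) - k' \<bullet> exponent_vec \<omega>0 \<le>
        ((c1 + c2) *\<^sub>R k - k') \<bullet> (exponent_vec \<omega> + y)"
      unfolding h_def h'_def by (simp add: inner_add_right inner_diff_left algebra_simps)
  qed (use x in \<open>simp add: newton_F_def\<close>)
  moreover have "k \<bullet> x = k \<bullet> exponent_vec \<omega>0" using x newton_m_eq[OF k(1) w0] by (simp add: newton_F_def)
  ultimately have "k' \<bullet> x \<le> k' \<bullet> exponent_vec \<omega>0" by (simp add: inner_diff_left)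
  moreover have "k' \<bullet> exponent_vec \<omega>0 \<le> k' \<bullet> x"
    using newton_polyhedron_min_exponents_le[OF k(2) w0'] x by (simp add: newton_F_def)
  ultimately show "x \<in> newton_F f k'"
    using x newton_m_eq[OF k(2) w0'] by (simp add: newton_F_def)
qed

text \<open>The finite data is visible in the face itself: it contains exactly the minimal exponents
  of the support, and stepping along axis \<open>i\<close> from a minimal exponent stays in the face
  exactly when \<open>k\<close> vanishes at \<open>i\<close>. The converse is monotonicity in both
  directions.\<close>

lemma newton_F_eq_iff:
  assumes "f \<noteq> 0" "k \<in> orthant" "k' \<in> orthant"
  shows "newton_F f k = newton_F f k' \<longleftrightarrow> min_exponents f k = min_exponents f k' \<and> zero_coords k = zero_coords k'"
proof
  assume F: "newton_F f k = newton_F f k'"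
  have M: "min_exponents f k = min_exponents f k'"
    using min_exponents_iff_newton_F[OF assms(1,2)] min_exponents_iff_newton_F[OF assms(1,3)] F by auto
  obtain \<omega> where "\<omega> \<in> min_exponents f k" using min_exponents_nonempty[OF assms(1)] .
  then show "min_exponents f k = min_exponents f k' \<and> zero_coords k = zero_coords k'"
    using zero_coords_iff_newton_F[OF assms(2)] zero_coords_iff_newton_F[OF assms(3)] F M by (metis subset_antisym subset_iff)
next
  assume "min_exponents f k = min_exponents f k' \<and> zero_coords k = zero_coords k'"
  then show "newton_F f k = newton_F f k'"
    using newton_F_mono[of f k k'] newton_F_mono[of f k' k] assms by auto
qed

lemma newton_F_in_faces:
  assumes "f \<noteq> 0" "k \<in> orthant"
  shows "newton_F f k \<in> newton_faces f"
proof (cases "k = 0")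
  case True
  obtain \<omega> where "\<omega> \<in> min_exponents f k" using min_exponents_nonempty[OF assms(1)] .
  then have "newton_m f k = 0" using newton_m_eq[OF assms(2)] True by simp
  \<comment> \<open>The zero vector is normal to no hyperplane; it accounts for the improper
    face.\<close>
  then have "newton_F f k = newton_polyhedron f" using True by (simp add: newton_F_def)
  then show ?thesis by (simp add: newton_faces_def)
next
  case False
  obtain \<omega> where w: "\<omega> \<in> min_exponents f k" using min_exponents_nonempty[OF assms(1)] .
  let ?H = "{x. k \<bullet> x = newton_m f k}"
  have "newton_F f k = newton_polyhedron f \<inter> ?H" by (auto simp: newton_F_def)
  moreover have "supporting_hyperplane ?H (newton_polyhedron f)"
    unfolding supporting_hyperplane_def
  proof (intro exI conjI)
    show "newton_polyhedron f \<subseteq> {x. k \<bullet> x \<ge> newton_m f k}"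
      using newton_polyhedron_min_exponents_le[OF assms(2) w] newton_m_eq[OF assms(2) w] by auto
    show "newton_polyhedron f \<inter> ?H \<noteq> {}"
      using w newton_m_eq[OF assms(2) w] newton_polyhedron_exponent[of \<omega> f] by (auto simp: min_exponents_def)
  qed (use False in auto)
  ultimately show ?thesis unfolding newton_faces_def by blast
qed

text \<open>The member of the partition through \<open>k\<close>. One condition on
  \<open>zero_coords\<close> serves both polynomials, since it depends on \<open>k\<close>
  alone.\<close>

definition cone_class :: "('a::zero,'n::finite) mpoly \<Rightarrow> ('a,'n) mpoly \<Rightarrow> real^'n \<Rightarrow> (real^'n) set" where
  "cone_class f g k = {k' \<in> orthant. min_exponents f k' = min_exponents f k \<and> min_exponents g k' = min_exponents g k \<and> zero_coords k' = zero_coords k}"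

lemma cone_class_refl: "k \<in> orthant \<Longrightarrow> k \<in> cone_class f g k"
  by (simp add: cone_class_def)

lemma cone_class_eq: "k' \<in> cone_class f g k \<Longrightarrow> cone_class f g k' = cone_class f g k"
  by (auto simp: cone_class_def)

lemma face_cone_Int:
  assumes "f \<noteq> 0" "g \<noteq> 0" "k \<in> orthant"
  shows "face_cone f (newton_F f k) \<inter> face_cone g (newton_F g k) = cone_class f g k"
  unfolding face_cone_def cone_class_def
  using newton_F_eq_iff[OF assms(1) _ assms(3)] newton_F_eq_iff[OF assms(2) _ assms(3)] by blast

lemma cone_partition_eq:
  assumes "f \<noteq> 0" "g \<noteq> 0"
  shows "cone_partition f g = cone_class f g ` orthant"
proof (intro equalityI subsetI)
  fix \<delta> assume "\<delta> \<in> cone_partition f g"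
  then obtain \<tau> \<tau>' k where d: "\<delta> = face_cone f \<tau> \<inter> face_cone g \<tau>'" "k \<in> \<delta>"
    by (auto simp: cone_partition_def)
  then have "k \<in> orthant" "\<tau> = newton_F f k" "\<tau>' = newton_F g k" by (auto simp: face_cone_def)
  then show "\<delta> \<in> cone_class f g ` orthant" using d face_cone_Int[OF assms] by auto
next
  fix \<delta> assume "\<delta> \<in> cone_class f g ` orthant"
  then obtain k where "k \<in> orthant" "\<delta> = cone_class f g k" by auto
  then have "\<delta> \<noteq> {}" "\<delta> = face_cone f (newton_F f k) \<inter> face_cone g (newton_F g k)"
    using face_cone_Int[OF assms] cone_class_refl[of k f g] by auto
  then show "\<delta> \<in> cone_partition f g"
    unfolding cone_partition_def
    using newton_F_in_faces[OF assms(1) \<open>k \<in> orthant\<close>] newton_F_in_faces[OF assms(2) \<open>k \<in> orthant\<close>]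
    by blast
qed

lemma finite_cone_partition:
  assumes "f \<noteq> 0" "g \<noteq> 0"
  shows "finite (cone_partition f g)"
proof -
  have "cone_partition f g \<subseteq> (\<lambda>(A,B,C). {k' \<in> orthant. min_exponents f k' = A \<and> min_exponents g k' = B \<and> zero_coords k' = C}) `
    (Pow (pkeys f) \<times> Pow (pkeys g) \<times> UNIV)"
    unfolding cone_partition_eq[OF assms]
  proof (rule image_subsetI)
    fix k
    have "(min_exponents f k, min_exponents g k, zero_coords k) \<in> Pow (pkeys f) \<times> Pow (pkeys g) \<times> UNIV" by (auto simp: min_exponents_def)
    then show "cone_class f g k \<in> (\<lambda>(A,B,C). {k' \<in> orthant. min_exponents f k' = A \<and> min_exponents g k' = B \<and> zero_coords k' = C}) `
       (Pow (pkeys f) \<times> Pow (pkeys g) \<times> UNIV)"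
      unfolding cone_class_def by (rule rev_image_eqI) simp
  qed
  then show ?thesis by (rule finite_subset) auto
qed

text \<open>Resolves the definite description in \<open>cone_poly\<close>: any point of the cone
  already determines its face, so a single witness \<open>k\<close> gives uniqueness.\<close>

lemma cone_class_THE:
  assumes "f \<noteq> 0" "k \<in> \<delta>" "\<delta> \<subseteq> face_cone f (newton_F f k)"
  shows "(THE \<tau>. \<tau> \<in> newton_faces f \<and> \<delta> \<subseteq> face_cone f \<tau>) = newton_F f k"
proof (rule the_equality)
  show "newton_F f k \<in> newton_faces f \<and> \<delta> \<subseteq> face_cone f (newton_F f k)"
    using assms newton_F_in_faces[OF assms(1), of k] by (auto simp: face_cone_def)
qed (use assms in \<open>auto simp: face_cone_def\<close>)

lemma cone_poly_eq:
  assumes "f \<noteq> 0" "g \<noteq> 0" "k \<in> orthant"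
  shows "cone_poly f (cone_class f g k) = face_poly f (newton_F f k)"
    and "cone_poly g (cone_class f g k) = face_poly g (newton_F g k)"
  unfolding cone_poly_def
  by (subst cone_class_THE; use assms face_cone_Int[OF assms] cone_class_refl[OF assms(3)] in auto)+

lemma lookup_sum_single:
  assumes "finite S"
  shows "Poly_Mapping.lookup (\<Sum>\<omega>\<in>S. Poly_Mapping.single \<omega> (h \<omega>)) \<eta> = (if \<eta> \<in> S then h \<eta> else 0)"
  using assms by (induction S) (auto simp: lookup_add lookup_single when_def)

lemma lookup_face_poly:
  assumes "f \<noteq> 0" "k \<in> orthant"
  shows "Poly_Mapping.lookup (face_poly f (newton_F f k)) \<omega> =
    (if \<omega> \<in> min_exponents f k then Poly_Mapping.lookup f \<omega> else 0)"
proof -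
  have "{\<omega> \<in> pkeys f. exponent_vec \<omega> \<in> newton_F f k} = min_exponents f k"
    using min_exponents_iff_newton_F[OF assms] by auto
  then show ?thesis unfolding face_poly_def by (simp add: lookup_sum_single finite_min_exponents)
qed

section \<open>First-order expansion on a shell\<close>

definition nat_inner :: "nat^'n::finite \<Rightarrow> nat^'n \<Rightarrow> nat" where
  "nat_inner k \<omega> = (\<Sum>i\<in>UNIV. k $ i * \<omega> $ i)"

text \<open>The value of \<open>newton_m\<close> at a lattice vector as a natural number, so that it
  can serve as an exponent of \<open>p\<close>.\<close>

definition newton_min :: "('a::zero,'n::finite) mpoly \<Rightarrow> nat^'n \<Rightarrow> nat" where
  "newton_min f k = Min (nat_inner k ` pkeys f)"

lemma inner_exponent_vec: "exponent_vec k \<bullet> exponent_vec \<omega> = real (nat_inner k \<omega>)"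
  by (simp add: nat_inner_def inner_vec_def exponent_vec_def)

lemma exponent_vec_orthant [simp]: "exponent_vec k \<in> orthant"
  by (simp add: orthant_def exponent_vec_def)

lemma newton_min_le: "\<omega> \<in> pkeys f \<Longrightarrow> newton_min f k \<le> nat_inner k \<omega>"
  unfolding newton_min_def by (intro Min_le) auto

lemma min_exponents_exponent_vec: "\<omega> \<in> min_exponents f (exponent_vec k) \<longleftrightarrow> \<omega> \<in> pkeys f \<and> nat_inner k \<omega> = newton_min f k"
proof (cases "\<omega> \<in> pkeys f")
  case True
  have "(\<forall>\<omega>'\<in>pkeys f. nat_inner k \<omega> \<le> nat_inner k \<omega>') \<longleftrightarrow> nat_inner k \<omega> = newton_min f k"
  proof
    assume "\<forall>\<omega>'\<in>pkeys f. nat_inner k \<omega> \<le> nat_inner k \<omega>'"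
    then show "nat_inner k \<omega> = newton_min f k"
      unfolding newton_min_def using True by (intro Min_eqI[symmetric]) auto
  qed (use newton_min_le in auto)
  with True show ?thesis by (simp add: min_exponents_def inner_exponent_vec)
qed (simp add: min_exponents_def)

lemma newton_m_exponent_vec:
  assumes "f \<noteq> 0"
  shows "newton_m f (exponent_vec k) = real (newton_min f k)"
proof -
  obtain \<omega> where w: "\<omega> \<in> min_exponents f (exponent_vec k)" using min_exponents_nonempty[OF assms] .
  then show ?thesis using newton_m_eq[OF _ w] by (simp add: inner_exponent_vec min_exponents_exponent_vec)
qed

definition monom_eval :: "nat^'n::finite \<Rightarrow> 'a::comm_semiring_1 ^'n \<Rightarrow> 'a" where
  "monom_eval \<omega> x = (\<Prod>i\<in>UNIV. x $ i ^ (\<omega> $ i))"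

lemma mpoly_eval_superset:
  assumes "finite S" "pkeys f \<subseteq> S"
  shows "mpoly_eval f x = (\<Sum>\<omega>\<in>S. Poly_Mapping.lookup f \<omega> * monom_eval \<omega> x)"
  unfolding mpoly_eval_def monom_eval_def[symmetric]
  by (rule sum.mono_neutral_left) (use assms in \<open>auto simp: in_keys_iff\<close>)

lemma mpoly_eval_0 [simp]: "mpoly_eval 0 x = 0"
  by (simp add: mpoly_eval_def)

lemma mpoly_eval_add: "mpoly_eval (f + g) x = mpoly_eval f x + mpoly_eval g x"
proof -
  have *: "finite (pkeys f \<union> pkeys g)" by simp
  show ?thesis
    using mpoly_eval_superset[OF *, of f x] mpoly_eval_superset[OF *, of g x] mpoly_eval_superset[OF *, of "f + g" x]
      keys_add[of f g]
    by (simp add: lookup_add distrib_right sum.distrib)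
qed

lemma mpoly_eval_sum: "mpoly_eval (sum h S) x = (\<Sum>i\<in>S. mpoly_eval (h i) x)"
  by (induction S rule: infinite_finite_induct) (auto simp: mpoly_eval_add)

lemma mpoly_eval_single: "mpoly_eval (Poly_Mapping.single \<omega> c) x = c * monom_eval \<omega> x"
  using mpoly_eval_superset[of "{\<omega>}" "Poly_Mapping.single \<omega> c" x] by simp

lemma mpoly_eval_pderiv:
  assumes "finite S" "pkeys f \<subseteq> S"
  shows "mpoly_eval (mpoly_pderiv i f) x =
    (\<Sum>\<omega>\<in>S. of_nat (\<omega> $ i) * Poly_Mapping.lookup f \<omega> * monom_eval (\<omega> - axis i 1) x)"
proof -
  have "mpoly_eval (mpoly_pderiv i f) x =
    (\<Sum>\<omega>\<in>pkeys f. of_nat (\<omega> $ i) * Poly_Mapping.lookup f \<omega> * monom_eval (\<omega> - axis i 1) x)"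
    by (simp add: mpoly_pderiv_def mpoly_eval_sum mpoly_eval_single)
  also have "\<dots> = (\<Sum>\<omega>\<in>S. of_nat (\<omega> $ i) * Poly_Mapping.lookup f \<omega> * monom_eval (\<omega> - axis i 1) x)"
    by (rule sum.mono_neutral_left) (use assms in \<open>auto simp: in_keys_iff\<close>)
  finally show ?thesis .
qed

definition red_vec :: "'p :: prime_card padic_int ^ 'n \<Rightarrow> 'p mod_ring ^ 'n" where
  "red_vec x = (\<chi> i. red (x $ i))"

lemma red_vec_nth [simp]: "red_vec x $ i = red (x $ i)" by (simp add: red_vec_def)

lemma lookup_mpoly_red [simp]: "Poly_Mapping.lookup (mpoly_red f) \<omega> = red (Poly_Mapping.lookup f \<omega>)"
  by (simp add: mpoly_red_def Poly_Mapping.map.rep_eq when_def)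

lemma keys_mpoly_red: "pkeys (mpoly_red f) \<subseteq> pkeys f"
  by (auto simp: in_keys_iff)

lemma red_monom_eval: "red (monom_eval \<omega> x) = monom_eval \<omega> (red_vec x)"
  by (simp add: monom_eval_def)

lemma red_mpoly_eval: "red (mpoly_eval f x) = mpoly_eval (mpoly_red f) (red_vec x)"
  using mpoly_eval_superset[OF finite_keys subset_refl, of f x]
    mpoly_eval_superset[OF finite_keys keys_mpoly_red, of f "red_vec x"]
  by (simp add: red_monom_eval)

lemma red_mpoly_eval_pderiv:
  fixes f :: "('p :: prime_card padic_int, 'n :: finite) mpoly"
  shows "red (mpoly_eval (mpoly_pderiv i f) x) = mpoly_eval (mpoly_pderiv i (mpoly_red f)) (red_vec x)"
  using mpoly_eval_pderiv[of "pkeys f" f i x] mpoly_eval_pderiv[of "pkeys f" "mpoly_red f" i "red_vec x"]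
    keys_mpoly_red[of f]
  by (simp add: red_monom_eval)

abbreviation prime_p :: "'p::prime_card padic_int" where "prime_p \<equiv> of_nat CARD('p)"

text \<open>The remainder \<open>D\<close> is only tracked modulo \<open>p\<close>. This is where
  \<open>j \<ge> 1\<close> enters: the quadratic term keeps a further factor \<open>p^j\<close> and
  dies under reduction. For \<open>n = 0\<close> the truncated exponent \<open>n - 1\<close> is
  multiplied by zero.\<close>

lemma power_taylor:
  fixes u v :: "'p::prime_card padic_int"
  assumes "j \<ge> 1"
  shows "\<exists>D. (u + prime_p ^ j * v) ^ n = u ^ n + prime_p ^ j * D \<and> red D = of_nat n * red u ^ (n - 1) * red v"
proof (induction n)
  case 0
  show ?case by (rule exI[of _ 0]) simp
next
  case (Suc n)
  then obtain D where D: "(u + prime_p ^ j * v) ^ n = u ^ n + prime_p ^ j * D"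
    "red D = of_nat n * red u ^ (n - 1) * red v" by blast
  show ?case
  proof (intro exI conjI)
    show "(u + prime_p ^ j * v) ^ Suc n = u ^ Suc n + prime_p ^ j * (u * D + v * u ^ n + prime_p ^ j * (v * D))"
      by (simp only: power_Suc D(1)) (simp add: algebra_simps)
    have "red (prime_p ^ j :: 'p padic_int) = 0" using assms by simp
    then show "red (u * D + v * u ^ n + prime_p ^ j * (v * D)) = of_nat (Suc n) * red u ^ (Suc n - 1) * red v"
      using assms by (cases n) (simp_all add: D algebra_simps power_0_left)
  qed
qed

text \<open>The Leibniz rule modulo \<open>p\<close>. The modified exponent keeps each summand a
  product over all of \<open>S\<close>; for \<open>S = UNIV\<close> it is literally the monomial
  with exponent \<open>\<omega> - axis i 1\<close>, as in \<open>mpoly_pderiv\<close>.\<close>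

lemma prod_taylor:
  fixes u v :: "'i \<Rightarrow> 'p::prime_card padic_int"
  assumes "j \<ge> 1" "finite S"
  shows "\<exists>D. (\<Prod>i\<in>S. (u i + prime_p ^ j * v i) ^ w i) = (\<Prod>i\<in>S. u i ^ w i) + prime_p ^ j * D \<and>
     red D = (\<Sum>i\<in>S. of_nat (w i) * (\<Prod>l\<in>S. red (u l) ^ (if l = i then w i - 1 else w l)) * red (v i))"
  using assms(2)
proof (induction S)
  case empty
  show ?case by (rule exI[of _ 0]) simp
next
  case (insert a S)
  then obtain D where D: "(\<Prod>i\<in>S. (u i + prime_p ^ j * v i) ^ w i) = (\<Prod>i\<in>S. u i ^ w i) + prime_p ^ j * D"
     "red D = (\<Sum>i\<in>S. of_nat (w i) * (\<Prod>l\<in>S. red (u l) ^ (if l = i then w i - 1 else w l)) * red (v i))"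
    by blast
  obtain E where E: "(u a + prime_p ^ j * v a) ^ w a = u a ^ w a + prime_p ^ j * E"
     "red E = of_nat (w a) * red (u a) ^ (w a - 1) * red (v a)" using power_taylor[OF assms(1)] by blast
  let ?P = "\<Prod>i\<in>S. u i ^ w i"
  show ?case
  proof (intro exI conjI)
    show "(\<Prod>i\<in>insert a S. (u i + prime_p ^ j * v i) ^ w i) = (\<Prod>i\<in>insert a S. u i ^ w i) + prime_p ^ j * (E * ?P + u a ^ w a * D + prime_p ^ j * (E * D))"
      by (simp only: prod.insert[OF insert.hyps] D(1) E(1)) (simp add: algebra_simps)
    have 1: "(\<Prod>l\<in>S. red (u l) ^ (if l = a then w a - 1 else w l)) = red ?P"
      unfolding red_prod red_power by (rule prod.cong) (use insert.hyps in auto)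
    have 2: "(\<Sum>i\<in>S. of_nat (w i) * (\<Prod>l\<in>insert a S. red (u l) ^ (if l = i then w i - 1 else w l)) * red (v i))
      = red (u a) ^ w a * red D"
      unfolding D(2) sum_distrib_left
      by (rule sum.cong) (use insert.hyps in \<open>auto simp: algebra_simps\<close>)
    have "red (prime_p ^ j :: 'p padic_int) = 0" using assms by simp
    then have "red (E * ?P + u a ^ w a * D + prime_p ^ j * (E * D)) = red E * red ?P + red (u a) ^ w a * red D"
      by (simp del: red_prod)
    also have "\<dots> =
      (\<Sum>i\<in>insert a S. of_nat (w i) * (\<Prod>l\<in>insert a S. red (u l) ^ (if l = i then w i - 1 else w l)) * red (v i))"
      unfolding sum.insert[OF insert.hyps] 2 E(2) using insert.hyps by (simp add: 1 mult_ac del: red_prod)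
    finally show "red (E * ?P + u a ^ w a * D + prime_p ^ j * (E * D)) =
      (\<Sum>i\<in>insert a S. of_nat (w i) * (\<Prod>l\<in>insert a S. red (u l) ^ (if l = i then w i - 1 else w l)) * red (v i))" .
  qed
qed

lemma monom_taylor:
  fixes u v :: "'p::prime_card padic_int ^ 'n::finite"
  assumes "j \<ge> 1"
  shows "\<exists>D. monom_eval \<omega> (u + (\<chi> i. prime_p ^ j * v $ i)) = monom_eval \<omega> u + prime_p ^ j * D \<and>
     red D = (\<Sum>i\<in>UNIV. of_nat (\<omega> $ i) * monom_eval (\<omega> - axis i 1) (red_vec u) * red (v $ i))"
proof -
  have "(\<omega> - axis i 1) $ l = (if l = i then \<omega> $ i - 1 else \<omega> $ l)" for i l
    by (simp add: axis_def)
  then show ?thesis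
    using prod_taylor[OF assms finite[of "UNIV :: 'n set"], of "\<lambda>i. u $ i" "\<lambda>i. v $ i" "\<lambda>i. \<omega> $ i"]
    unfolding monom_eval_def by simp
qed

definition scale_vec :: "nat^'n::finite \<Rightarrow> 'p::prime_card padic_int ^ 'n \<Rightarrow> 'p padic_int ^ 'n" where
  "scale_vec k u = (\<chi> i. prime_p ^ (k $ i) * u $ i)"

lemma monom_eval_scale_vec: "monom_eval \<omega> (scale_vec k u) = prime_p ^ nat_inner k \<omega> * monom_eval \<omega> u"
  by (simp add: monom_eval_def scale_vec_def power_mult_distrib prod.distrib nat_inner_def power_sum power_mult[symmetric])

text \<open>Value and first-order change are divided by the same power of \<open>p\<close>. What
  survives modulo \<open>p\<close> comes from the exponents that minimize \<open>k\<close>, so both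
  are governed by the face polynomial alone.\<close>

lemma mpoly_taylor:
  fixes f :: "('p :: prime_card padic_int, 'n :: finite) mpoly" and u v :: "'p padic_int ^ 'n" and k :: "nat ^ 'n"
  assumes f: "f \<noteq> 0" and j: "j \<ge> 1"
  defines "h \<equiv> mpoly_red (face_poly f (newton_F f (exponent_vec k)))"
  shows "\<exists>F D. mpoly_eval f (scale_vec k u) = prime_p ^ newton_min f k * F \<and>
     mpoly_eval f (scale_vec k (u + (\<chi> i. prime_p ^ j * v $ i))) = prime_p ^ newton_min f k * (F + prime_p ^ j * D) \<and>
     red F = mpoly_eval h (red_vec u) \<and>
     red D = (\<Sum>i\<in>UNIV. mpoly_eval (mpoly_pderiv i h) (red_vec u) * red (v $ i))"
proof -
  \<comment> \<open>The coefficients of \<open>f(p^k u) / p^m\<close>. The exponent difference is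
    nonnegative on the support and zero exactly on the face, so off the face \<open>c\<close>
    reduces to zero.\<close>
  define c where "c = (\<lambda>\<omega>. prime_p ^ (nat_inner k \<omega> - newton_min f k) * Poly_Mapping.lookup f \<omega>)"
  have c: "prime_p ^ newton_min f k * c \<omega> = prime_p ^ nat_inner k \<omega> * Poly_Mapping.lookup f \<omega>" if "\<omega> \<in> pkeys f" for \<omega>
    using newton_min_le[OF that, of k] by (simp add: c_def mult.assoc[symmetric] power_add[symmetric])
  have lh: "Poly_Mapping.lookup h \<omega> = (if \<omega> \<in> min_exponents f (exponent_vec k) then red (Poly_Mapping.lookup f \<omega>) else 0)" for \<omega>
    unfolding h_def lookup_mpoly_red lookup_face_poly[OF f exponent_vec_orthant] by simp
  have rc: "red (c \<omega>) = Poly_Mapping.lookup h \<omega>" if "\<omega> \<in> pkeys f" for \<omega>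
    using newton_min_le[OF that, of k] that unfolding lh min_exponents_exponent_vec c_def by auto
  have kh: "pkeys h \<subseteq> pkeys f"
    using lh by (auto simp: in_keys_iff min_exponents_def split: if_splits)
  have "\<forall>\<omega>. \<exists>D. monom_eval \<omega> (u + (\<chi> i. prime_p ^ j * v $ i)) = monom_eval \<omega> u + prime_p ^ j * D \<and>
     red D = (\<Sum>i\<in>UNIV. of_nat (\<omega> $ i) * monom_eval (\<omega> - axis i 1) (red_vec u) * red (v $ i))"
    using monom_taylor[OF j] by blast
  from choice[OF this] obtain D
    where D: "\<And>\<omega>. monom_eval \<omega> (u + (\<chi> i. prime_p ^ j * v $ i)) = monom_eval \<omega> u + prime_p ^ j * D \<omega>"
     "\<And>\<omega>. red (D \<omega>) = (\<Sum>i\<in>UNIV. of_nat (\<omega> $ i) * monom_eval (\<omega> - axis i 1) (red_vec u) * red (v $ i))"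
    by blast
  have ev: "mpoly_eval f (scale_vec k y) = prime_p ^ newton_min f k * (\<Sum>\<omega>\<in>pkeys f. c \<omega> * monom_eval \<omega> y)" for y
    unfolding mpoly_eval_superset[OF finite_keys subset_refl] sum_distrib_left monom_eval_scale_vec
  proof (rule sum.cong)
    fix \<omega> assume "\<omega> \<in> pkeys f"
    have "Poly_Mapping.lookup f \<omega> * (prime_p ^ nat_inner k \<omega> * monom_eval \<omega> y) =
        prime_p ^ nat_inner k \<omega> * Poly_Mapping.lookup f \<omega> * monom_eval \<omega> y" by (simp only: mult_ac)
    also have "\<dots> = prime_p ^ newton_min f k * (c \<omega> * monom_eval \<omega> y)"
      unfolding c[OF \<open>\<omega> \<in> pkeys f\<close>, symmetric] by (rule mult.assoc)
    finally show "Poly_Mapping.lookup f \<omega> * (prime_p ^ nat_inner k \<omega> * monom_eval \<omega> y) = prime_p ^ newton_min f k * (c \<omega> * monom_eval \<omega> y)" .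
  qed simp
  show ?thesis
  proof (intro exI conjI)
    show "mpoly_eval f (scale_vec k u) = prime_p ^ newton_min f k * (\<Sum>\<omega>\<in>pkeys f. c \<omega> * monom_eval \<omega> u)" by (rule ev)
    show "mpoly_eval f (scale_vec k (u + (\<chi> i. prime_p ^ j * v $ i))) =
       prime_p ^ newton_min f k * ((\<Sum>\<omega>\<in>pkeys f. c \<omega> * monom_eval \<omega> u) + prime_p ^ j * (\<Sum>\<omega>\<in>pkeys f. c \<omega> * D \<omega>))"
      unfolding ev D by (simp add: algebra_simps sum.distrib sum_distrib_left)
    show "red (\<Sum>\<omega>\<in>pkeys f. c \<omega> * monom_eval \<omega> u) = mpoly_eval h (red_vec u)"
      unfolding mpoly_eval_superset[OF finite_keys kh] by (simp add: rc red_monom_eval)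
    have "red (\<Sum>\<omega>\<in>pkeys f. c \<omega> * D \<omega>) =
       (\<Sum>\<omega>\<in>pkeys f. \<Sum>i\<in>UNIV. of_nat (\<omega> $ i) * Poly_Mapping.lookup h \<omega> * monom_eval (\<omega> - axis i 1) (red_vec u) * red (v $ i))"
      by (simp add: rc D sum_distrib_left mult_ac)
    also have "\<dots> = (\<Sum>i\<in>UNIV. mpoly_eval (mpoly_pderiv i h) (red_vec u) * red (v $ i))"
      unfolding mpoly_eval_pderiv[OF finite_keys kh] sum_distrib_right by (rule sum.swap)
    finally show "red (\<Sum>\<omega>\<in>pkeys f. c \<omega> * D \<omega>) = (\<Sum>i\<in>UNIV. mpoly_eval (mpoly_pderiv i h) (red_vec u) * red (v $ i))" .
  qed
qed

section \<open>Boxes and the Haar measure\<close>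

text \<open>The base \<open>p\<close> digit at place \<open>m\<close>, taken in the field with
  \<open>p\<close> elements so that raising it by one is cyclic and no carry has to be
  discussed.\<close>

definition digit :: "nat \<Rightarrow> 'p :: prime_card padic_int \<Rightarrow> 'p mod_ring" where
  "digit m w = of_int (residue w (Suc m) div int CARD('p) ^ m)"

lemma digit_CARD_power_mult: "digit m (prime_p ^ m * y) = red (y :: 'p :: prime_card padic_int)"
proof -
  have "int CARD('p) ^ m > 0" using CARD_prime_gt[where ?'p = 'p] by simp
  then show ?thesis
    using residue_CARD_power_mult[of m y 1] by (simp add: digit_def red_def)
qed

lemma digit_eq_0_iff:
  fixes w :: "'p :: prime_card padic_int"
  assumes "prime_p ^ m dvd w"
  shows "digit m w = 0 \<longleftrightarrow> prime_p ^ Suc m dvd w"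
proof -
  obtain y where "w = prime_p ^ m * y" using assms by (auto simp: dvd_def)
  then show ?thesis using digit_CARD_power_mult[of m y] CARD_power_dvd_cancel[of m 1 y] red_eq_0_iff[of y] by simp
qed

lemma residue_diff_dvd: "residue x k = residue y k \<longleftrightarrow> prime_p ^ k dvd (x - y :: 'p :: prime_card padic_int)"
  by (simp add: dvd_iff_residue residue_diff_eq_0_iff)

section \<open>Congruences, continuity and measurability of polynomial maps\<close>

lemma dvd_power_diff:
  fixes x y :: "'a :: comm_ring_1"
  assumes "d dvd x - y"
  shows "d dvd x ^ n - y ^ n"
proof (induction n)
  case (Suc n)
  have "x ^ Suc n - y ^ Suc n = x * (x ^ n - y ^ n) + (x - y) * y ^ n" by (simp add: algebra_simps)
  then show ?case using Suc assms by simp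
qed simp

lemma dvd_prod_diff:
  fixes x y :: "'i \<Rightarrow> 'a :: comm_ring_1"
  assumes "\<And>i. d dvd x i - y i"
  shows "d dvd prod x S - prod y S"
proof (induction S rule: infinite_finite_induct)
  case (insert a S)
  have "x a * prod x S - y a * prod y S = x a * (prod x S - prod y S) + (x a - y a) * prod y S" by (simp add: algebra_simps)
  then show ?case using insert assms by simp
qed simp_all

lemma dvd_mpoly_eval_diff:
  fixes x y :: "'a :: comm_ring_1 ^ 'n :: finite"
  assumes "\<And>i. d dvd x $ i - y $ i"
  shows "d dvd mpoly_eval f x - mpoly_eval f y"
  unfolding mpoly_eval_def sum_subtractf[symmetric] right_diff_distrib[symmetric]
  by (intro dvd_sum dvd_mult dvd_prod_diff dvd_power_diff assms)

lemma cylinder_self: "x \<in> cylinder K x"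
  by (simp add: cylinder_def)

lemma residue_mpoly_eval_cong:
  "y \<in> cylinder K x \<Longrightarrow> residue (mpoly_eval f y) K = residue (mpoly_eval f x) K"
  unfolding residue_diff_dvd cylinder_def by (intro dvd_mpoly_eval_diff) simp

lemma continuous_mpoly_eval: "continuous_on UNIV (mpoly_eval (f :: ('p :: prime_card padic_int, 'n :: finite) mpoly))"
proof -
  have "open (mpoly_eval f -` U)" if U: "open U" for U
  proof (subst open_subopen, intro ballI)
    fix x assume "x \<in> mpoly_eval f -` U"
    then obtain e where e: "e > 0" "\<And>z. dist z (mpoly_eval f x) < e \<Longrightarrow> z \<in> U"
      using U unfolding open_dist by auto
    have p: "1 < real CARD('p)" using CARD_prime_gt[where ?'p = 'p] by simp
    then obtain K where "1 / e < real CARD('p) ^ K" using real_arch_pow by blast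
    then have small: "1 / real CARD('p) ^ K < e" using e(1) p by (simp add: field_simps)
    have "cylinder K x \<subseteq> mpoly_eval f -` U"
    proof
      fix y assume "y \<in> cylinder K x"
      then have "dist (mpoly_eval f y) (mpoly_eval f x) \<le> 1 / real CARD('p) ^ K"
        unfolding dist_padic_le_iff by (rule residue_mpoly_eval_cong)
      then show "y \<in> mpoly_eval f -` U" using e(2) small by auto
    qed
    then show "\<exists>T. open T \<and> x \<in> T \<and> T \<subseteq> mpoly_eval f -` U"
      using open_cylinder[of K x] cylinder_self[of x K] by blast
  qed
  then show ?thesis by (auto simp: continuous_on_open_vimage)
qed

lemma measurable_residue_mpoly:
  "(\<lambda>x. residue (mpoly_eval f x) K) \<in> measurable borel (count_space UNIV)"
  for f :: "('p :: prime_card padic_int, 'n :: finite) mpoly"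
proof (rule measurableI)
  fix S :: "int set"
  have "(\<lambda>x. residue (mpoly_eval f x) K) -` S = mpoly_eval f -` (\<Union>c\<in>S. {y. residue y K = c})" by auto
  also have "open \<dots>"
    using continuous_mpoly_eval[of f] open_UN[of S "\<lambda>c. {y :: 'p padic_int. residue y K = c}"] open_residue
    by (auto simp only: continuous_on_open_vimage[OF open_UNIV] Int_UNIV_right)
  finally have "open ((\<lambda>x. residue (mpoly_eval f x) K) -` S)" .
  then show "(\<lambda>x. residue (mpoly_eval f x) K) -` S \<inter> space borel \<in> sets borel" by simp
qed simp

lemma sets_borel_cylinder_closed:
  fixes U :: "('p :: prime_card padic_int ^ 'n :: finite) set"
  assumes "\<And>x. x \<in> U \<Longrightarrow> cylinder K x \<subseteq> U"
  shows "U \<in> sets borel"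
proof (rule borel_open, subst open_subopen, intro ballI)
  fix x assume "x \<in> U"
  then show "\<exists>T. open T \<and> x \<in> T \<and> T \<subseteq> U"
    using assms[of x] open_cylinder[of K x] cylinder_self[of x K] by blast
qed

section \<open>Translation invariance and the measure of congruence classes\<close>

locale haar =
  fixes \<mu> :: "('p :: prime_card padic_int ^ 'n :: finite) measure"
  assumes haar: "normalized_haar \<mu>"
begin

lemma sets_haar [measurable_cong, simp]: "sets \<mu> = sets borel"
  using haar by (simp add: normalized_haar_def)

lemma space_haar [simp]: "space \<mu> = UNIV"
  using sets_eq_imp_space_eq[OF sets_haar] by simp

sublocale prob_space \<mu>
  by (rule prob_spaceI) (use haar in \<open>simp add: normalized_haar_def\<close>)

lemma measurable_shift: "(\<lambda>x. a + x) \<in> measurable \<mu> \<mu>"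
proof -
  have "continuous_on UNIV (\<lambda>x :: 'p padic_int ^ 'n. a + x)"
  proof -
    have "open ((\<lambda>x. a + x) -` U)" if U: "open U" for U :: "('p padic_int ^ 'n) set"
    proof (subst open_subopen, intro ballI)
      fix x assume "x \<in> (\<lambda>x. a + x) -` U"
      then obtain K where K: "cylinder K (a + x) \<subseteq> U" using open_contains_cylinder[OF U] by auto
      have "a + y \<in> cylinder K (a + x)" if "y \<in> cylinder K x" for y
        using that by (simp add: cylinder_def residue_diff_dvd)
      then have "cylinder K x \<subseteq> (\<lambda>x. a + x) -` U" using K by blast
      moreover note cylinder_self[of x K]
      ultimately show "\<exists>T. open T \<and> x \<in> T \<and> T \<subseteq> (\<lambda>x. a + x) -` U"
        using open_cylinder[of K x] by blast
    qed
    then show ?thesis by (auto simp: continuous_on_open_vimage)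
  qed
  then have "(\<lambda>x. a + x) \<in> borel_measurable borel" by (rule borel_measurable_continuous_onI)
  then show ?thesis by (simp add: measurable_cong_sets[OF sets_haar sets_haar])
qed

lemma measure_shift:
  assumes "S \<in> sets borel"
  shows "measure \<mu> ((\<lambda>x. a + x) -` S) = measure \<mu> S"
proof -
  have "measure \<mu> S = measure (distr \<mu> \<mu> (\<lambda>x. a + x)) S"
    using haar by (simp add: normalized_haar_def)
  also have "\<dots> = measure \<mu> ((\<lambda>x. a + x) -` S)"
    using measure_distr[OF measurable_shift[of a], of S] assms by simp
  finally show ?thesis by simp
qed

text \<open>Translation by \<open>e\<close> permutes the \<open>p\<close> fibres of \<open>c\<close>
  on \<open>A\<close> cyclically, so they all have the same measure. Invariance of \<open>A\<close>
  is needed in both directions for the preimage of a fibre to be a full fibre. Every use of the Haar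
  measure below goes through this lemma.\<close>

lemma measure_split:
  fixes c :: "'p padic_int ^ 'n \<Rightarrow> 'p mod_ring"
  assumes sets: "\<And>t. {x \<in> A. c x = t} \<in> sets borel"
    and inv: "\<And>x. x \<in> A \<Longrightarrow> e + x \<in> A" "\<And>x. x \<in> A \<Longrightarrow> x - e \<in> A"
    and c: "\<And>x. x \<in> A \<Longrightarrow> c (e + x) = c x + 1"
  shows "measure \<mu> {x \<in> A. c x = 0} = measure \<mu> A / real CARD('p)"
proof -
  have step: "measure \<mu> {x \<in> A. c x = t + 1} = measure \<mu> {x \<in> A. c x = t}" for t
  proof -
    have "(\<lambda>x. e + x) -` {x \<in> A. c x = t + 1} = {x \<in> A. c x = t}"
    proof (intro equalityI subsetI)
      fix x assume "x \<in> (\<lambda>x. e + x) -` {x \<in> A. c x = t + 1}"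
      then have x: "e + x \<in> A" "c (e + x) = t + 1" by auto
      from inv(2)[OF x(1)] have "x \<in> A" by simp
      with x c[of x] show "x \<in> {x \<in> A. c x = t}" by simp
    qed (use inv c in auto)
    with measure_shift[OF sets[of "t + 1"], of e] show ?thesis by simp
  qed
  have nat: "measure \<mu> {x \<in> A. c x = of_nat m} = measure \<mu> {x \<in> A. c x = 0}" for m
    by (induction m) (use step in \<open>simp_all add: add.commute[of 1]\<close>)
  have all: "measure \<mu> {x \<in> A. c x = t} = measure \<mu> {x \<in> A. c x = 0}" for t
  proof -
    obtain m where m: "t = of_nat m" using surj_of_nat_mod_ring[of t] by blast
    show ?thesis unfolding m by (rule nat)
  qed
  have "measure \<mu> A = measure \<mu> (\<Union>t\<in>UNIV. {x \<in> A. c x = t})" by (rule arg_cong[where f = "measure \<mu>"]) auto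
  also have "\<dots> = (\<Sum>t\<in>UNIV. measure \<mu> {x \<in> A. c x = t})"
    by (rule finite_measure_finite_Union) (use sets in \<open>auto simp: disjoint_family_on_def\<close>)
  also have "\<dots> = (\<Sum>t\<in>(UNIV :: 'p mod_ring set). measure \<mu> {x \<in> A. c x = 0})"
    by (rule sum.cong) (use all in auto)
  also have "\<dots> = real CARD('p) * measure \<mu> {x \<in> A. c x = 0}"
    by simp
  finally show ?thesis by simp
qed

definition box :: "nat ^ 'n \<Rightarrow> 'p padic_int ^ 'n \<Rightarrow> ('p padic_int ^ 'n) set" where
  "box \<kappa> z = {x. \<forall>i. prime_p ^ (\<kappa> $ i) dvd x $ i - z $ i}"

lemma cylinder_dvd: "y \<in> cylinder K x \<longleftrightarrow> (\<forall>i. prime_p ^ K dvd y $ i - (x $ i :: 'p padic_int))"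
  by (simp add: cylinder_def residue_diff_dvd)

text \<open>One modulus is lowered by a factor \<open>p\<close>; within the larger box the missing
  condition is the vanishing of one digit, which translation along that axis raises by one.
  Measurability is carried through the same induction.\<close>

lemma measure_box: "box \<kappa> z \<in> sets borel \<and> measure \<mu> (box \<kappa> z) = (1 / real CARD('p)) ^ (\<Sum>i\<in>UNIV. \<kappa> $ i)"
proof (induction "\<Sum>i\<in>UNIV. \<kappa> $ i" arbitrary: \<kappa>)
  case 0
  then have "box \<kappa> z = UNIV" by (simp add: box_def)
  then show ?case using 0 prob_space by simp
next
  case (Suc m)
  have "\<exists>i. \<kappa> $ i \<noteq> 0"
  proof (rule ccontr)
    assume "\<not> ?thesis"
    then show False using Suc(2) by simp
  qed
  then obtain i where i: "\<kappa> $ i \<noteq> 0" by blast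
  define \<kappa>' where "\<kappa>' = (\<chi> l. if l = i then \<kappa> $ i - 1 else \<kappa> $ l)"
  have k'i: "\<kappa> $ i = Suc (\<kappa>' $ i)" "l \<noteq> i \<Longrightarrow> \<kappa>' $ l = \<kappa> $ l" for l using i by (auto simp: \<kappa>'_def)
  have m: "m = (\<Sum>i\<in>UNIV. \<kappa>' $ i)"
    using Suc(2) by (simp add: sum.remove[of UNIV i] k'i)
  note IH = Suc(1)[OF m]
  let ?c = "\<lambda>x :: 'p padic_int ^ 'n. digit (\<kappa>' $ i) (x $ i - z $ i)"
  let ?e = "axis i (prime_p ^ (\<kappa>' $ i)) :: 'p padic_int ^ 'n"
  \<comment> \<open>A level beyond all moduli and beyond the digit in question: box and digit only
    depend on the residues modulo \<open>p^K\<close>, which makes the set a union of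
    cylinders.\<close>
  define K where "K = Suc (Max (range (\<lambda>i. \<kappa> $ i)))"
  have K: "\<kappa>' $ l \<le> K" "Suc (\<kappa>' $ i) \<le> K" for l
  proof -
    have M: "\<kappa> $ l \<le> Max (range (\<lambda>i. \<kappa> $ i))" for l by (rule Max_ge) auto
    have "\<kappa>' $ l \<le> \<kappa> $ l" by (simp add: \<kappa>'_def)
    then show "\<kappa>' $ l \<le> K" unfolding K_def using M[of l] by linarith
    show "Suc (\<kappa>' $ i) \<le> K" using M[of i] k'i(1) by (simp add: K_def)
  qed
  have inv: "x + ?e \<in> box \<kappa>' z \<longleftrightarrow> x \<in> box \<kappa>' z" for x
  proof -
    have "prime_p ^ (\<kappa>' $ l) dvd (x + ?e) $ l - z $ l \<longleftrightarrow> prime_p ^ (\<kappa>' $ l) dvd x $ l - z $ l" for l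
    proof -
      have "prime_p ^ (\<kappa>' $ l) dvd ?e $ l" by (simp add: axis_def)
      moreover have "(x + ?e) $ l - z $ l = (x $ l - z $ l) + ?e $ l" by simp
      ultimately show ?thesis using dvd_add_left_iff by metis
    qed
    then show ?thesis by (simp add: box_def)
  qed
  have sets: "{x \<in> box \<kappa>' z. ?c x = t} \<in> sets borel" for t
  proof (rule sets_borel_cylinder_closed)
    fix x assume x: "x \<in> {x \<in> box \<kappa>' z. ?c x = t}"
    show "cylinder K x \<subseteq> {x \<in> box \<kappa>' z. ?c x = t}"
    proof
      fix y assume y: "y \<in> cylinder K x"
      have d: "prime_p ^ j dvd y $ l - x $ l" if "j \<le> K" for j l
        using dvd_trans[OF le_imp_power_dvd[OF that]] y unfolding cylinder_dvd by blast
      have "y \<in> box \<kappa>' z" unfolding box_def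
      proof (intro CollectI allI)
        fix l
        have "prime_p ^ (\<kappa>' $ l) dvd (x $ l - z $ l) + (y $ l - x $ l)"
          using x d[OF K(1)] by (intro dvd_add) (auto simp: box_def)
        then show "prime_p ^ (\<kappa>' $ l) dvd y $ l - z $ l" by simp
      qed
      moreover have "residue (y $ i - z $ i) (Suc (\<kappa>' $ i)) = residue (x $ i - z $ i) (Suc (\<kappa>' $ i))"
        unfolding residue_diff_dvd using d[OF K(2), of i] by simp
      then have "?c y = ?c x" by (simp add: digit_def)
      ultimately show "y \<in> {x \<in> box \<kappa>' z. ?c x = t}" using x by simp
    qed
  qed
  have eq: "{x \<in> box \<kappa>' z. ?c x = 0} = box \<kappa> z"
  proof -
    have sp: "(\<forall>l. P l) \<longleftrightarrow> P i \<and> (\<forall>l. l \<noteq> i \<longrightarrow> P l)" for P by metis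
    have "x \<in> box \<kappa> z \<longleftrightarrow> prime_p ^ Suc (\<kappa>' $ i) dvd x $ i - z $ i \<and> (\<forall>l. l \<noteq> i \<longrightarrow> prime_p ^ (\<kappa>' $ l) dvd x $ l - z $ l)" for x
      unfolding box_def mem_Collect_eq by (subst sp) (simp add: k'i del: power_Suc)
    moreover have "x \<in> box \<kappa>' z \<longleftrightarrow> prime_p ^ (\<kappa>' $ i) dvd x $ i - z $ i \<and> (\<forall>l. l \<noteq> i \<longrightarrow> prime_p ^ (\<kappa>' $ l) dvd x $ l - z $ l)" for x
      unfolding box_def mem_Collect_eq by (rule sp)
    moreover have "prime_p ^ Suc (\<kappa>' $ i) dvd x $ i - z $ i \<longleftrightarrow> prime_p ^ (\<kappa>' $ i) dvd x $ i - z $ i \<and> ?c x = 0" for x :: "'p padic_int ^ 'n"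
      using digit_eq_0_iff[of "\<kappa>' $ i" "x $ i - z $ i"] dvd_trans[OF le_imp_power_dvd[of "\<kappa>' $ i" "Suc (\<kappa>' $ i)" prime_p], of "x $ i - z $ i"]
      by auto
    ultimately show ?thesis by blast
  qed
  have "measure \<mu> {x \<in> box \<kappa>' z. ?c x = 0} = measure \<mu> (box \<kappa>' z) / real CARD('p)"
  proof (rule measure_split[where e = ?e, OF sets])
    fix x assume x: "x \<in> box \<kappa>' z"
    show "?e + x \<in> box \<kappa>' z" using inv x by (simp add: add.commute)
    show "x - ?e \<in> box \<kappa>' z" using inv[of "x - ?e"] x by simp
    obtain y where y: "x $ i - z $ i = prime_p ^ (\<kappa>' $ i) * y" using x by (auto simp: box_def dvd_def)
    then have "(?e + x) $ i - z $ i = prime_p ^ (\<kappa>' $ i) * (y + 1)" by (simp add: algebra_simps)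
    then show "?c (?e + x) = ?c x + 1" unfolding y by (simp add: digit_CARD_power_mult)
  qed
  then show ?case using IH sets[of 0] Suc(2)[symmetric] m[symmetric] unfolding eq by simp
qed

end

section \<open>Integration over countable partitions\<close>

text \<open>Unconditional convergence is the point, since the pieces are regrouped later, by
  valuation, by shell and by cone. The sums of the integrals of the norms are bounded by the
  integral of the norm of \<open>h\<close>.\<close>

lemma has_sum_integral_nat:
  fixes h :: "'a \<Rightarrow> complex"
  assumes A: "\<And>i :: nat. A i \<in> sets M" and disj: "disjoint_family A"
    and h: "integrable M h" and ae: "AE x in M. x \<notin> (\<Union>i. A i) \<longrightarrow> h x = 0"
  shows "((\<lambda>i. \<integral>x. indicator (A i) x * h x \<partial>M) has_sum (\<integral>x. h x \<partial>M)) UNIV"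
proof -
  define u where "u = (\<lambda>i x. indicator (A i) x * h x)"
  have eq: "indicator (A i) x * h x = indicator (A i) x *\<^sub>R h x" for i x
    by (simp add: indicator_def)
  have u_int: "integrable M (u i)" for i
    unfolding u_def eq using A h by (rule integrable_mult_indicator)
  \<comment> \<open>By disjointness at most one term is nonzero at each point, so all pointwise
    series are finite sums.\<close>
  have zero: "u i x = 0" if "x \<in> A j" "i \<noteq> j" for i j x
    using that disj by (auto simp: u_def disjoint_family_on_def indicator_def)
  have usum: "(\<lambda>i. u i x) sums (indicator (\<Union>i. A i) x * h x)" for x
  proof (cases "x \<in> (\<Union>i. A i)")
    case True
    then obtain j where j: "x \<in> A j" by blast
    have "(\<lambda>i. u i x) sums (\<Sum>i\<in>{j}. u i x)"
      by (rule sums_finite) (use zero[OF j] in auto)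
    then show ?thesis using j True by (simp add: u_def)
  qed (auto simp: u_def)
  have nsum: "(\<lambda>i. norm (u i x)) sums norm (indicator (\<Union>i. A i) x * h x)" for x
  proof (cases "x \<in> (\<Union>i. A i)")
    case True
    then obtain j where j: "x \<in> A j" by blast
    have "(\<lambda>i. norm (u i x)) sums (\<Sum>i\<in>{j}. norm (u i x))"
      by (rule sums_finite) (use zero[OF j] in auto)
    then show ?thesis using j True by (simp add: u_def)
  qed (auto simp: u_def)
  have bound: "(\<Sum>i<n. \<integral>x. norm (u i x) \<partial>M) \<le> (\<integral>x. norm (h x) \<partial>M)" for n
  proof -
    have "(\<Sum>i<n. \<integral>x. norm (u i x) \<partial>M) = (\<integral>x. (\<Sum>i<n. norm (u i x)) \<partial>M)"
      using u_int by (subst Bochner_Integration.integral_sum) auto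
    also have "\<dots> \<le> (\<integral>x. norm (h x) \<partial>M)"
    proof (rule integral_mono)
      fix x
      have "(\<Sum>i<n. norm (u i x)) \<le> norm (indicator (\<Union>i. A i) x * h x)"
        using sum_le_suminf[OF sums_summable[OF nsum], of "{..<n}" x] sums_unique[OF nsum, of x] by simp
      also have "\<dots> \<le> norm (h x)" by (simp add: indicator_def norm_mult)
      finally show "(\<Sum>i<n. norm (u i x)) \<le> norm (h x)" .
    qed (use u_int h in auto)
    finally show ?thesis .
  qed
  have summ: "summable (\<lambda>i. \<integral>x. norm (u i x) \<partial>M)"
    by (rule summableI_nonneg_bounded[OF _ bound]) auto
  have "(\<lambda>i. \<integral>x. u i x \<partial>M) sums (\<integral>x. suminf (\<lambda>i. u i x) \<partial>M)"
    by (rule sums_integral[OF u_int _ summ]) (use nsum in \<open>auto simp: sums_iff\<close>)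
  also have "(\<integral>x. suminf (\<lambda>i. u i x) \<partial>M) = (\<integral>x. h x \<partial>M)"
  proof (rule integral_cong_AE)
    have "(\<lambda>x. suminf (\<lambda>i. u i x)) = (\<lambda>x. indicator (\<Union>i. A i) x * h x)" using usum by (auto simp: sums_iff)
    moreover have "(\<lambda>x. indicator (\<Union>i. A i) x *\<^sub>R h x) \<in> borel_measurable M"
      using A h by (intro borel_measurable_scaleR borel_measurable_indicator) auto
    moreover have "indicator (\<Union>i. A i) x * h x = indicator (\<Union>i. A i) x *\<^sub>R h x" for x
      by (simp add: indicator_def)
    ultimately show "(\<lambda>x. suminf (\<lambda>i. u i x)) \<in> borel_measurable M" by simp
    show "AE x in M. suminf (\<lambda>i. u i x) = h x"
      using ae by eventually_elim (use usum in \<open>auto simp: sums_iff indicator_def\<close>)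
  qed (use h in auto)
  finally have S: "(\<lambda>i. \<integral>x. u i x \<partial>M) sums (\<integral>x. h x \<partial>M)" .
  have "summable (\<lambda>i. norm (\<integral>x. u i x \<partial>M))"
    by (rule summable_comparison_test'[OF summ, of 0]) (simp add: integral_norm_bound)
  from norm_summable_imp_has_sum[OF this S] show ?thesis by (simp add: u_def)
qed

lemma has_sum_integral_partition:
  fixes h :: "'a \<Rightarrow> complex"
  assumes I: "countable I" and A: "\<And>i. i \<in> I \<Longrightarrow> A i \<in> sets M" and disj: "disjoint_family_on A I"
    and h: "integrable M h" and ae: "AE x in M. x \<notin> (\<Union>i\<in>I. A i) \<longrightarrow> h x = 0"
  shows "((\<lambda>i. \<integral>x. indicator (A i) x * h x \<partial>M) has_sum (\<integral>x. h x \<partial>M)) I"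
proof -
  let ?t = "to_nat_on I"
  define B where "B = (\<lambda>n. if n \<in> ?t ` I then A (from_nat_into I n) else {})"
  have inj: "inj_on ?t I" by (rule inj_on_to_nat_on[OF I])
  have Bt: "B (?t i) = A i" if "i \<in> I" for i using that I by (simp add: B_def)
  have U: "(\<Union>n. B n) = (\<Union>i\<in>I. A i)"
  proof
    show "(\<Union>i\<in>I. A i) \<subseteq> (\<Union>n. B n)" using Bt by blast
    show "(\<Union>n. B n) \<subseteq> (\<Union>i\<in>I. A i)"
      using Bt by (auto simp: B_def I)
  qed
  have "((\<lambda>n. \<integral>x. indicator (B n) x * h x \<partial>M) has_sum (\<integral>x. h x \<partial>M)) UNIV"
  proof (rule has_sum_integral_nat[OF _ _ h])
    show "B n \<in> sets M" for n using A Bt by (auto simp: B_def I)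
    show "disjoint_family B"
      using disj Bt by (fastforce simp: disjoint_family_on_def B_def I)
    show "AE x in M. x \<notin> (\<Union>i. B i) \<longrightarrow> h x = 0" unfolding U by (rule ae)
  qed
  also have "?this \<longleftrightarrow> ((\<lambda>n. \<integral>x. indicator (B n) x * h x \<partial>M) has_sum (\<integral>x. h x \<partial>M)) (?t ` I)"
    by (rule has_sum_cong_neutral) (auto simp: B_def)
  also have "\<dots> \<longleftrightarrow> ((\<lambda>i. \<integral>x. indicator (B (?t i)) x * h x \<partial>M) has_sum (\<integral>x. h x \<partial>M)) I"
    by (subst has_sum_reindex[OF inj]) (simp add: o_def)
  also have "\<dots> \<longleftrightarrow> ?thesis" by (rule has_sum_cong) (simp add: Bt)
  finally show ?thesis .
qed

text \<open>The truncated subtraction gives weight one to both \<open>j = 0\<close> and \<open>j = 1\<close>: a value that vanishes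
  modulo \<open>p\<close> has valuation at least one.\<close>

definition tail_weight :: "real \<Rightarrow> bool \<Rightarrow> nat \<Rightarrow> real" where
  "tail_weight q u j = (if u then (if j = 0 then 1 else 0) else q ^ (j - 1))"

lemma has_sum_geometric:
  fixes z :: complex assumes "norm z < 1"
  shows "((\<lambda>n. z ^ n) has_sum (1 / (1 - z))) UNIV"
  by (rule norm_summable_imp_has_sum)
    (use assms geometric_sums[OF assms] in \<open>auto simp: norm_power summable_geometric\<close>)

text \<open>Consecutive tail weights differ by the probability that the excess valuation is exactly
  \<open>j\<close>, so this is the expectation of \<open>z^j\<close>. In the non-unit case the term
  \<open>j = 0\<close> vanishes and the geometric series starts at \<open>1\<close>.\<close>

lemma has_sum_tail_weight:
  fixes z :: complex
  assumes z: "norm z \<le> 1" and q: "0 < q" "q < 1"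
  shows "((\<lambda>j. z ^ j * of_real (tail_weight q u j - tail_weight q u (Suc j))) has_sum
     (if u then 1 else z * (1 - of_real q) / (1 - z * of_real q))) UNIV"
proof (cases u)
  case True
  have "((\<lambda>j. z ^ j * of_real (tail_weight q u j - tail_weight q u (Suc j))) has_sum
     (\<Sum>j\<in>{0}. z ^ j * of_real (tail_weight q u j - tail_weight q u (Suc j)))) {0}"
    by (rule has_sum_finite) simp
  also have "?this \<longleftrightarrow> ((\<lambda>j. z ^ j * of_real (tail_weight q u j - tail_weight q u (Suc j))) has_sum
     (\<Sum>j\<in>{0}. z ^ j * of_real (tail_weight q u j - tail_weight q u (Suc j)))) UNIV"
    by (rule has_sum_cong_neutral) (use True in \<open>auto simp: tail_weight_def\<close>)
  finally show ?thesis using True by (simp add: tail_weight_def)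
next
  case False
  have "norm (z * of_real q) \<le> q" using z q by (simp add: norm_mult mult_left_le_one_le)
  then have "norm (z * of_real q) < 1" using q by simp
  then have "((\<lambda>n. z * (1 - of_real q) * (z * of_real q) ^ n) has_sum (z * (1 - of_real q) * (1 / (1 - z * of_real q)))) UNIV"
    by (intro has_sum_cmult_right has_sum_geometric)
  also have "(\<lambda>n. z * (1 - of_real q) * (z * of_real q) ^ n) =
     (\<lambda>j. z ^ j * of_real (tail_weight q u j - tail_weight q u (Suc j))) \<circ> Suc"
    using False by (auto simp: tail_weight_def fun_eq_iff algebra_simps power_mult_distrib)
  finally have "((\<lambda>j. z ^ j * of_real (tail_weight q u j - tail_weight q u (Suc j))) has_sum
     (z * (1 - of_real q) * (1 / (1 - z * of_real q)))) (range Suc)"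
    by (subst has_sum_reindex) (simp, assumption)
  also have "?this \<longleftrightarrow> ((\<lambda>j. z ^ j * of_real (tail_weight q u j - tail_weight q u (Suc j))) has_sum
     (z * (1 - of_real q) * (1 / (1 - z * of_real q)))) UNIV"
  proof (rule has_sum_cong_neutral)
    fix j :: nat assume "j \<in> UNIV - range Suc"
    then have "j = 0" by (cases j) auto
    then show "z ^ j * of_real (tail_weight q u j - tail_weight q u (Suc j)) = 0"
      using False by (simp add: tail_weight_def)
  qed auto
  finally show ?thesis using False by simp
qed

section \<open>Valuations on a shell\<close>

definition reduced_face :: "('p :: prime_card padic_int, 'n :: finite) mpoly \<Rightarrow> nat^'n \<Rightarrow> ('p mod_ring, 'n) mpoly" where
  "reduced_face f k = mpoly_red (face_poly f (newton_F f (exponent_vec k)))"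

text \<open>The differential of \<open>h\<close> at \<open>a\<close> in a direction
  \<open>v\<close>. The direction is p-adic rather than reduced because it is also used to
  translate.\<close>

definition dirderiv :: "('p :: prime_card mod_ring, 'n :: finite) mpoly \<Rightarrow> 'p mod_ring ^ 'n \<Rightarrow> 'p padic_int ^ 'n \<Rightarrow> 'p mod_ring" where
  "dirderiv h a v = (\<Sum>i\<in>UNIV. mpoly_eval (mpoly_pderiv i h) a * red (v $ i))"

definition shell :: "nat^'n::finite \<Rightarrow> 'p::prime_card mod_ring ^ 'n \<Rightarrow> ('p padic_int ^ 'n) set" where
  "shell k a = {scale_vec k u | u. red_vec u = a}"

text \<open>Lower bounds on the valuations rather than exact values: these sets are nested, and
  passing from one to the next is the vanishing of a single digit, to which
  \<open>measure_split\<close> applies.\<close>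

definition level :: "('p :: prime_card padic_int, 'n :: finite) mpoly \<Rightarrow> ('p padic_int, 'n) mpoly \<Rightarrow> nat^'n \<Rightarrow>
    'p mod_ring ^ 'n \<Rightarrow> nat \<Rightarrow> nat \<Rightarrow> ('p padic_int ^ 'n) set" where
  "level f g k a j l = {x \<in> shell k a. prime_p ^ (newton_min f k + j) dvd mpoly_eval f x \<and> prime_p ^ (newton_min g k + l) dvd mpoly_eval g x}"

lemma level_commute: "level f g k a j l = level g f k a l j"
  by (auto simp: level_def)

lemma red_vec_surj: "\<exists>z. red_vec z = (a :: 'p :: prime_card mod_ring ^ 'n :: finite)"
proof -
  obtain h :: "'p mod_ring \<Rightarrow> 'p padic_int" where "\<And>c. red (h c) = c" using red_surj by metis
  then have "red_vec (\<chi> i. h (a $ i)) = a" by (simp add: vec_eq_iff)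
  then show ?thesis by blast
qed

lemma scale_vec_add: "scale_vec k (u + w) = scale_vec k u + scale_vec k w"
  by (simp add: scale_vec_def vec_eq_iff distrib_left)

lemma scale_vec_uminus: "scale_vec k (- u) = - scale_vec k u"
  by (simp add: scale_vec_def vec_eq_iff)

lemma scale_vec_inject: "scale_vec k u = scale_vec k v \<longleftrightarrow> u = v"
  by (simp add: scale_vec_def vec_eq_iff CARD_power_mult_cancel)

lemma mpoly_eval_shell:
  fixes f :: "('p :: prime_card padic_int, 'n :: finite) mpoly"
  assumes "f \<noteq> 0"
  shows "\<exists>F. mpoly_eval f (scale_vec k u) = prime_p ^ newton_min f k * F \<and> red F = mpoly_eval (reduced_face f k) (red_vec u)"
  using mpoly_taylor[OF assms order_refl, of k u 0] unfolding reduced_face_def by blast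

lemma mpoly_eval_shift:
  fixes f :: "('p :: prime_card padic_int, 'n :: finite) mpoly"
  assumes "f \<noteq> 0" "J \<ge> 1"
  shows "\<exists>D. mpoly_eval f (scale_vec k u + scale_vec k (\<chi> i. prime_p ^ J * v $ i)) = mpoly_eval f (scale_vec k u) + prime_p ^ (newton_min f k + J) * D
    \<and> red D = dirderiv (reduced_face f k) (red_vec u) v"
  using mpoly_taylor[OF assms, of k u v] unfolding reduced_face_def[symmetric] dirderiv_def scale_vec_add[symmetric]
  by (auto simp: algebra_simps power_add)

lemma red_vec_add_small: "J \<ge> 1 \<Longrightarrow> red_vec (u + (\<chi> i. prime_p ^ J * v $ i)) = red_vec u"
  by (simp add: vec_eq_iff power_0_left)

context haar
begin

text \<open>Fixing \<open>u\<close> modulo \<open>p\<close> prescribes one digit of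
  \<open>p^(k $ i) * u $ i\<close> beyond the forced zeros; hence the modulus
  \<open>k $ i + 1\<close>.\<close>

lemma shell_box: "shell k (red_vec z) = box (\<chi> i. k $ i + 1) (scale_vec k z)"
proof (intro equalityI subsetI)
  fix x assume "x \<in> shell k (red_vec z)"
  then obtain u where u: "x = scale_vec k u" "red_vec u = red_vec z" by (auto simp: shell_def)
  have "prime_p ^ (k $ i + 1) dvd prime_p ^ (k $ i) * (u $ i - z $ i)" for i
  proof -
    have "red (u $ i - z $ i) = 0" using u(2) by (simp add: vec_eq_iff)
    then show ?thesis unfolding CARD_power_dvd_cancel power_one_right red_eq_0_iff .
  qed
  then show "x \<in> box (\<chi> i. k $ i + 1) (scale_vec k z)"
    by (simp add: box_def u scale_vec_def right_diff_distrib)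
next
  fix x assume x: "x \<in> box (\<chi> i. k $ i + 1) (scale_vec k z)"
  have "\<forall>i. \<exists>w. x $ i - prime_p ^ (k $ i) * z $ i = prime_p ^ (k $ i + 1) * w"
    using x by (simp add: box_def scale_vec_def dvd_def del: power_Suc)
  then obtain w where w: "\<And>i. x $ i - prime_p ^ (k $ i) * z $ i = prime_p ^ (k $ i + 1) * w i" by metis
  have "x = scale_vec k (\<chi> i. z $ i + prime_p * w i)"
    unfolding vec_eq_iff
  proof
    fix i show "x $ i = scale_vec k (\<chi> i. z $ i + prime_p * w i) $ i"
      using w[of i] by (simp add: scale_vec_def algebra_simps)
  qed
  moreover have "red_vec (\<chi> i. z $ i + prime_p * w i) = red_vec z" by (simp add: vec_eq_iff)
  ultimately show "x \<in> shell k (red_vec z)" by (auto simp: shell_def)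
qed

lemma measure_shell:
  "shell k a \<in> sets borel"
  "measure \<mu> (shell k a) = (1 / real CARD('p)) ^ ((\<Sum>i\<in>UNIV. k $ i) + CARD('n))"
proof -
  obtain z where "red_vec z = a" using red_vec_surj by blast
  then show "shell k a \<in> sets borel"
    "measure \<mu> (shell k a) = (1 / real CARD('p)) ^ ((\<Sum>i\<in>UNIV. k $ i) + CARD('n))"
    using measure_box[of "\<chi> i. k $ i + 1" "scale_vec k z"] shell_box[of k z] sum.distrib[of "\<lambda>i. k $ i" "\<lambda>i. 1" UNIV] by simp_all
qed

lemma sets_residue_mpoly: "{x. residue (mpoly_eval f x) K \<in> S} \<in> sets borel"
  for f :: "('p padic_int, 'n) mpoly"
  using measurable_sets[OF measurable_residue_mpoly, of S f K] by (simp add: vimage_def)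

lemma sets_level:
  fixes f g :: "('p padic_int, 'n) mpoly"
  shows "level f g k a j l \<in> sets borel"
proof -
  have *: "level f g k a j l = shell k a \<inter> {x. residue (mpoly_eval f x) (newton_min f k + j) \<in> {0}} \<inter>
      {x. residue (mpoly_eval g x) (newton_min g k + l) \<in> {0}}"
    by (auto simp: level_def dvd_iff_residue)
  show ?thesis unfolding * by (intro sets.Int measure_shell(1) sets_residue_mpoly)
qed

text \<open>Translation by a multiple of \<open>p\<^sup>j\<close> in direction \<open>v\<close> raises digit \<open>j\<close> of \<open>f / p\<^bsup>m\<^esup>\<close> by one and
  fixes \<open>g / p\<^bsup>m'\<^esup>\<close> modulo \<open>p\<^bsup>j+1\<^esup>\<close> only, hence the bound on \<open>l\<close>.\<close>

lemma level_step:
  assumes f: "f \<noteq> 0" and g: "g \<noteq> 0" and j: "1 \<le> j"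
    and v: "dirderiv (reduced_face f k) a v = 1"
    and l: "l = 0 \<or> dirderiv (reduced_face g k) a v = 0 \<and> l \<le> Suc j"
  shows "measure \<mu> (level f g k a (Suc j) l) = measure \<mu> (level f g k a j l) / real CARD('p)"
proof -
  let ?M = "newton_min f k + j"
  let ?c = "\<lambda>x. digit ?M (mpoly_eval f x)"
  let ?A = "level f g k a j l"
  define e where "e = (\<lambda>v :: 'p padic_int ^ 'n. scale_vec k (\<chi> i. prime_p ^ j * v $ i))"
  have gdvd: "prime_p ^ (newton_min g k) dvd mpoly_eval g (scale_vec k u)" for u
    using mpoly_eval_shell[OF g, of k u] by auto
  \<comment> \<open>Stated for an arbitrary direction \<open>w\<close>: it is applied to
    \<open>v\<close>, and to \<open>- v\<close> for the inverse translation.\<close>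
  have shift: "x + e w \<in> ?A \<and> (\<exists>F D. mpoly_eval f x = prime_p ^ ?M * F \<and> mpoly_eval f (x + e w) = prime_p ^ ?M * (F + D)
        \<and> red D = dirderiv (reduced_face f k) a w)"
    if x: "x \<in> ?A" and w: "l = 0 \<or> dirderiv (reduced_face g k) a w = 0 \<and> l \<le> Suc j" for x w
  proof -
    obtain u where u: "x = scale_vec k u" "red_vec u = a" using x by (auto simp: level_def shell_def)
    obtain D where D: "mpoly_eval f (x + e w) = mpoly_eval f x + prime_p ^ ?M * D" "red D = dirderiv (reduced_face f k) a w"
      using mpoly_eval_shift[OF f j, of k u w] u by (auto simp: e_def)
    obtain E where E: "mpoly_eval g (x + e w) = mpoly_eval g x + prime_p ^ (newton_min g k + j) * E" "red E = dirderiv (reduced_face g k) a w"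
      using mpoly_eval_shift[OF g j, of k u w] u by (auto simp: e_def)
    have sh: "x + e w = scale_vec k (u + (\<chi> i. prime_p ^ j * w $ i))" by (simp add: u e_def scale_vec_add)
    then have "x + e w \<in> shell k a" using red_vec_add_small[OF j, of u w] u(2) by (auto simp: shell_def)
    moreover have "prime_p ^ ?M dvd mpoly_eval f (x + e w)" using x D by (auto simp: level_def)
    moreover have "prime_p ^ (newton_min g k + l) dvd mpoly_eval g (x + e w)"
    proof (cases "l = 0")
      case True
      then show ?thesis using gdvd sh by simp
    next
      case False
      with w have w: "red E = 0" "l \<le> Suc j" using E by auto
      \<comment> \<open>The vanishing directional derivative of \<open>g\<close> gains one factor
        \<open>p\<close>; this is the extra digit allowed by \<open>l \<le> Suc j\<close>.\<close>
      from w(1) obtain E' where "E = prime_p * E'" by (auto simp: red_eq_0_iff dvd_def)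
      then have "prime_p ^ (newton_min g k + j) * E = prime_p ^ (newton_min g k + Suc j) * E'" by (simp add: mult_ac)
      moreover have "prime_p ^ (newton_min g k + l) dvd prime_p ^ (newton_min g k + Suc j) * E'"
        using w(2) by (intro dvd_mult2 le_imp_power_dvd) simp
      ultimately show ?thesis using E(1) x by (auto simp: level_def intro: dvd_add)
    qed
    moreover obtain F where "mpoly_eval f x = prime_p ^ ?M * F" using x by (auto simp: level_def dvd_def)
    ultimately show ?thesis using D by (auto simp: level_def distrib_left)
  qed
  have "dirderiv h a (- v) = - dirderiv h a v" for h
    by (simp add: dirderiv_def sum_negf)
  then have l': "l = 0 \<or> dirderiv (reduced_face g k) a (- v) = 0 \<and> l \<le> Suc j" using l by auto
  have em: "e (- v) = - e v"
    unfolding e_def scale_vec_uminus[symmetric] by (rule arg_cong[where f = "scale_vec k"]) (simp add: vec_eq_iff)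
  have "measure \<mu> {x \<in> ?A. ?c x = 0} = measure \<mu> ?A / real CARD('p)"
  proof (rule measure_split[where e = "e v"])
    fix t
    have *: "{x \<in> ?A. ?c x = t} = ?A \<inter> {x. residue (mpoly_eval f x) (Suc ?M) \<in> {r. of_int (r div int CARD('p) ^ ?M) = t}}"
      by (auto simp: digit_def)
    show "{x \<in> ?A. ?c x = t} \<in> sets borel"
      unfolding * by (intro sets.Int sets_level sets_residue_mpoly)
  next
    fix x assume x: "x \<in> ?A"
    show "e v + x \<in> ?A" using shift[OF x l] by (simp add: add.commute)
    show "x - e v \<in> ?A" using shift[OF x l'] em by simp
    show "?c (e v + x) = ?c x + 1"
      using shift[OF x l] v by (auto simp: add.commute digit_CARD_power_mult)
  qed
  also have "{x \<in> ?A. ?c x = 0} = level f g k a (Suc j) l"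
  proof -
    have "prime_p ^ ?M dvd w \<and> digit ?M w = 0 \<longleftrightarrow> prime_p ^ Suc ?M dvd w" for w :: "'p padic_int"
      using digit_eq_0_iff[of ?M w] dvd_trans[OF le_imp_power_dvd[of ?M "Suc ?M" prime_p], of w] by auto
    then show ?thesis unfolding level_def add_Suc_right by blast
  qed
  finally show ?thesis .
qed

lemma level_0:
  fixes f g :: "('p padic_int, 'n) mpoly"
  assumes "f \<noteq> 0" "g \<noteq> 0"
  shows "level f g k a 0 0 = shell k a"
proof -
  have "prime_p ^ newton_min f k dvd mpoly_eval f (scale_vec k u) \<and> prime_p ^ newton_min g k dvd mpoly_eval g (scale_vec k u)" for u :: "'p padic_int ^ 'n"
    using mpoly_eval_shell[OF assms(1), of k u] mpoly_eval_shell[OF assms(2), of k u] by (metis dvd_triv_left)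
  then show ?thesis by (auto simp: level_def shell_def)
qed

lemma level_unit:
  assumes f: "f \<noteq> 0" and u: "mpoly_eval (reduced_face f k) a \<noteq> 0" and j: "j \<ge> 1"
  shows "level f g k a j l = {}"
proof (rule ccontr)
  assume "level f g k a j l \<noteq> {}"
  then obtain u where "red_vec u = a" "prime_p ^ (newton_min f k + j) dvd mpoly_eval f (scale_vec k u)"
    by (auto simp: level_def shell_def)
  moreover obtain F where "mpoly_eval f (scale_vec k u) = prime_p ^ newton_min f k * F" "red F = mpoly_eval (reduced_face f k) (red_vec u)"
    using mpoly_eval_shell[OF f] by blast
  ultimately have "prime_p ^ j dvd F" "red F \<noteq> 0" using u CARD_power_dvd_cancel[of "newton_min f k" j F] by auto
  then show False using j dvd_trans[OF le_imp_power_dvd[of 1 j prime_p], of F] by (simp add: red_eq_0_iff)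
qed

lemma level_zero:
  assumes f: "f \<noteq> 0" and u: "mpoly_eval (reduced_face f k) a = 0"
  shows "level f g k a 1 l = level f g k a 0 l"
proof -
  have "prime_p ^ (newton_min f k + 1) dvd mpoly_eval f x" if "x \<in> shell k a" for x
  proof -
    obtain w where w: "x = scale_vec k w" "red_vec w = a" using \<open>x \<in> shell k a\<close> by (auto simp: shell_def)
    moreover obtain F where "mpoly_eval f (scale_vec k w) = prime_p ^ newton_min f k * F" "red F = mpoly_eval (reduced_face f k) (red_vec w)"
      using mpoly_eval_shell[OF f] by blast
    ultimately show ?thesis using u CARD_power_dvd_cancel[of "newton_min f k" 1 F] red_eq_0_iff[of F] by simp
  qed
  moreover have "prime_p ^ newton_min f k dvd w" if "prime_p ^ (newton_min f k + 1) dvd w" for w :: "'p padic_int"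
    using dvd_trans[OF le_imp_power_dvd[of "newton_min f k" "newton_min f k + 1" prime_p] that] by simp
  ultimately show ?thesis unfolding level_def by auto
qed

lemma level_single:
  assumes f: "f \<noteq> 0" and g: "g \<noteq> 0" and v: "dirderiv (reduced_face f k) a v = 1"
    and z: "mpoly_eval (reduced_face f k) a = 0"
  shows "measure \<mu> (level f g k a j 0) = measure \<mu> (shell k a) * (1 / real CARD('p)) ^ (j - 1)"
proof (induction j)
  case 0
  show ?case using level_0[OF f g] by simp
next
  case (Suc j)
  show ?case
  proof (cases "j = 0")
    case True
    then show ?thesis using Suc level_zero[OF f z, of g 0] by simp
  next
    case False
    then have "j = Suc (j - 1)" by simp
    then have "(1 / real CARD('p)) ^ j = (1 / real CARD('p)) ^ (j - 1) / real CARD('p)" by (metis power_Suc2 times_divide_eq_right mult.right_neutral)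
    then show ?thesis using level_step[OF f g _ v, of j 0] False Suc by simp
  qed
qed

text \<open>Lowering the larger of the two indices keeps the side condition of \<open>level_step\<close> satisfied.\<close>

lemma level_double:
  assumes f: "f \<noteq> 0" and g: "g \<noteq> 0"
    and z: "mpoly_eval (reduced_face f k) a = 0" "mpoly_eval (reduced_face g k) a = 0"
    and v: "dirderiv (reduced_face f k) a v = 1" "dirderiv (reduced_face g k) a v = 0"
    and w: "dirderiv (reduced_face f k) a w = 0" "dirderiv (reduced_face g k) a w = 1"
  shows "measure \<mu> (level f g k a (Suc j) (Suc l)) = measure \<mu> (shell k a) * (1 / real CARD('p)) ^ (j + l)"
proof (induction "j + l" arbitrary: j l)
  case 0
  then show ?case using level_zero[OF f z(1), of g 1] level_zero[OF g z(2), of f 0] level_0[OF f g, of k a]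
    level_commute[of f g k a 0] by simp
next
  case (Suc m)
  show ?case
  proof (cases "j \<ge> l")
    case True
    with Suc(2) obtain j' where j: "j = Suc j'" by (cases j) auto
    show ?thesis using Suc(1)[of j' l] Suc(2) True level_step[OF f g _ v(1), of "Suc j'" "Suc l"] v j
      by simp
  next
    case False
    with Suc(2) obtain l' where l: "l = Suc l'" by (cases l) auto
    show ?thesis using Suc(1)[of j l'] Suc(2) False level_step[OF g f _ w(2), of "Suc l'" "Suc j"] w l
      by (simp add: level_commute[of f g k a])
  qed
qed

text \<open>The product form says that the two valuations are independent within a shell. The
  non-degeneracy enters only as the existence of suitable directions, which the later sections
  derive from the gradient and rank conditions.\<close>

lemma measure_level:
  fixes f g :: "('p padic_int, 'n) mpoly"
  assumes f: "f \<noteq> 0" and g: "g \<noteq> 0"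
    and vf: "mpoly_eval (reduced_face f k) a = 0 \<Longrightarrow> \<exists>v. dirderiv (reduced_face f k) a v = 1"
    and vg: "mpoly_eval (reduced_face g k) a = 0 \<Longrightarrow> \<exists>v. dirderiv (reduced_face g k) a v = 1"
    and vfg: "mpoly_eval (reduced_face f k) a = 0 \<Longrightarrow> mpoly_eval (reduced_face g k) a = 0 \<Longrightarrow>
       (\<exists>v. dirderiv (reduced_face f k) a v = 1 \<and> dirderiv (reduced_face g k) a v = 0) \<and>
       (\<exists>v. dirderiv (reduced_face f k) a v = 0 \<and> dirderiv (reduced_face g k) a v = 1)"
  defines "q \<equiv> 1 / real CARD('p)"
  shows "measure \<mu> (level f g k a j l) = measure \<mu> (shell k a) *
     tail_weight q (mpoly_eval (reduced_face f k) a \<noteq> 0) j * tail_weight q (mpoly_eval (reduced_face g k) a \<noteq> 0) l"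
proof -
  have A: ?thesis if "mpoly_eval (reduced_face f k) a \<noteq> 0" "j \<ge> 1"
    using level_unit[OF f that, of g l] that by (simp add: tail_weight_def)
  have B: ?thesis if "mpoly_eval (reduced_face g k) a \<noteq> 0" "l \<ge> 1"
    using level_unit[OF g that, of f j] that by (simp add: tail_weight_def level_commute[of f g])
  have C: ?thesis if "j = 0" "l = 0"
    using level_0[OF f g, of k a] that by (simp add: tail_weight_def)
  have D: ?thesis if z: "mpoly_eval (reduced_face f k) a = 0" and l: "l = 0"
    using z vf[OF z] level_single[OF f g _ z] l by (auto simp: tail_weight_def q_def)
  have E: ?thesis if z: "mpoly_eval (reduced_face g k) a = 0" and l: "j = 0"
    using z vg[OF z] level_single[OF g f _ z] l by (auto simp: tail_weight_def q_def level_commute[of f g])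
  have F: ?thesis if z: "mpoly_eval (reduced_face f k) a = 0" "mpoly_eval (reduced_face g k) a = 0" and jl: "j = Suc j'" "l = Suc l'" for j' l'
  proof -
    obtain v w where "dirderiv (reduced_face f k) a v = 1" "dirderiv (reduced_face g k) a v = 0"
      "dirderiv (reduced_face f k) a w = 0" "dirderiv (reduced_face g k) a w = 1" using vfg[OF z] by blast
    from level_double[OF f g z this, of j' l'] show ?thesis
      using z by (simp add: jl tail_weight_def q_def power_add)
  qed
  show ?thesis
  proof (cases "mpoly_eval (reduced_face f k) a = 0"; cases "mpoly_eval (reduced_face g k) a = 0"; cases j; cases l)
  qed (use A B C D E F in auto)
qed

end

section \<open>The integral over a shell\<close>

lemma padic_abs_exact:
  fixes w :: "'p :: prime_card padic_int"
  assumes "prime_p ^ m dvd w" "\<not> prime_p ^ Suc m dvd w"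
  shows "padic_abs w = (1 / real CARD('p)) ^ m"
proof -
  obtain y where y: "w = prime_p ^ m * y" using assms(1) by (auto simp: dvd_def)
  have "red y \<noteq> 0"
    using assms(2) CARD_power_dvd_cancel[of m 1 y] unfolding y red_eq_0_iff by simp
  then show ?thesis using padic_abs_unit_mult[of y m] y by (simp add: power_divide)
qed

lemma zeta_integrand_zero:
  "mpoly_eval f x = 0 \<or> mpoly_eval g x = 0 \<Longrightarrow> zeta_integrand f g s x = 0"
  by (auto simp: zeta_integrand_def padic_abs_def)

lemma norm_zeta_integrand_le:
  assumes "Re s > 0"
  shows "norm (zeta_integrand f g s x) \<le> 1"
proof -
  have "norm (complex_of_real (padic_abs (mpoly_eval f x)) powr s) \<le> 1"
  proof (cases "mpoly_eval f x = 0")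
    case False
    then have "0 < padic_abs (mpoly_eval f x)" by (rule padic_abs_pos)
    moreover have "padic_abs (mpoly_eval f x) powr Re s \<le> 1 powr Re s"
      using assms by (intro powr_mono2 padic_abs_le_1 padic_abs_nonneg) auto
    ultimately show ?thesis by (subst norm_powr_real_powr) auto
  qed (simp add: padic_abs_def)
  moreover have "norm (complex_of_real (padic_abs (mpoly_eval g x))) \<le> 1"
    using padic_abs_le_1[of "mpoly_eval g x"] padic_abs_nonneg[of "mpoly_eval g x"] by simp
  ultimately show ?thesis
    unfolding zeta_integrand_def norm_mult using mult_mono[of _ 1 _ 1] by fastforce
qed

lemma borel_measurable_padic_abs_mpoly:
  fixes f :: "('p :: prime_card padic_int, 'n :: finite) mpoly"
  shows "(\<lambda>x. padic_abs (mpoly_eval f x)) \<in> borel_measurable borel"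
proof -
  have "continuous_on UNIV (\<lambda>x. dist (mpoly_eval f x) 0)"
    by (intro continuous_on_dist continuous_mpoly_eval continuous_on_const)
  then have "(\<lambda>x. dist (mpoly_eval f x) 0) \<in> borel_measurable borel"
    by (rule borel_measurable_continuous_onI)
  then show ?thesis by (simp add: dist_padic_int_def)
qed

text \<open>On nonnegative reals the complex power can be written with the real logarithm, which is
  measurable; at zero it has the value \<open>0\<close>.\<close>

lemma borel_measurable_of_real_powr:
  fixes h :: "'a \<Rightarrow> real" and s :: complex
  assumes h: "h \<in> borel_measurable M" and nn: "\<And>x. 0 \<le> h x"
  shows "(\<lambda>x. of_real (h x) powr s) \<in> borel_measurable M"
proof -
  have "(\<lambda>x. of_real (h x) powr s) = (\<lambda>x. if h x = 0 then 0 else exp (s * of_real (ln (h x))))"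
  proof
    fix x show "of_real (h x) powr s = (if h x = 0 then 0 else exp (s * of_real (ln (h x))))"
      using nn[of x] by (auto simp: powr_def Ln_of_real)
  qed
  also have "\<dots> \<in> borel_measurable M"
    using h by measurable
  finally show ?thesis .
qed

lemma of_real_inverse_power_powr:
  assumes "0 < p"
  shows "complex_of_real ((1 / p) ^ m) powr s = (of_real p powr - s) ^ m"
proof -
  have "complex_of_real ((1 / p) ^ m) powr s = exp (s * of_real (ln ((1 / p) ^ m)))"
    using assms by (subst powr_def) (simp add: Ln_of_real del: of_real_power of_real_divide)
  also have "\<dots> = exp (of_nat m * (- s * of_real (ln p)))"
    using assms by (simp add: ln_realpow ln_div algebra_simps)
  also have "\<dots> = exp (- s * of_real (ln p)) ^ m" by (rule exp_of_nat_mult)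
  also have "\<dots> = (of_real p powr - s) ^ m"
    using assms by (simp add: powr_def Ln_of_real)
  finally show ?thesis .
qed

text \<open>The expectation computed in \<open>has_sum_tail_weight\<close>. It is used with
  \<open>q = 1/p\<close>, at \<open>z = p^(-s)\<close> for \<open>f\<close> and at
  \<open>z = 1/p\<close> for \<open>g\<close>.\<close>

definition unit_weight :: "real \<Rightarrow> bool \<Rightarrow> complex \<Rightarrow> complex" where
  "unit_weight q u z = (if u then 1 else z * (1 - of_real q) / (1 - z * of_real q))"

context haar
begin

lemma integrable_zeta_integrand:
  fixes f g :: "('p padic_int, 'n) mpoly"
  assumes "Re s > 0"
  shows "integrable \<mu> (zeta_integrand f g s)"
proof (rule integrable_const_bound[of _ 1])
  show "AE x in \<mu>. norm (zeta_integrand f g s x) \<le> 1" by (rule AE_I2) (rule norm_zeta_integrand_le[OF assms])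
  note borel_measurable_padic_abs_mpoly[measurable]
  have [measurable]: "(\<lambda>x. of_real (padic_abs (mpoly_eval f x)) powr s) \<in> borel_measurable borel"
    by (intro borel_measurable_of_real_powr borel_measurable_padic_abs_mpoly padic_abs_nonneg)
  have "zeta_integrand f g s \<in> borel_measurable borel"
    unfolding zeta_integrand_def by measurable
  then show "zeta_integrand f g s \<in> borel_measurable \<mu>" by (simp add: measurable_cong_sets[OF sets_haar refl])
qed

lemma level_antimono:
  fixes f g :: "('p padic_int, 'n) mpoly"
  assumes "j \<le> j'" "l \<le> l'"
  shows "level f g k a j' l' \<subseteq> level f g k a j l"
proof -
  have "prime_p ^ (newton_min f k + j) dvd w" if "prime_p ^ (newton_min f k + j') dvd w" for w :: "'p padic_int"
    using that assms by (meson add_le_cancel_left dvd_trans le_imp_power_dvd)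
  moreover have "prime_p ^ (newton_min g k + l) dvd w" if "prime_p ^ (newton_min g k + l') dvd w" for w :: "'p padic_int"
    using that assms by (meson add_le_cancel_left dvd_trans le_imp_power_dvd)
  ultimately show ?thesis by (auto simp: level_def)
qed

text \<open>The shell is cut by the exact valuations of \<open>f\<close> and \<open>g\<close>. The
  integrand is constant on each piece, so independence turns the integral into a product of two
  expectations.\<close>

lemma integral_shell:
  fixes f g :: "('p padic_int, 'n) mpoly"
  assumes f: "f \<noteq> 0" and g: "g \<noteq> 0" and s: "Re s > 0"
    and vf: "mpoly_eval (reduced_face f k) a = 0 \<Longrightarrow> \<exists>v. dirderiv (reduced_face f k) a v = 1"
    and vg: "mpoly_eval (reduced_face g k) a = 0 \<Longrightarrow> \<exists>v. dirderiv (reduced_face g k) a v = 1"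
    and vfg: "mpoly_eval (reduced_face f k) a = 0 \<Longrightarrow> mpoly_eval (reduced_face g k) a = 0 \<Longrightarrow>
       (\<exists>v. dirderiv (reduced_face f k) a v = 1 \<and> dirderiv (reduced_face g k) a v = 0) \<and>
       (\<exists>v. dirderiv (reduced_face f k) a v = 0 \<and> dirderiv (reduced_face g k) a v = 1)"
  defines "q \<equiv> 1 / real CARD('p)" and "P \<equiv> complex_of_real (real CARD('p)) powr - s"
  shows "(\<integral>x. indicator (shell k a) x * zeta_integrand f g s x \<partial>\<mu>) =
     of_real (measure \<mu> (shell k a)) * P ^ newton_min f k * of_real q ^ newton_min g k *
     unit_weight q (mpoly_eval (reduced_face f k) a \<noteq> 0) P * unit_weight q (mpoly_eval (reduced_face g k) a \<noteq> 0) (of_real q)"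
proof -
  let ?u = "mpoly_eval (reduced_face f k) a \<noteq> 0" and ?v = "mpoly_eval (reduced_face g k) a \<noteq> 0"
  let ?L = "level f g k a"
  let ?h = "\<lambda>x. indicator (shell k a) x * zeta_integrand f g s x"
  have p: "1 < real CARD('p)" using CARD_prime_gt[where ?'p = 'p] by simp
  have q: "0 < q" "q < 1" using p by (simp_all add: q_def)
  have P1: "norm P \<le> 1"
  proof -
    have "norm P = real CARD('p) powr - Re s" unfolding P_def using p by (subst norm_powr_real_powr) auto
    also have "\<dots> \<le> real CARD('p) powr 0" using p s by (intro powr_mono) auto
    finally show ?thesis using p by simp
  qed
  \<comment> \<open>Exact valuations \<open>m + j\<close> and \<open>m' + l\<close>, written as an
    iterated difference of nested levels so that the measure follows from additivity alone.\<close>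
  define A where "A = (\<lambda>(j, l). (?L j l - ?L (Suc j) l) - (?L j (Suc l) - ?L (Suc j) (Suc l)))"
  have A_iff: "x \<in> A (j, l) \<longleftrightarrow> x \<in> shell k a \<and> (prime_p ^ (newton_min f k + j) dvd mpoly_eval f x \<and> \<not> prime_p ^ Suc (newton_min f k + j) dvd mpoly_eval f x)
      \<and> (prime_p ^ (newton_min g k + l) dvd mpoly_eval g x \<and> \<not> prime_p ^ Suc (newton_min g k + l) dvd mpoly_eval g x)" for x j l
  proof -
    have "prime_p ^ M dvd w" if "prime_p ^ Suc M dvd w" for M and w :: "'p padic_int"
      using that by (meson dvd_trans le_imp_power_dvd lessI less_imp_le)
    then show ?thesis unfolding A_def level_def add_Suc_right split_conv by blast
  qed
  have valA: "padic_abs (mpoly_eval f x) = q ^ (newton_min f k + j)" "padic_abs (mpoly_eval g x) = q ^ (newton_min g k + l)"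
    if "x \<in> A (j, l)" for x j l
    using that padic_abs_exact unfolding A_iff q_def by blast+
  have setsA: "A i \<in> sets borel" for i
    unfolding A_def by (cases i) (simp add: sets_level sets.Diff)
  have measA: "measure \<mu> (A (j, l)) = measure \<mu> (shell k a) * (tail_weight q ?u j - tail_weight q ?u (Suc j)) *
      (tail_weight q ?v l - tail_weight q ?v (Suc l))" for j l
  proof -
    have L: "measure \<mu> (?L j l) = measure \<mu> (shell k a) * tail_weight q ?u j * tail_weight q ?v l" for j l
      unfolding q_def using f g vf vg vfg by (rule measure_level)
    have "measure \<mu> (A (j, l)) = (measure \<mu> (?L j l) - measure \<mu> (?L (Suc j) l)) - (measure \<mu> (?L j (Suc l)) - measure \<mu> (?L (Suc j) (Suc l)))"
      unfolding A_def split_conv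
      by (subst finite_measure_Diff; (subst finite_measure_Diff)?; (subst finite_measure_Diff)?)
        (use level_antimono[of j j l "Suc l"] level_antimono[of j "Suc j" l l] level_antimono[of j "Suc j" "Suc l" "Suc l"]
          level_antimono[of "Suc j" "Suc j" l "Suc l"]
          in \<open>auto simp: sets_level sets.Diff\<close>, auto simp: level_def)
    then show ?thesis unfolding L by (simp add: algebra_simps)
  qed
  have "((\<lambda>i. \<integral>x. indicator (A i) x * ?h x \<partial>\<mu>) has_sum (\<integral>x. ?h x \<partial>\<mu>)) (UNIV \<times> UNIV)"
  proof (rule has_sum_integral_partition)
    show "disjoint_family_on A (UNIV \<times> UNIV)"
    proof (unfold disjoint_family_on_def, intro ballI impI)
      fix m n :: "nat \<times> nat" assume mn: "m \<noteq> n"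
      show "A m \<inter> A n = {}"
      proof (rule ccontr)
        assume "A m \<inter> A n \<noteq> {}"
        then obtain x where x: "x \<in> A (fst m, snd m)" "x \<in> A (fst n, snd n)" by auto
        from valA[OF x(1)] valA[OF x(2)] q have "fst m = fst n" "snd m = snd n"
          by (auto simp: power_inject_exp')
        with mn show False by (simp add: prod_eq_iff)
      qed
    qed
    show "integrable \<mu> ?h"
    proof -
      have "integrable \<mu> (\<lambda>x. indicator (shell k a) x *\<^sub>R zeta_integrand f g s x)"
        by (intro integrable_mult_indicator integrable_zeta_integrand s) (simp add: measure_shell)
      also have "(\<lambda>x. indicator (shell k a) x *\<^sub>R zeta_integrand f g s x) = ?h"
        by (simp add: fun_eq_iff indicator_def)
      finally show ?thesis .
    qed
    \<comment> \<open>Points of the shell outside all pieces are zeros of \<open>f\<close> or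
      \<open>g\<close>, where a valuation is infinite and the integrand vanishes. Thus the zero sets
      need not be shown to be null.\<close>
    have "?h x = 0" if x: "x \<notin> (\<Union>i\<in>UNIV \<times> UNIV. A i)" for x
    proof (cases "x \<in> shell k a \<and> mpoly_eval f x \<noteq> 0 \<and> mpoly_eval g x \<noteq> 0")
      case False
      then show ?thesis using zeta_integrand_zero[of f x g s] by auto
    next
      case True
      then obtain w where w: "x = scale_vec k w" by (auto simp: shell_def)
      have val: "\<exists>M. prime_p ^ (m + M) dvd y \<and> \<not> prime_p ^ Suc (m + M) dvd y" if y: "y \<noteq> 0" "prime_p ^ m dvd y" for m and y :: "'p padic_int"
      proof -
        obtain N u where u: "y = prime_p ^ N * u" "red u \<noteq> 0" using padic_cases[OF y(1)] by blast
        have *: "\<not> prime_p ^ Suc N dvd y" using u CARD_power_dvd_cancel[of N 1 u] by (simp add: red_eq_0_iff)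
        then have "m \<le> N" using y(2) by (meson dvd_trans le_imp_power_dvd not_less_eq_eq)
        then obtain M where "N = m + M" using le_Suc_ex by blast
        then show ?thesis using * u(1) by (intro exI[of _ M]) auto
      qed
      have "prime_p ^ newton_min f k dvd mpoly_eval f x" "prime_p ^ newton_min g k dvd mpoly_eval g x"
        using mpoly_eval_shell[OF f, of k w] mpoly_eval_shell[OF g, of k w] unfolding w by auto
      with True val obtain j l where "x \<in> A (j, l)" unfolding A_iff by meson
      with x show ?thesis by auto
    qed
    then show "AE x in \<mu>. x \<notin> (\<Union>i\<in>UNIV \<times> UNIV. A i) \<longrightarrow> ?h x = 0" by simp
  qed (auto simp: setsA)
  also have "(\<lambda>i. \<integral>x. indicator (A i) x * ?h x \<partial>\<mu>) = (\<lambda>(j, l). of_real (measure \<mu> (shell k a)) * P ^ newton_min f k * of_real q ^ newton_min g k *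
      (P ^ j * of_real (tail_weight q ?u j - tail_weight q ?u (Suc j))) * (of_real q ^ l * of_real (tail_weight q ?v l - tail_weight q ?v (Suc l))))"
    (is "_ = (\<lambda>(j, l). ?C * ?F j * ?G l)")
  proof (rule ext, clarify)
    fix j l
    have "(\<integral>x. indicator (A (j, l)) x * ?h x \<partial>\<mu>) = (\<integral>x. indicator (A (j, l)) x *\<^sub>R (P ^ (newton_min f k + j) * of_real q ^ (newton_min g k + l)) \<partial>\<mu>)"
    proof (rule Bochner_Integration.integral_cong[OF refl])
      fix x
      show "indicator (A (j, l)) x * ?h x = indicator (A (j, l)) x *\<^sub>R (P ^ (newton_min f k + j) * of_real q ^ (newton_min g k + l))"
      proof (cases "x \<in> A (j, l)")
        case True
        have "x \<in> shell k a" using True A_iff by blast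
        moreover have "zeta_integrand f g s x = P ^ (newton_min f k + j) * of_real q ^ (newton_min g k + l)"
          unfolding zeta_integrand_def valA[OF True] unfolding q_def P_def
          unfolding of_real_inverse_power_powr[OF less_trans[OF zero_less_one p]] by (simp only: of_real_power)
        ultimately show ?thesis using True by simp
      qed simp
    qed
    also have "\<dots> = of_real (measure \<mu> (A (j, l))) * (P ^ (newton_min f k + j) * of_real q ^ (newton_min g k + l))"
      using setsA[of "(j, l)"] by (simp add: scaleR_conv_of_real)
    also have "\<dots> = ?C * ?F j * ?G l"
      unfolding measA by (simp add: power_add)
    finally show "(\<integral>x. indicator (A (j, l)) x * ?h x \<partial>\<mu>) = ?C * ?F j * ?G l" .
  qed
  finally have "((\<lambda>(j, l). ?C * ?F j * ?G l) has_sum (\<integral>x. ?h x \<partial>\<mu>)) (UNIV \<times> UNIV)" .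
  \<comment> \<open>The sum over \<open>l\<close> does not depend on \<open>j\<close>, so the double
    series splits; the same value is then obtained from the sum over \<open>j\<close>.\<close>
  then have 1: "((\<lambda>j. ?C * ?F j * unit_weight q ?v (of_real q)) has_sum (\<integral>x. ?h x \<partial>\<mu>)) UNIV"
  proof (rule has_sum_SigmaD)
    fix j
    show "((\<lambda>l. (case (j, l) of (j, l) \<Rightarrow> ?C * ?F j * ?G l)) has_sum (?C * ?F j * unit_weight q ?v (of_real q))) UNIV"
      unfolding split_conv unit_weight_def using q
      by (intro has_sum_cmult_right has_sum_tail_weight) auto
  qed
  have 2: "((\<lambda>j. ?C * ?F j * unit_weight q ?v (of_real q)) has_sum (?C * unit_weight q ?u P * unit_weight q ?v (of_real q))) UNIV"
    unfolding unit_weight_def[of q ?u] using q P1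
    by (intro has_sum_cmult_left has_sum_cmult_right has_sum_tail_weight) auto
  from has_sum_unique[OF 1 2] show ?thesis by simp
qed

end

section \<open>The local factor\<close>

lemma rank_2_independent:
  fixes r1 r2 :: "'a::field ^ 'n::finite"
  assumes "rank (vector [r1, r2] :: 'a ^ 'n ^ 2) = 2" and c: "c1 *s r1 + c2 *s r2 = 0"
  shows "c1 = 0 \<and> c2 = 0"
proof (rule ccontr)
  assume nz: "\<not> ?thesis"
  have rows: "rows (vector [r1, r2] :: 'a ^ 'n ^ 2) = {r1, r2}"
  proof -
    have "rows (vector [r1, r2] :: 'a ^ 'n ^ 2) = (\<lambda>i. row i (vector [r1, r2] :: 'a ^ 'n ^ 2)) ` UNIV"
      by (auto simp: rows_def)
    then show ?thesis by (simp add: row_def UNIV_2 vec_lambda_eta)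
  qed
  have "\<exists>w. {r1, r2} \<subseteq> vec.span {w}"
  proof (cases "c1 = 0")
    case True
    with nz have "c2 \<noteq> 0" by simp
    with c True have "r2 = 0" by (simp add: vec_eq_iff)
    then have "{r1, r2} \<subseteq> vec.span {r1}" by (simp add: vec.span_base vec.span_zero)
    then show ?thesis by blast
  next
    case False
    have "r1 = (- c2 / c1) *s r2"
      using c False by (simp add: vec_eq_iff field_simps eq_neg_iff_add_eq_0)
    then have "r1 \<in> vec.span {r2}" by (metis vec.span_base vec.span_scale singletonI)
    then have "{r1, r2} \<subseteq> vec.span {r2}" by (simp add: vec.span_base)
    then show ?thesis by blast
  qed
  then obtain w where "{r1, r2} \<subseteq> vec.span {w}" by blast
  then have "vec.dim {r1, r2} \<le> card {w}" by (rule vec.dim_le_card) simp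
  then show False using assms(1) unfolding row_rank_def_gen rows by simp
qed

text \<open>Rank two means independent rows, hence a surjective matrix: both directional derivatives
  can be prescribed at once.\<close>

lemma rank_2_solve:
  fixes r1 r2 :: "'a::field ^ 'n::finite"
  assumes "rank (vector [r1, r2] :: 'a ^ 'n ^ 2) = 2"
  shows "\<exists>x. (\<Sum>i\<in>UNIV. r1 $ i * x $ i) = b1 \<and> (\<Sum>i\<in>UNIV. r2 $ i * x $ i) = b2"
proof -
  let ?A = "vector [r1, r2] :: 'a ^ 'n ^ 2"
  have "\<forall>c. (\<Sum>i\<in>UNIV. c i *s row i ?A) = 0 \<longrightarrow> (\<forall>i. c i = 0)"
  proof (intro allI impI)
    fix c :: "2 \<Rightarrow> 'a" and i :: 2
    assume "(\<Sum>i\<in>UNIV. c i *s row i ?A) = 0"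
    then have "c 1 *s r1 + c 2 *s r2 = 0" by (simp add: UNIV_2 row_def vec_lambda_eta)
    from rank_2_independent[OF assms this] show "c i = 0" using exhaust_2[of i] by auto
  qed
  then have "surj ((*v) ?A)"
    using matrix_right_invertible_independent_rows[of ?A] matrix_right_invertible_surjective[of ?A] by blast
  then obtain x where "?A *v x = vector [b1, b2]" by (metis surjD)
  then show ?thesis
    by (intro exI[of _ x]) (auto simp: vec_eq_iff forall_2 matrix_vector_mult_def)
qed

text \<open>The quantifier over \<open>h\<close> is inside, so that one p-adic lift of the direction
  serves \<open>f\<close> and \<open>g\<close> simultaneously.\<close>

lemma dirderiv_lift: "\<exists>v :: 'p :: prime_card padic_int ^ 'n :: finite. \<forall>h. dirderiv h a v = (\<Sum>i\<in>UNIV. mpoly_eval (mpoly_pderiv i h) a * x $ i)"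
proof -
  obtain v :: "'p padic_int ^ 'n" where "red_vec v = x" using red_vec_surj by blast
  then have "red (v $ i) = x $ i" for i by (simp flip: red_vec_nth)
  then show ?thesis unfolding dirderiv_def by (intro exI[of _ v]) simp
qed

lemma nondegenerate_dirderiv:
  fixes f :: "('p :: prime_card padic_int, 'n :: finite) mpoly" and a :: "'p mod_ring ^ 'n"
  assumes f: "f \<noteq> 0" "nondegenerate f" and a: "\<forall>i. a $ i \<noteq> 0" and z: "mpoly_eval (reduced_face f k) a = 0"
  shows "\<exists>v. dirderiv (reduced_face f k) a v = 1"
proof -
  have "newton_F f (exponent_vec k) \<in> newton_faces f" by (intro newton_F_in_faces f) simp
  with f(2) a z obtain i where i: "mpoly_eval (mpoly_pderiv i (reduced_face f k)) a \<noteq> 0"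
    unfolding nondegenerate_def reduced_face_def by blast
  let ?c = "\<lambda>i. mpoly_eval (mpoly_pderiv i (reduced_face f k)) a"
  \<comment> \<open>The axis direction of a nonvanishing partial derivative, scaled by its
    inverse.\<close>
  obtain v :: "'p padic_int ^ 'n" where v: "\<And>h. dirderiv h a v = (\<Sum>l\<in>UNIV. mpoly_eval (mpoly_pderiv l h) a * axis i (inverse (?c i)) $ l)"
    using dirderiv_lift[of a "axis i (inverse (?c i))"] by blast
  have "(\<Sum>l\<in>UNIV. ?c l * axis i (inverse (?c i)) $ l) = (\<Sum>l\<in>{i}. ?c l * axis i (inverse (?c i)) $ l)"
    by (rule sum.mono_neutral_right) (auto simp: axis_def)
  then have "dirderiv (reduced_face f k) a v = 1" unfolding v using i by (simp add: axis_def)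
  then show ?thesis by blast
qed

lemma nondegenerate_pair_dirderiv:
  fixes f g :: "('p :: prime_card padic_int, 'n :: finite) mpoly" and a :: "'p mod_ring ^ 'n"
  assumes fg: "f \<noteq> 0" "g \<noteq> 0" "nondegenerate_pair f g" and a: "\<forall>i. a $ i \<noteq> 0"
    and z: "mpoly_eval (reduced_face f k) a = 0" "mpoly_eval (reduced_face g k) a = 0"
  shows "\<exists>v. dirderiv (reduced_face f k) a v = b1 \<and> dirderiv (reduced_face g k) a v = b2"
proof -
  let ?\<delta> = "cone_class f g (exponent_vec k)"
  have d: "?\<delta> \<in> cone_partition f g" unfolding cone_partition_eq[OF fg(1,2)] by simp
  note cp = cone_poly_eq[OF fg(1,2) exponent_vec_orthant[of k]]
  \<comment> \<open>The pair condition speaks of p-adic units, the counting of points over the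
    residue field; a lift of \<open>a\<close> connects them.\<close>
  obtain y where y: "red_vec y = a" using red_vec_surj by blast
  have "\<forall>i. y $ i dvd 1" using a unfolding dvd_1_iff_red y[symmetric] by simp
  moreover have "of_nat CARD('p) dvd mpoly_eval (cone_poly f ?\<delta>) y" "of_nat CARD('p) dvd mpoly_eval (cone_poly g ?\<delta>) y"
    unfolding red_eq_0_iff[symmetric] red_mpoly_eval cp y using z by (simp_all add: reduced_face_def)
  ultimately have "rank (vector [\<chi> i. red (mpoly_eval (mpoly_pderiv i (cone_poly f ?\<delta>)) y),
                      \<chi> i. red (mpoly_eval (mpoly_pderiv i (cone_poly g ?\<delta>)) y)] :: 'p mod_ring ^ 'n ^ 2) = 2"
    using fg(3) d unfolding nondegenerate_pair_def by blast
  from rank_2_solve[OF this, of b1 b2] obtain x where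
    x: "(\<Sum>i\<in>UNIV. mpoly_eval (mpoly_pderiv i (reduced_face f k)) a * x $ i) = b1"
       "(\<Sum>i\<in>UNIV. mpoly_eval (mpoly_pderiv i (reduced_face g k)) a * x $ i) = b2"
    unfolding red_mpoly_eval_pderiv cp y reduced_face_def[symmetric] by auto
  from dirderiv_lift[of a x] obtain v :: "'p padic_int ^ 'n"
    where "\<And>h. dirderiv h a v = (\<Sum>i\<in>UNIV. mpoly_eval (mpoly_pderiv i h) a * x $ i)" by blast
  then show ?thesis using x by (intro exI[of _ v]) simp
qed

lemma exponent_vec_inject: "exponent_vec k = exponent_vec k' \<longleftrightarrow> k = k'"
  by (simp add: exponent_vec_def vec_eq_iff)

lemma natural_points_eq: "natural_points = range exponent_vec"
proof (intro equalityI subsetI)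
  fix x :: "real ^ 'n" assume "x \<in> natural_points"
  then have "\<forall>i. \<exists>n. x $ i = real n" by (auto simp: natural_points_def Nats_def)
  then obtain n where "\<And>i. x $ i = real (n i)" by metis
  then have "x = exponent_vec (\<chi> i. n i)" by (simp add: exponent_vec_def vec_eq_iff)
  then show "x \<in> range exponent_vec" by blast
qed (auto simp: natural_points_def exponent_vec_def)

lemma sigma_exponent_vec: "sigma (exponent_vec k) = real (\<Sum>i\<in>UNIV. k $ i)"
  by (simp add: sigma_def exponent_vec_def)

lemma powr_neg_of_nat:
  assumes "0 < (p :: real)"
  shows "complex_of_real p powr (- of_nat m * s) = (of_real p powr - s) ^ m"
proof -
  have "complex_of_real p powr (- of_nat m * s) = exp (of_nat m * (- s * of_real (ln p)))"
    using assms by (simp add: powr_def Ln_of_real mult.assoc)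
  also have "\<dots> = exp (- s * of_real (ln p)) ^ m" by (rule exp_of_nat_mult)
  also have "\<dots> = (of_real p powr - s) ^ m" using assms by (simp add: powr_def Ln_of_real)
  finally show ?thesis .
qed

lemma S_summand_exponent_vec:
  fixes f g :: "('p :: prime_card padic_int, 'n :: finite) mpoly"
  assumes "f \<noteq> 0" "g \<noteq> 0"
  defines "p \<equiv> real CARD('p)"
  shows "S_summand f g s (exponent_vec k) =
    (of_real p powr - s) ^ newton_min f k * of_real (1 / p) ^ newton_min g k * of_real (1 / p) ^ (\<Sum>i\<in>UNIV. k $ i)"
proof -
  have p: "0 < p" using CARD_prime_gt[where ?'p = 'p] by (simp add: p_def)
  have q: "of_real p powr - 1 = complex_of_real (1 / p)"
    using p by (simp add: powr_minus divide_inverse)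
  have "S_summand f g s (exponent_vec k) = of_real p powr (- of_nat (newton_min f k) * s + (- of_nat (newton_min g k) * 1) + (- of_nat (\<Sum>i\<in>UNIV. k $ i) * 1))"
    unfolding S_summand_def cone_exponent_def newton_m_exponent_vec[OF assms(1)] newton_m_exponent_vec[OF assms(2)] sigma_exponent_vec
    by (simp add: p_def algebra_simps)
  also have "\<dots> = of_real p powr (- of_nat (newton_min f k) * s) * of_real p powr (- of_nat (newton_min g k) * 1) * of_real p powr (- of_nat (\<Sum>i\<in>UNIV. k $ i) * 1)"
    by (simp only: powr_add)
  finally show ?thesis unfolding powr_neg_of_nat[OF p] q .
qed

text \<open>Explains the shape of \<open>L_term\<close>: all points counted with weight one, minus a
  correction for each class on which at least one polynomial vanishes modulo
  \<open>p\<close>.\<close>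

lemma sum_four_cases:
  fixes A :: "'a set" and c1 c2 :: complex
  assumes "finite A"
  shows "(\<Sum>a\<in>A. (if P a then 1 else c1) * (if Q a then 1 else c2)) =
    of_nat (card A) - (1 - c1) * of_nat (card {a \<in> A. \<not> P a \<and> Q a}) - (1 - c2) * of_nat (card {a \<in> A. P a \<and> \<not> Q a})
     - (1 - c1 * c2) * of_nat (card {a \<in> A. \<not> P a \<and> \<not> Q a})"
proof -
  have card: "of_nat (card {a \<in> A. R a}) = (\<Sum>a\<in>A. if R a then 1 else 0 :: complex)" for R
    using assms by (simp add: sum.If_cases Int_def)
  have cA: "of_nat (card A) = (\<Sum>a\<in>A. 1 :: complex)" by simp
  show ?thesis
    unfolding cA card sum_distrib_left sum_subtractf[symmetric]
    by (auto intro!: sum.cong)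
qed

lemma card_units: "card {a :: 'p :: prime_card mod_ring ^ 'n :: finite. \<forall>i. a $ i \<noteq> 0} = (CARD('p) - 1) ^ CARD('n)"
proof -
  have "bij_betw vec_nth {a :: 'p mod_ring ^ 'n. \<forall>i. a $ i \<noteq> 0} (Pi\<^sub>E UNIV (\<lambda>_. - {0}))"
    by (rule bij_betw_byWitness[where f' = vec_lambda]) (auto simp: PiE_def)
  then have "card {a :: 'p mod_ring ^ 'n. \<forall>i. a $ i \<noteq> 0} = card (Pi\<^sub>E (UNIV :: 'n set) (\<lambda>_. - {0 :: 'p mod_ring}))"
    by (rule bij_betw_same_card)
  also have "\<dots> = (CARD('p) - 1) ^ CARD('n)"
    by (subst card_PiE) (simp_all add: Compl_eq_Diff_UNIV)
  finally show ?thesis .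
qed

lemma L_term_eq:
  fixes f g :: "('p :: prime_card padic_int, 'n :: finite) mpoly"
  assumes fg: "f \<noteq> 0" "g \<noteq> 0" and s: "Re s > 0"
  defines "q \<equiv> 1 / real CARD('p)"
  shows "L_term f g (cone_class f g (exponent_vec k)) s = of_real q ^ CARD('n) *
    (\<Sum>a\<in>{a :: 'p mod_ring ^ 'n. \<forall>i. a $ i \<noteq> 0}. unit_weight q (mpoly_eval (reduced_face f k) a \<noteq> 0) (of_real (real CARD('p)) powr - s) *
       unit_weight q (mpoly_eval (reduced_face g k) a \<noteq> 0) (of_real q))"
proof -
  define p where "p = (of_nat CARD('p) :: complex)"
  have p1: "1 < CARD('p)" using CARD_prime_gt[where ?'p = 'p] by simp
  have p0: "p \<noteq> 0" "p + 1 \<noteq> 0" "p - 1 \<noteq> 0" using p1 of_nat_neq_0[of "CARD('p)", where 'a = complex]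
    by (auto simp: p_def add.commute)
  have q: "complex_of_real q = 1 / p" by (simp add: q_def p_def)
  let ?\<delta> = "cone_class f g (exponent_vec k)"
  note cp = cone_poly_eq[OF fg(1,2) exponent_vec_orthant[of k]]
  define X where "X = p powr s"
  have X: "of_real (real CARD('p)) powr - s = 1 / X" "p powr (s + 1) = X * p" "X \<noteq> 0"
    using p0 by (simp_all add: X_def p_def powr_minus powr_add divide_inverse)
  \<comment> \<open>The denominator \<open>p^(s+1) - 1\<close> does not vanish, since
    \<open>p^(s+1)\<close> has norm greater than one for \<open>Re s > 0\<close>.\<close>
  have Xp: "X * p - 1 \<noteq> 0"
  proof
    assume "X * p - 1 = 0"
    then have "norm (p powr (s + 1)) = 1" using X(2) by simp
    moreover have "norm (p powr (s + 1)) = real CARD('p) powr (Re s + 1)"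
      unfolding p_def using p1 norm_powr_real_powr[of "real CARD('p)" "s + 1"] by simp
    moreover have "1 < real CARD('p) powr (Re s + 1)" using p1 s by (intro gr_one_powr) auto
    ultimately show False by simp
  qed
  have cards: "N_count f g ?\<delta> = card {a \<in> {a :: 'p mod_ring ^ 'n. \<forall>i. a $ i \<noteq> 0}. \<not> mpoly_eval (reduced_face f k) a \<noteq> 0 \<and> mpoly_eval (reduced_face g k) a \<noteq> 0}"
    "P_count f g ?\<delta> = card {a \<in> {a :: 'p mod_ring ^ 'n. \<forall>i. a $ i \<noteq> 0}. mpoly_eval (reduced_face f k) a \<noteq> 0 \<and> \<not> mpoly_eval (reduced_face g k) a \<noteq> 0}"
    "Q_count f g ?\<delta> = card {a \<in> {a :: 'p mod_ring ^ 'n. \<forall>i. a $ i \<noteq> 0}. \<not> mpoly_eval (reduced_face f k) a \<noteq> 0 \<and> \<not> mpoly_eval (reduced_face g k) a \<noteq> 0}"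
    unfolding N_count_def P_count_def Q_count_def cp reduced_face_def[symmetric] by simp_all
  \<comment> \<open>The two non-unit weights in terms of \<open>X = p^s\<close>: \<open>w1\<close>
    belongs to \<open>f\<close> at \<open>z = 1/X\<close>, \<open>w2\<close> to \<open>g\<close> at
    \<open>z = 1/p\<close>.\<close>
  have w1: "1 / X * (1 - 1 / p) / (1 - 1 / X * (1 / p)) = (p - 1) / (X * p - 1)"
    using p0 X(3) Xp by (simp add: divide_simps)
  have pp: "p * p - 1 \<noteq> 0"
  proof -
    have "p * p - 1 = (p + 1) * (p - 1)" by (simp add: algebra_simps)
    then show ?thesis using p0 by simp
  qed
  have w2: "1 / p * (1 - 1 / p) / (1 - 1 / p * (1 / p)) = 1 / (p + 1)"
    using p0 pp by (simp add: divide_simps) (simp add: algebra_simps)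
  have uc: "of_nat (card {a :: 'p mod_ring ^ 'n. \<forall>i. a $ i \<noteq> 0}) = (p - 1) ^ CARD('n)"
    unfolding card_units p_def using p1 by (simp add: of_nat_diff)
  \<comment> \<open>The corrections \<open>1 - c1\<close>, \<open>1 - c2\<close> and
    \<open>1 - c1 * c2\<close> are the coefficients of \<open>N_count\<close>,
    \<open>P_count\<close> and \<open>Q_count\<close>.\<close>
  have e1: "1 - (p - 1) / (X * p - 1) = p * ((X - 1) / (X * p - 1))"
    using Xp by (simp add: divide_simps) (simp add: algebra_simps)
  have e2: "1 - 1 / (p + 1) = p / (p + 1)"
    using p0 by (simp add: divide_simps)
  have e3: "1 - (p - 1) / (X * p - 1) * (1 / (p + 1)) = p * ((X * (p + 1) - 2) / ((X * p - 1) * (p + 1)))"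
    using Xp p0 by (simp add: divide_simps) (simp add: algebra_simps)
  show ?thesis
    unfolding unit_weight_def X(1) q w1 w2 sum_four_cases[OF finite] uc cards[symmetric] e1 e2 e3
    unfolding L_term_def Let_def p_def[symmetric] X_def[symmetric] X(2)
    by (simp add: power_one_over algebra_simps)
qed

section \<open>Summation over the shells\<close>

abbreviation units :: "('p :: prime_card mod_ring ^ 'n :: finite) set" where
  "units \<equiv> {a. \<forall>i. a $ i \<noteq> 0}"

text \<open>With nonzero reductions, coordinate \<open>i\<close> has norm \<open>p^(-k_i)\<close>,
  so the point determines \<open>k\<close>, then \<open>u\<close>, then \<open>a\<close>.\<close>

lemma shell_disjoint:
  assumes "a \<in> units" "a' \<in> units" "x \<in> shell k a" "x \<in> shell k' a'"
  shows "k = k' \<and> a = a'"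
proof -
  obtain u u' where u: "x = scale_vec k u" "red_vec u = a" "x = scale_vec k' u'" "red_vec u' = a'"
    using assms(3,4) unfolding shell_def by blast
  have "k $ i = k' $ i" for i
  proof -
    have nz: "red (u $ i) \<noteq> 0" "red (u' $ i) \<noteq> 0" using assms(1,2) u(2,4) by auto
    have "prime_p ^ k $ i * u $ i = prime_p ^ k' $ i * u' $ i"
      using u(1,3) by (simp add: scale_vec_def vec_eq_iff)
    then have "1 / real CARD('a) ^ k $ i = 1 / real CARD('a) ^ k' $ i"
      using padic_abs_unit_mult[OF nz(1), of "k $ i"] padic_abs_unit_mult[OF nz(2), of "k' $ i"] by simp
    moreover have "1 < real CARD('a)" using CARD_prime_gt[where ?'p = 'a] by simp
    ultimately show ?thesis by simp
  qed
  then have "k = k'" by (simp add: vec_eq_iff)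
  moreover from this have "u = u'" using u(1,3) by (simp add: scale_vec_inject)
  ultimately show ?thesis using u by simp
qed

lemma shell_cover:
  fixes x :: "'p :: prime_card padic_int ^ 'n :: finite"
  assumes "\<forall>i. x $ i \<noteq> 0"
  shows "\<exists>k. \<exists>a\<in>units. x \<in> shell k a"
proof -
  have "\<forall>i. \<exists>k u. x $ i = prime_p ^ k * u \<and> red u \<noteq> 0" 
  proof
    fix i
    have "x $ i \<noteq> 0" using assms by blast
    then show "\<exists>k u. x $ i = prime_p ^ k * u \<and> red u \<noteq> 0" by (rule padic_cases) blast
  qed
  then obtain k where "\<forall>i. \<exists>u. x $ i = prime_p ^ k i * u \<and> red u \<noteq> 0" by (auto dest: choice)
  then obtain u where ku: "\<And>i. x $ i = prime_p ^ k i * u i" "\<And>i. red (u i) \<noteq> 0" by (auto dest: choice)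
  have "x = scale_vec (\<chi> i. k i) (\<chi> i. u i)" using ku(1) by (simp add: scale_vec_def vec_eq_iff)
  then have "x \<in> shell (\<chi> i. k i) (red_vec (\<chi> i. u i))" by (auto simp: shell_def)
  moreover have "red_vec (\<chi> i. u i) \<in> units" using ku(2) by simp
  ultimately show ?thesis by blast
qed

context haar
begin

text \<open>The shells miss the points with a vanishing coordinate. Each coordinate hyperplane lies
  in boxes of measure \<open>p^(-m)\<close> for every \<open>m\<close>.\<close>

lemma AE_nonzero: "AE x in \<mu>. \<forall>i. x $ i \<noteq> 0"
proof -
  have "AE x in \<mu>. x $ i \<noteq> 0" for i
  proof -
    let ?B = "\<lambda>m. box (\<chi> l. if l = i then m else 0) 0"
    have B: "?B m \<in> sets \<mu>" "measure \<mu> (?B m) = (1 / real CARD('p)) ^ m" for m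
      using measure_box[of "\<chi> l. if l = i then m else 0" 0] by simp_all
    have "(\<Inter>m. ?B m) \<in> null_sets \<mu>"
    proof (rule null_setsI)
      show "emeasure \<mu> (\<Inter>m. ?B m) = 0"
      proof -
        have "measure \<mu> (\<Inter>m. ?B m) \<le> (1 / real CARD('p)) ^ m" for m
          using finite_measure_mono[of "\<Inter>m. ?B m" "?B m"] B by auto
        moreover have "(\<lambda>m. (1 / real CARD('p)) ^ m) \<longlonglongrightarrow> 0"
          using CARD_prime_gt[where ?'p = 'p] by (intro LIMSEQ_power_zero) simp
        ultimately have "measure \<mu> (\<Inter>m. ?B m) \<le> 0" by (intro LIMSEQ_le_const) auto
        then have "measure \<mu> (\<Inter>m. ?B m) = 0" using measure_le_0_iff by blast
        then show ?thesis by (simp add: emeasure_eq_measure)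
      qed
    qed (use B in auto)
    moreover have "{x \<in> space \<mu>. \<not> x $ i \<noteq> 0} \<subseteq> (\<Inter>m. ?B m)" by (auto simp: box_def)
    ultimately show ?thesis by (rule AE_I')
  qed
  then show ?thesis by (simp add: AE_all_countable countableI_type)
qed

lemma zeta_has_sum:
  fixes f g :: "('p padic_int, 'n) mpoly"
  assumes f: "f \<noteq> 0" "nondegenerate f" and g: "g \<noteq> 0" "nondegenerate g" and fg: "nondegenerate_pair f g" and s: "Re s > 0"
  shows "((\<lambda>k. S_summand f g s (exponent_vec k) * L_term f g (cone_class f g (exponent_vec k)) s) has_sum zeta_fun \<mu> f g s) UNIV"
proof -
  let ?U = "units :: ('p mod_ring ^ 'n) set"
  have "((\<lambda>(k, a). \<integral>x. indicator (shell k a) x * zeta_integrand f g s x \<partial>\<mu>) has_sum (\<integral>x. zeta_integrand f g s x \<partial>\<mu>)) (UNIV \<times> ?U)"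
  proof -
    have "((\<lambda>i. \<integral>x. indicator (case_prod shell i) x * zeta_integrand f g s x \<partial>\<mu>) has_sum (\<integral>x. zeta_integrand f g s x \<partial>\<mu>)) (UNIV \<times> ?U)"
    proof (rule has_sum_integral_partition)
      show "countable ((UNIV :: (nat ^ 'n) set) \<times> ?U)" by (rule countable_SIGMA) (auto intro: countable_finite countableI_type)
      show "disjoint_family_on (case_prod shell) (UNIV \<times> ?U)"
        unfolding disjoint_family_on_def using shell_disjoint by fastforce
      show "AE x in \<mu>. x \<notin> (\<Union>i\<in>UNIV \<times> ?U. case_prod shell i) \<longrightarrow> zeta_integrand f g s x = 0"
        using AE_nonzero
      proof eventually_elim
        fix x :: "'p padic_int ^ 'n" assume "\<forall>i. x $ i \<noteq> 0"
        from shell_cover[OF this] show "x \<notin> (\<Union>i\<in>UNIV \<times> ?U. case_prod shell i) \<longrightarrow> zeta_integrand f g s x = 0"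
          by auto
      qed
    qed (auto simp: measure_shell integrable_zeta_integrand s)
    then show ?thesis by (simp add: case_prod_unfold)
  qed
  then have 1: "((\<lambda>k. \<Sum>a\<in>?U. \<integral>x. indicator (shell k a) x * zeta_integrand f g s x \<partial>\<mu>) has_sum (\<integral>x. zeta_integrand f g s x \<partial>\<mu>)) UNIV"
    by (rule has_sum_SigmaD) (simp add: has_sum_finite)
  have "(\<Sum>a\<in>?U. \<integral>x. indicator (shell k a) x * zeta_integrand f g s x \<partial>\<mu>) =
      S_summand f g s (exponent_vec k) * L_term f g (cone_class f g (exponent_vec k)) s" for k
  proof -
    have "(\<Sum>a\<in>?U. \<integral>x. indicator (shell k a) x * zeta_integrand f g s x \<partial>\<mu>) =
      (\<Sum>a\<in>?U. of_real (measure \<mu> (shell k a)) * (of_real (real CARD('p)) powr - s) ^ newton_min f k * of_real (1 / real CARD('p)) ^ newton_min g k *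
        unit_weight (1 / real CARD('p)) (mpoly_eval (reduced_face f k) a \<noteq> 0) (of_real (real CARD('p)) powr - s) *
        unit_weight (1 / real CARD('p)) (mpoly_eval (reduced_face g k) a \<noteq> 0) (of_real (1 / real CARD('p))))"
      by (intro sum.cong refl integral_shell f g s)
        (use nondegenerate_dirderiv[OF f] nondegenerate_dirderiv[OF g] nondegenerate_pair_dirderiv[OF f(1) g(1) fg] in auto)
    then show ?thesis
      unfolding measure_shell S_summand_exponent_vec[OF f(1) g(1)] L_term_eq[OF f(1) g(1) s]
      by (simp add: sum_distrib_left power_add mult_ac)
  qed
  with 1 show ?thesis by (simp add: zeta_fun_def)
qed

text \<open>Summability is borrowed from the measure: the norm of the summand is at most
  \<open>p^(-\<sigma>(k))\<close>, that is \<open>p^n\<close> times the measure of a shell, and the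
  shells of one fixed reduction, here \<open>(1, ..., 1)\<close>, are disjoint in a space of total
  mass one.\<close>

lemma S_summand_summable:
  fixes f g :: "('p padic_int, 'n) mpoly"
  assumes f: "f \<noteq> 0" and g: "g \<noteq> 0" and s: "Re s > 0"
  shows "(\<lambda>k. norm (S_summand f g s (exponent_vec k))) summable_on UNIV"
proof -
  define a :: "'p mod_ring ^ 'n" where "a = (\<chi> i. (1 :: 'p mod_ring))" 
  have a: "a \<in> (units :: ('p mod_ring ^ 'n) set)" by (simp add: a_def)
  have p: "1 < real CARD('p)" using CARD_prime_gt[where ?'p = 'p] by simp
  have "((\<lambda>k. \<integral>x. indicator (shell k a) x * indicator (\<Union>k. shell k a) x \<partial>\<mu>) has_sum (\<integral>x. indicator (\<Union>k. shell k a) x \<partial>\<mu> :: complex)) UNIV"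
  proof (rule has_sum_integral_partition)
    show "disjoint_family_on (\<lambda>k. shell k a) UNIV"
      unfolding disjoint_family_on_def using shell_disjoint[OF a a] by blast
    have U: "(\<Union>k. shell k a) \<in> sets \<mu>" by (intro sets.countable_UN') (auto simp: measure_shell)
    have "integrable \<mu> (\<lambda>x. indicator (\<Union>k. shell k a) x *\<^sub>R (1 :: complex))"
      by (intro integrable_mult_indicator U) simp
    also have "(\<lambda>x. indicator (\<Union>k. shell k a) x *\<^sub>R (1 :: complex)) = indicator (\<Union>k. shell k a)"
      by (simp add: fun_eq_iff indicator_def)
    finally show "integrable \<mu> (indicator (\<Union>k. shell k a) :: _ \<Rightarrow> complex)" .
  qed (auto simp: measure_shell)
  also have "(\<lambda>k. \<integral>x. indicator (shell k a) x * indicator (\<Union>k. shell k a) x \<partial>\<mu>) =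
     (\<lambda>k. complex_of_real (measure \<mu> (shell k a)))"
  proof
    fix k
    have "(\<integral>x. indicator (shell k a) x * indicator (\<Union>k. shell k a) x \<partial>\<mu>) = (\<integral>x. indicator (shell k a) x *\<^sub>R (1 :: complex) \<partial>\<mu>)"
      by (rule Bochner_Integration.integral_cong) (auto simp: indicator_def)
    also have "\<dots> = complex_of_real (measure \<mu> (shell k a))"
      by (simp add: measure_shell scaleR_conv_of_real)
    finally show "(\<integral>x. indicator (shell k a) x * indicator (\<Union>k. shell k a) x \<partial>\<mu>) = complex_of_real (measure \<mu> (shell k a))" .
  qed
  finally have "(\<lambda>k. complex_of_real (measure \<mu> (shell k a))) summable_on UNIV" by (rule has_sum_imp_summable)
  then have "(\<lambda>k. of_real (real CARD('p)) ^ CARD('n) * complex_of_real (measure \<mu> (shell k a))) summable_on UNIV"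
    by (rule summable_on_cmult_right)
  then have "(\<lambda>k. norm (of_real (real CARD('p)) ^ CARD('n) * complex_of_real (measure \<mu> (shell k a)))) summable_on UNIV"
    by (rule summable_on_iff_abs_summable_on_complex[THEN iffD1])
  then show ?thesis
  proof (rule Infinite_Sum.abs_summable_on_comparison_test)
    fix k :: "nat ^ 'n"
    have P1: "norm (complex_of_real (real CARD('p)) powr - s) \<le> 1"
    proof -
      have "norm (complex_of_real (real CARD('p)) powr - s) = real CARD('p) powr - Re s" using p by (subst norm_powr_real_powr) auto
      also have "\<dots> \<le> real CARD('p) powr 0" using p s by (intro powr_mono) auto
      finally show ?thesis using p by simp
    qed
    let ?q = "1 / real CARD('p)"
    have nq: "norm (complex_of_real ?q) = ?q" using p by (subst norm_of_real) simp
    have "norm (S_summand f g s (exponent_vec k)) =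
       norm (complex_of_real (real CARD('p)) powr - s) ^ newton_min f k * ?q ^ newton_min g k * ?q ^ (\<Sum>i\<in>UNIV. k $ i)"
      unfolding S_summand_exponent_vec[OF f g] norm_mult norm_power nq by (rule refl)
    also have "\<dots> \<le> 1 * 1 * ?q ^ (\<Sum>i\<in>UNIV. k $ i)"
      using p P1 by (intro mult_mono power_le_one) auto
    also have "\<dots> = real CARD('p) ^ CARD('n) * ?q ^ ((\<Sum>i\<in>UNIV. k $ i) + CARD('n))"
      using p by (simp add: power_add power_one_over)
    also have "\<dots> = norm (of_real (real CARD('p)) ^ CARD('n) * complex_of_real (measure \<mu> (shell k a)))"
      unfolding measure_shell norm_mult norm_power norm_of_real by simp
    finally show "norm (S_summand f g s (exponent_vec k)) \<le> norm (of_real (real CARD('p)) ^ CARD('n) * complex_of_real (measure \<mu> (shell k a)))" .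
  qed
qed

lemma S_summand_summable_natural:
  fixes f g :: "('p padic_int, 'n) mpoly"
  assumes f: "f \<noteq> 0" and g: "g \<noteq> 0" and s: "Re s > 0"
  shows "(\<lambda>k. norm (S_summand f g s k)) summable_on natural_points"
proof -
  have "inj (exponent_vec :: nat ^ 'n \<Rightarrow> _)" by (simp add: inj_def exponent_vec_inject)
  from summable_on_reindex[OF this, of "\<lambda>k. norm (S_summand f g s k)"]
  show ?thesis using S_summand_summable[OF assms] unfolding natural_points_eq o_def by blast
qed

lemma zeta_formula:
  fixes f g :: "('p padic_int, 'n) mpoly"
  assumes f: "f \<noteq> 0" "nondegenerate f" and g: "g \<noteq> 0" "nondegenerate g" and fg: "nondegenerate_pair f g" and s: "Re s > 0"
  shows "zeta_fun \<mu> f g s = (\<Sum>\<delta>\<in>cone_partition f g. L_term f g \<delta> s * S_term f g \<delta> s)"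
proof -
  let ?D = "cone_partition f g"
  \<comment> \<open>Lattice points tagged with their cone. Since the cones partition the orthant,
    \<open>snd\<close> is a bijection onto the lattice points, and the sum may be grouped by the
    tag.\<close>
  let ?S = "Sigma ?D (\<lambda>\<delta>. natural_points \<inter> \<delta>)"
  have no: "natural_points \<subseteq> (orthant :: (real ^ 'n) set)" by (auto simp: natural_points_eq)
  have cl: "\<delta> = cone_class f g k" if "\<delta> \<in> ?D" "k \<in> \<delta>" for \<delta> k
    using that cone_class_eq unfolding cone_partition_eq[OF f(1) g(1)] by blast
  have inj: "inj_on snd ?S" using cl by (auto simp: inj_on_def)
  have img: "snd ` ?S = natural_points"
  proof
    show "natural_points \<subseteq> snd ` ?S"
    proof
      fix k :: "real ^ 'n" assume k: "k \<in> natural_points"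
      then have "(cone_class f g k, k) \<in> ?S"
        using no cone_class_refl[of k f g] by (auto simp: cone_partition_eq[OF f(1) g(1)])
      then show "k \<in> snd ` ?S" by force
    qed
  qed auto
  have inj_e: "inj (exponent_vec :: nat ^ 'n \<Rightarrow> _)" by (simp add: inj_def exponent_vec_inject)
  have "((\<lambda>k. S_summand f g s k * L_term f g (cone_class f g k) s) has_sum zeta_fun \<mu> f g s) natural_points"
    unfolding natural_points_eq by (subst has_sum_reindex[OF inj_e]) (use zeta_has_sum[OF assms] in \<open>simp add: o_def\<close>)
  then have "((\<lambda>i. S_summand f g s (snd i) * L_term f g (cone_class f g (snd i)) s) has_sum zeta_fun \<mu> f g s) ?S"
    using has_sum_reindex[OF inj, unfolded img, of "\<lambda>k. S_summand f g s k * L_term f g (cone_class f g k) s" "zeta_fun \<mu> f g s"]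
    unfolding o_def by blast
  then have "((\<lambda>\<delta>. S_term f g \<delta> s * L_term f g \<delta> s) has_sum zeta_fun \<mu> f g s) ?D"
  proof (rule has_sum_SigmaD)
    fix \<delta> assume d: "\<delta> \<in> ?D"
    have "(\<lambda>k. norm (S_summand f g s k)) summable_on (natural_points \<inter> \<delta>)"
      using S_summand_summable_natural[OF f(1) g(1) s] by (rule summable_on_subset_banach) auto
    then have "S_summand f g s summable_on (natural_points \<inter> \<delta>)" by (rule abs_summable_summable)
    then have "(S_summand f g s has_sum S_term f g \<delta> s) (natural_points \<inter> \<delta>)"
      unfolding S_term_def by (rule has_sum_infsum)
    then have "((\<lambda>k. S_summand f g s k * L_term f g \<delta> s) has_sum S_term f g \<delta> s * L_term f g \<delta> s) (natural_points \<inter> \<delta>)"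
      by (rule has_sum_cmult_left)
    also have "?this \<longleftrightarrow> ((\<lambda>k. S_summand f g s (snd (\<delta>, k)) * L_term f g (cone_class f g (snd (\<delta>, k))) s) has_sum S_term f g \<delta> s * L_term f g \<delta> s) (natural_points \<inter> \<delta>)"
      by (rule has_sum_cong) (use cl[OF d] in auto)
    finally show "((\<lambda>k. S_summand f g s (snd (\<delta>, k)) * L_term f g (cone_class f g (snd (\<delta>, k))) s) has_sum S_term f g \<delta> s * L_term f g \<delta> s) (natural_points \<inter> \<delta>)" .
  qed
  then show ?thesis using finite_cone_partition[OF f(1) g(1)] by (simp add: has_sum_finite_iff mult.commute)
qed

end

section \<open>Lattice points of simplicial cones\<close>

definition int_points :: "(real ^ 'n :: finite) set" where
  "int_points = {x. \<forall>i. x $ i \<in> \<int>}"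

lemma int_points_add: "x \<in> int_points \<Longrightarrow> y \<in> int_points \<Longrightarrow> x + y \<in> int_points"
  and int_points_diff: "x \<in> int_points \<Longrightarrow> y \<in> int_points \<Longrightarrow> x - y \<in> int_points"
  by (simp_all add: int_points_def)

lemma int_points_of_nat: "x \<in> int_points \<Longrightarrow> real n *\<^sub>R x \<in> int_points"
  by (simp add: int_points_def)

lemma int_points_sum: "(\<And>j. j \<in> J \<Longrightarrow> f j \<in> int_points) \<Longrightarrow> sum f J \<in> int_points"
  by (induction J rule: infinite_finite_induct) (auto simp: int_points_add, auto simp: int_points_def)

lemma primitive_int_points: "primitive k \<Longrightarrow> k \<in> int_points"
  by (auto simp: primitive_def int_points_def)

lemma finite_int_points_bounded: "finite {x :: real ^ 'n :: finite \<in> int_points. \<forall>i. \<bar>x $ i\<bar> \<le> B}"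
proof -
  have "{x :: real ^ 'n \<in> int_points. \<forall>i. \<bar>x $ i\<bar> \<le> B} \<subseteq> vec_lambda ` (Pi\<^sub>E UNIV (\<lambda>_. real_of_int ` {- \<lceil>B\<rceil>..\<lceil>B\<rceil>}))"
  proof
    fix x :: "real ^ 'n" assume x: "x \<in> {x \<in> int_points. \<forall>i. \<bar>x $ i\<bar> \<le> B}"
    have "x $ i \<in> real_of_int ` {- \<lceil>B\<rceil>..\<lceil>B\<rceil>}" for i
    proof -
      obtain m where m: "x $ i = real_of_int m" using x by (auto simp: int_points_def Ints_def)
      have "\<bar>real_of_int m\<bar> \<le> B" using x m by (metis (mono_tags, lifting) mem_Collect_eq)
      then have "m \<in> {- \<lceil>B\<rceil>..\<lceil>B\<rceil>}" by (auto simp: abs_le_iff; linarith)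
      then show ?thesis using m by blast
    qed
    then have "vec_nth x \<in> Pi\<^sub>E UNIV (\<lambda>_. real_of_int ` {- \<lceil>B\<rceil>..\<lceil>B\<rceil>})" by auto
    then have "vec_lambda (vec_nth x) \<in> vec_lambda ` (Pi\<^sub>E UNIV (\<lambda>_. real_of_int ` {- \<lceil>B\<rceil>..\<lceil>B\<rceil>}))" by (rule imageI)
    then show "x \<in> vec_lambda ` (Pi\<^sub>E UNIV (\<lambda>_. real_of_int ` {- \<lceil>B\<rceil>..\<lceil>B\<rceil>}))" by simp
  qed
  moreover have "finite (Pi\<^sub>E (UNIV :: 'n set) (\<lambda>_. real_of_int ` {- \<lceil>B\<rceil>..\<lceil>B\<rceil>}))" by (intro finite_PiE) auto
  ultimately show ?thesis by (meson finite_imageI finite_subset)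
qed

text \<open>A crude bound independent of the coefficients; it makes the lattice points of the
  parallelepiped, and later the remainders in the closed cone, finite in number.\<close>

lemma bounded_combination:
  fixes k :: "'j \<Rightarrow> real ^ 'n :: finite"
  assumes "\<And>j. j \<in> J \<Longrightarrow> 0 \<le> l j \<and> l j \<le> 1"
  shows "\<bar>vec_nth (\<Sum>j\<in>J. l j *\<^sub>R k j) i\<bar> \<le> (\<Sum>j\<in>J. \<Sum>i\<in>UNIV. \<bar>k j $ i\<bar>)"
proof -
  have "\<bar>vec_nth (\<Sum>j\<in>J. l j *\<^sub>R k j) i\<bar> \<le> (\<Sum>j\<in>J. \<bar>l j * k j $ i\<bar>)"
    by (simp add: sum_abs)
  also have "\<dots> \<le> (\<Sum>j\<in>J. \<Sum>i\<in>UNIV. \<bar>k j $ i\<bar>)"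
  proof (rule sum_mono)
    fix j assume "j \<in> J"
    then have "\<bar>l j * k j $ i\<bar> \<le> \<bar>k j $ i\<bar>"
      using assms[of j] by (simp add: abs_mult mult_left_le_one_le)
    also have "\<dots> \<le> (\<Sum>i\<in>UNIV. \<bar>k j $ i\<bar>)" by (rule member_le_sum) auto
    finally show "\<bar>l j * k j $ i\<bar> \<le> (\<Sum>i\<in>UNIV. \<bar>k j $ i\<bar>)" .
  qed
  finally show ?thesis .
qed

lemma finite_half_open_parallelepiped: "finite (half_open_parallelepiped_points r (k :: nat \<Rightarrow> real ^ 'n :: finite))"
proof (rule finite_subset)
  show "half_open_parallelepiped_points r k \<subseteq> {x \<in> int_points. \<forall>i. \<bar>x $ i\<bar> \<le> (\<Sum>j\<in>{1..r}. \<Sum>i\<in>UNIV. \<bar>k j $ i\<bar>)}"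
  proof
    fix h assume h: "h \<in> half_open_parallelepiped_points r k"
    then obtain l where l: "\<forall>j\<in>{1..r}. 0 \<le> l j \<and> l j < 1" "h = (\<Sum>j=1..r. l j *\<^sub>R k j)"
      by (auto simp: half_open_parallelepiped_points_def)
    have "\<bar>h $ i\<bar> \<le> (\<Sum>j\<in>{1..r}. \<Sum>i\<in>UNIV. \<bar>k j $ i\<bar>)" for i
      unfolding l(2) by (rule bounded_combination) (use l(1) in force)
    then show "h \<in> {x \<in> int_points. \<forall>i. \<bar>x $ i\<bar> \<le> (\<Sum>j\<in>{1..r}. \<Sum>i\<in>UNIV. \<bar>k j $ i\<bar>)}"
      using h by (simp add: half_open_parallelepiped_points_def int_points_def)
  qed
qed (rule finite_int_points_bounded)

lemma independent_combination_eq: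
  fixes k :: "'j \<Rightarrow> 'v :: real_vector"
  assumes "finite J" "inj_on k J" "independent (k ` J)" "(\<Sum>j\<in>J. a j *\<^sub>R k j) = (\<Sum>j\<in>J. b j *\<^sub>R k j)" "j \<in> J"
  shows "a j = b j"
proof -
  define c where "c = (\<lambda>v. a (the_inv_into J k v) - b (the_inv_into J k v))"
  have ck: "c (k i) = a i - b i" if "i \<in> J" for i
    using that by (simp add: c_def the_inv_into_f_f[OF assms(2)])
  have "(\<Sum>v\<in>k ` J. c v *\<^sub>R v) = (\<Sum>i\<in>J. (a i - b i) *\<^sub>R k i)"
    unfolding sum.reindex[OF assms(2)] by (rule sum.cong) (simp_all add: ck)
  also have "\<dots> = 0" using assms(4) by (simp add: scaleR_diff_left sum_subtractf)
  finally have "(\<Sum>v\<in>k ` J. c v *\<^sub>R v) = 0" .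
  then have "c (k j) = 0"
    by (rule independentD[OF assms(3) _ subset_refl, rotated]) (use assms in auto)
  then show ?thesis using ck[OF assms(5)] by simp
qed

lemma powr_of_nat_mult: "of_nat p powr (of_nat n * z :: complex) = (of_nat p powr z) ^ n" if "0 < p"
  using that by (simp add: powr_def exp_of_nat_mult[symmetric] mult.assoc)

lemma powr_sum: "of_nat p powr (sum f J :: complex) = (\<Prod>j\<in>J. of_nat p powr f j)" if "0 < p" "finite J"
  using that(2) by (induction J) (use that(1) in \<open>auto simp: powr_add\<close>)

lemma norm_powr_gt_1:
  assumes "1 < p" "0 < Re z"
  shows "1 < norm (of_nat p powr z)"
proof -
  have "norm (of_nat p powr z) = real p powr Re z"
    using assms norm_powr_real_powr[of "real p" z] by simp
  moreover have "1 < real p powr Re z" using assms by (intro gr_one_powr) auto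
  ultimately show ?thesis by simp
qed

lemma has_sum_geometric_from_1:
  fixes z :: complex
  assumes "1 < norm z"
  shows "((\<lambda>n. (1 / z) ^ n) has_sum (1 / (z - 1))) {1..}" "(\<lambda>n. norm ((1 / z) ^ n)) summable_on {1..}"
proof -
  have n: "norm (1 / z) < 1" using assms by (simp add: norm_divide divide_less_eq)
  have "((\<lambda>n. 1 / z * (1 / z) ^ n) has_sum (1 / z * (1 / (1 - 1 / z)))) UNIV"
    by (intro has_sum_cmult_right has_sum_geometric n)
  also have "1 / z * (1 / (1 - 1 / z)) = 1 / (z - 1)"
    using assms by (auto simp: divide_simps)
  also have "(\<lambda>n. 1 / z * (1 / z) ^ n) = (\<lambda>n. (1 / z) ^ n) \<circ> Suc" by (auto simp: fun_eq_iff)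
  finally have "((\<lambda>n. (1 / z) ^ n) has_sum (1 / (z - 1))) (Suc ` UNIV)"
    by (subst has_sum_reindex) (simp, assumption)
  moreover have "Suc ` UNIV = {1..}" using atLeast_Suc_greaterThan by (auto simp: image_iff Suc_le_eq gr0_conv_Suc)
  ultimately show S: "((\<lambda>n. (1 / z) ^ n) has_sum (1 / (z - 1))) {1..}" by simp
  show "(\<lambda>n. norm ((1 / z) ^ n)) summable_on {1..}"
    using has_sum_imp_summable[OF S] by (rule summable_on_iff_abs_summable_on_complex[THEN iffD1])
qed

lemma simplicial_bij:
  fixes k :: "nat \<Rightarrow> real ^ 'n :: finite"
  assumes ki: "\<And>j. j \<in> {1..r} \<Longrightarrow> k j \<in> int_points" and inj: "inj_on k {1..r}" and ind: "independent (k ` {1..r})"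
  shows "bij_betw (\<lambda>(h, n). (\<Sum>j=1..r. real (n j) *\<^sub>R k j) - h)
    (half_open_parallelepiped_points r k \<times> Pi\<^sub>E {1..r} (\<lambda>_. {1..})) (int_points \<inter> pos_cone {1..r} k)"
  unfolding bij_betw_def
proof
  let ?H = "half_open_parallelepiped_points r k" and ?N = "Pi\<^sub>E {1..r} (\<lambda>_. {1..}) :: (nat \<Rightarrow> nat) set"
  let ?\<phi> = "\<lambda>(h, n). (\<Sum>j=1..r. real (n j) *\<^sub>R k j) - h"
  show "inj_on ?\<phi> (?H \<times> ?N)"
  proof (rule inj_onI, clarify)
    fix h n h' n' assume H: "h \<in> ?H" "h' \<in> ?H" and N: "n \<in> ?N" "n' \<in> ?N"
      and eq: "(\<Sum>j=1..r. real (n j) *\<^sub>R k j) - h = (\<Sum>j=1..r. real (n' j) *\<^sub>R k j) - h'"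
    obtain l where l: "\<forall>j\<in>{1..r}. 0 \<le> l j \<and> l j < 1" "h = (\<Sum>j=1..r. l j *\<^sub>R k j)"
      using H(1) by (auto simp: half_open_parallelepiped_points_def)
    obtain l' where l': "\<forall>j\<in>{1..r}. 0 \<le> l' j \<and> l' j < 1" "h' = (\<Sum>j=1..r. l' j *\<^sub>R k j)"
      using H(2) by (auto simp: half_open_parallelepiped_points_def)
    have eq': "(\<Sum>j=1..r. (real (n j) - l j) *\<^sub>R k j) = (\<Sum>j=1..r. (real (n' j) - l' j) *\<^sub>R k j)"
      using eq unfolding l(2) l'(2) by (simp add: scaleR_diff_left sum_subtractf)
    have nj: "n j = n' j" if "j \<in> {1..r}" for j
    proof -
      have "real (n j) - l j = real (n' j) - l' j"
        using independent_combination_eq[OF _ inj ind eq' that] by simp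
      moreover have "0 \<le> l j" "l j < 1" "0 \<le> l' j" "l' j < 1" using l(1) l'(1) that by blast+
      ultimately show ?thesis by linarith
    qed
    then have "n = n'" using N by (intro PiE_ext) auto
    then show "h = h' \<and> n = n'" using eq by simp
  qed
  show "?\<phi> ` (?H \<times> ?N) = int_points \<inter> pos_cone {1..r} k"
  proof (intro equalityI subsetI)
    fix x assume "x \<in> ?\<phi> ` (?H \<times> ?N)"
    then obtain h n where H: "h \<in> ?H" and N: "n \<in> ?N" and x: "x = (\<Sum>j=1..r. real (n j) *\<^sub>R k j) - h" by auto
    obtain l where l: "\<forall>j\<in>{1..r}. 0 \<le> l j \<and> l j < 1" "h = (\<Sum>j=1..r. l j *\<^sub>R k j)"
      using H by (auto simp: half_open_parallelepiped_points_def)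
    have "h \<in> int_points" using H by (simp add: half_open_parallelepiped_points_def int_points_def)
    then have "x \<in> int_points" unfolding x by (intro int_points_diff int_points_sum int_points_of_nat ki) auto
    moreover have "x = (\<Sum>j=1..r. (real (n j) - l j) *\<^sub>R k j)"
      unfolding x l(2) by (simp add: scaleR_diff_left sum_subtractf)
    moreover have "0 < real (n j) - l j" if "j \<in> {1..r}" for j
    proof -
      have "1 \<le> n j" using N that by (auto simp: PiE_def Pi_def)
      moreover have "l j < 1" using l(1) that by blast
      ultimately show ?thesis by linarith
    qed
    ultimately show "x \<in> int_points \<inter> pos_cone {1..r} k"
      unfolding pos_cone_def by (intro IntI CollectI exI[of _ "\<lambda>j. real (n j) - l j"] conjI) auto
  next
    fix x assume x: "x \<in> int_points \<inter> pos_cone {1..r} k"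
    then obtain c where c: "x = (\<Sum>j=1..r. c j *\<^sub>R k j)" "\<forall>j\<in>{1..r}. 0 < c j" by (auto simp: pos_cone_def)
    \<comment> \<open>Coefficients are rounded up: for \<open>c j > 0\<close> this gives
      \<open>n j \<ge> 1\<close> and a defect in \<open>[0, 1)\<close>. The lattice point is
      therefore a sum minus \<open>h\<close>, and \<open>h\<close> enters the numerator with a
      positive exponent.\<close>
    define n where "n = restrict (\<lambda>j. nat \<lceil>c j\<rceil>) {1..r}"
    have nc: "real (n j) = real_of_int \<lceil>c j\<rceil>" if "j \<in> {1..r}" for j
      using c(2) that by (simp add: n_def less_imp_le)
    have N: "n \<in> ?N" using c(2) by (auto simp: n_def Suc_le_eq)
    define h where "h = (\<Sum>j=1..r. real (n j) *\<^sub>R k j) - x"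
    have h: "h = (\<Sum>j=1..r. (real (n j) - c j) *\<^sub>R k j)"
      unfolding h_def c(1) by (simp add: scaleR_diff_left sum_subtractf)
    have "h \<in> int_points" unfolding h_def using x by (intro int_points_diff int_points_sum int_points_of_nat ki) auto
    moreover have "\<forall>j\<in>{1..r}. 0 \<le> real (n j) - c j \<and> real (n j) - c j < 1"
    proof
      fix j assume "j \<in> {1..r}"
      then show "0 \<le> real (n j) - c j \<and> real (n j) - c j < 1"
        using nc[of j] ceiling_correct[of "c j"] by linarith
    qed
    ultimately have "h \<in> ?H"
      unfolding half_open_parallelepiped_points_def int_points_def mem_Collect_eq
      by (intro conjI exI[of _ "\<lambda>j. real (n j) - c j"] h)
    moreover have "x = ?\<phi> (h, n)" by (simp add: h_def)
    ultimately show "x \<in> ?\<phi> ` (?H \<times> ?N)" using N by blast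
  qed
qed

text \<open>Stated for a linear \<open>E\<close>. The actual exponent is only piecewise linear on
  the orthant; it is replaced by the linear form valid on one closed cone before this lemma is
  applied.\<close>

lemma simplicial_sum:
  fixes k :: "nat \<Rightarrow> real ^ 'n :: finite" and E :: "real ^ 'n \<Rightarrow> complex"
  assumes p: "1 < p" and E: "linear E" and pos: "\<And>j. j \<in> {1..r} \<Longrightarrow> 0 < Re (E (k j))"
    and ki: "\<And>j. j \<in> {1..r} \<Longrightarrow> k j \<in> int_points" and inj: "inj_on k {1..r}" and ind: "independent (k ` {1..r})"
    and summ: "(\<lambda>x. of_nat p powr - E x) summable_on (int_points \<inter> pos_cone {1..r} k)"
  shows "(\<Sum>\<^sub>\<infinity>x\<in>int_points \<inter> pos_cone {1..r} k. of_nat p powr - E x) =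
     (\<Sum>h\<in>half_open_parallelepiped_points r k. of_nat p powr E h) / (\<Prod>j=1..r. of_nat p powr E (k j) - 1)"
proof -
  let ?H = "half_open_parallelepiped_points r k" and ?N = "Pi\<^sub>E {1..r} (\<lambda>_. {1..}) :: (nat \<Rightarrow> nat) set"
  let ?\<phi> = "\<lambda>(h, n). (\<Sum>j=1..r. real (n j) *\<^sub>R k j) - h"
  note bij = simplicial_bij[OF ki inj ind]
  let ?z = "\<lambda>j. of_nat p powr E (k j)"
  have z: "1 < norm (?z j)" if "j \<in> {1..r}" for j by (intro norm_powr_gt_1 p pos that)
  have powr_eq: "of_nat p powr - E (?\<phi> (h, n)) = of_nat p powr E h * (\<Prod>j=1..r. (1 / ?z j) ^ n j)" for h n
  proof -
    have "- E (?\<phi> (h, n)) = E h + (\<Sum>j=1..r. of_nat (n j) * (- E (k j)))"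
      unfolding split_conv linear_diff[OF E] linear_sum[OF E] linear_scale[OF E]
      by (simp add: scaleR_conv_of_real sum_negf)
    also have "of_nat p powr \<dots> = of_nat p powr E h * (\<Prod>j=1..r. (1 / ?z j) ^ n j)"
      unfolding powr_add using p by (subst powr_sum) (simp_all only: powr_of_nat_mult powr_minus_divide finite_atLeastAtMost)
    finally show ?thesis .
  qed
  have "(\<lambda>x. of_nat p powr - E (?\<phi> x)) summable_on ?H \<times> ?N"
    using summable_on_reindex_bij_betw[OF bij, of "\<lambda>x. of_nat p powr - E x"] summ by blast
  then have summ': "(\<lambda>(h, n). of_nat p powr - E (?\<phi> (h, n))) summable_on ?H \<times> ?N"
    by (simp add: case_prod_unfold)
  have "(\<Sum>\<^sub>\<infinity>x\<in>int_points \<inter> pos_cone {1..r} k. of_nat p powr - E x) = (\<Sum>\<^sub>\<infinity>x\<in>?H \<times> ?N. of_nat p powr - E (?\<phi> x))"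
    using infsum_reindex_bij_betw[OF bij, of "\<lambda>x. of_nat p powr - E x"] by simp
  also have "\<dots> = (\<Sum>\<^sub>\<infinity>(h, n)\<in>?H \<times> ?N. of_nat p powr - E (?\<phi> (h, n)))" by (simp add: case_prod_unfold)
  also have "\<dots> = (\<Sum>\<^sub>\<infinity>h\<in>?H. \<Sum>\<^sub>\<infinity>n\<in>?N. of_nat p powr - E (?\<phi> (h, n)))"
    by (rule infsum_Sigma'_banach[OF summ', symmetric])
  also have "\<dots> = (\<Sum>h\<in>?H. \<Sum>\<^sub>\<infinity>n\<in>?N. of_nat p powr E h * (\<Prod>j=1..r. (1 / ?z j) ^ n j))"
    unfolding powr_eq by (rule infsum_finite[OF finite_half_open_parallelepiped])
  also have "\<dots> = (\<Sum>h\<in>?H. of_nat p powr E h * (\<Prod>j=1..r. 1 / (?z j - 1)))"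
  proof (rule sum.cong[OF refl])
    fix h
    have "(\<Sum>\<^sub>\<infinity>n\<in>?N. \<Prod>j=1..r. (1 / ?z j) ^ n j) = (\<Prod>j=1..r. \<Sum>\<^sub>\<infinity>m\<in>{1..}. (1 / ?z j) ^ m)"
      by (rule infsum_prod_PiE_abs) (use has_sum_geometric_from_1(2)[OF z] in auto)
    also have "\<dots> = (\<Prod>j=1..r. 1 / (?z j - 1))"
      by (rule prod.cong[OF refl]) (rule infsumI[OF has_sum_geometric_from_1(1)[OF z]])
    finally show "(\<Sum>\<^sub>\<infinity>n\<in>?N. of_nat p powr E h * (\<Prod>j=1..r. (1 / ?z j) ^ n j)) = of_nat p powr E h * (\<Prod>j=1..r. 1 / (?z j - 1))"
      unfolding infsum_cmult_right' by simp
  qed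
  also have "\<dots> = (\<Sum>h\<in>?H. of_nat p powr E h) / (\<Prod>j=1..r. ?z j - 1)"
    by (simp add: prod_dividef sum_divide_distrib)
  finally show ?thesis .
qed

section \<open>Closures of the cones and the linear exponent on them\<close>

definition closed_class :: "('a::zero,'n::finite) mpoly \<Rightarrow> ('a,'n) mpoly \<Rightarrow> real^'n \<Rightarrow> (real^'n) set" where
  "closed_class f g k0 = {k \<in> orthant. min_exponents f k0 \<subseteq> min_exponents f k \<and> min_exponents g k0 \<subseteq> min_exponents g k \<and> zero_coords k0 \<subseteq> zero_coords k}"

text \<open>A common minimizer makes the minimum of the sum the sum of the minima, so minimizing the
  sum forces equality in both inequalities.\<close>

lemma min_exponents_add:
  assumes "\<omega> \<in> min_exponents f k" "\<omega> \<in> min_exponents f k'"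
  shows "min_exponents f (k + k') = min_exponents f k \<inter> min_exponents f k'"
proof (intro equalityI subsetI)
  fix \<eta> assume "\<eta> \<in> min_exponents f (k + k')"
  then have *: "\<eta> \<in> pkeys f" "k \<bullet> exponent_vec \<eta> + k' \<bullet> exponent_vec \<eta> \<le> k \<bullet> exponent_vec \<omega> + k' \<bullet> exponent_vec \<omega>"
    using assms by (auto simp: min_exponents_def inner_add_left)
  have "k \<bullet> exponent_vec \<omega> \<le> k \<bullet> exponent_vec \<eta>" "k' \<bullet> exponent_vec \<omega> \<le> k' \<bullet> exponent_vec \<eta>"
    using assms *(1) by (auto simp: min_exponents_def)
  with * have "k \<bullet> exponent_vec \<omega> = k \<bullet> exponent_vec \<eta>" "k' \<bullet> exponent_vec \<omega> = k' \<bullet> exponent_vec \<eta>" by linarith+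
  then show "\<eta> \<in> min_exponents f k \<inter> min_exponents f k'" using assms * by (auto simp: min_exponents_def)
next
  fix \<eta> assume "\<eta> \<in> min_exponents f k \<inter> min_exponents f k'"
  then show "\<eta> \<in> min_exponents f (k + k')" by (auto simp: min_exponents_def inner_add_left intro: add_mono)
qed

lemma min_exponents_scaleR: "0 < c \<Longrightarrow> min_exponents f (c *\<^sub>R k) = min_exponents f k"
  by (simp add: min_exponents_def)

lemma min_exponents_0: "min_exponents f 0 = pkeys f"
  by (auto simp: min_exponents_def)

lemma zero_coords_add: "k \<in> orthant \<Longrightarrow> k' \<in> orthant \<Longrightarrow> zero_coords (k + k') = zero_coords k \<inter> zero_coords k'"
  by (auto simp: zero_coords_def orthant_def add_nonneg_eq_0_iff)

lemma zero_coords_scaleR: "0 < c \<Longrightarrow> zero_coords (c *\<^sub>R k) = zero_coords k"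
  by (simp add: zero_coords_def)

lemma min_exponents_subset: "min_exponents f k \<subseteq> pkeys f"
  by (auto simp: min_exponents_def)

lemma cone_class_subset_closed: "cone_class f g k0 \<subseteq> closed_class f g k0"
  by (auto simp: cone_class_def closed_class_def)

lemma closed_class_orthant: "closed_class f g k0 \<subseteq> orthant"
  by (auto simp: closed_class_def)

lemma closed_class_0: "0 \<in> closed_class f g k0"
  using min_exponents_subset by (auto simp: closed_class_def min_exponents_0 zero_coords_def)

lemma closed_class_add:
  assumes "f \<noteq> 0" "g \<noteq> 0" "k \<in> closed_class f g k0" "k' \<in> closed_class f g k0"
  shows "k + k' \<in> closed_class f g k0"
proof -
  obtain \<omega> \<eta> where "\<omega> \<in> min_exponents f k0" "\<eta> \<in> min_exponents g k0" using min_exponents_nonempty assms(1,2) by metis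
  then have "\<omega> \<in> min_exponents f k" "\<omega> \<in> min_exponents f k'" "\<eta> \<in> min_exponents g k" "\<eta> \<in> min_exponents g k'"
    using assms(3,4) by (auto simp: closed_class_def)
  then show ?thesis using assms(3,4) min_exponents_add[of \<omega> f k k'] min_exponents_add[of \<eta> g k k']
    by (auto simp: closed_class_def orthant_add zero_coords_add)
qed

lemma closed_class_scaleR: "k \<in> closed_class f g k0 \<Longrightarrow> 0 \<le> c \<Longrightarrow> c *\<^sub>R k \<in> closed_class f g k0"
  by (cases "c = 0") (simp add: closed_class_0, simp add: closed_class_def min_exponents_scaleR zero_coords_scaleR orthant_scaleR)

lemma closed_class_sum:
  assumes "f \<noteq> 0" "g \<noteq> 0" "\<And>j. j \<in> J \<Longrightarrow> h j \<in> closed_class f g k0"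
  shows "sum h J \<in> closed_class f g k0"
  using assms(3) by (induction J rule: infinite_finite_induct) (auto simp: closed_class_0 closed_class_add[OF assms(1,2)])

text \<open>This makes the lattice points of a cone a module over those of
  \<open>closed_class\<close>. Added to small multiples of \<open>k0\<close> it also shows, for
  \<open>k0\<close> in the orthant, that \<open>closed_class\<close> is the closure of the
  cone.\<close>

lemma cone_class_add_closed:
  assumes "f \<noteq> 0" "g \<noteq> 0" "k \<in> cone_class f g k0" "k' \<in> closed_class f g k0"
  shows "k + k' \<in> cone_class f g k0"
proof -
  obtain \<omega> \<eta> where "\<omega> \<in> min_exponents f k0" "\<eta> \<in> min_exponents g k0" using min_exponents_nonempty assms(1,2) by metis
  then have "\<omega> \<in> min_exponents f k" "\<omega> \<in> min_exponents f k'" "\<eta> \<in> min_exponents g k" "\<eta> \<in> min_exponents g k'"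
    using assms(3,4) by (auto simp: closed_class_def cone_class_def)
  then show ?thesis using assms(3,4) min_exponents_add[of \<omega> f k k'] min_exponents_add[of \<eta> g k k']
    by (auto simp: closed_class_def cone_class_def orthant_add zero_coords_add)
qed

text \<open>The sum of all generators plus \<open>N\<close> times one of them stays in the cone. A
  linear inequality that holds for every \<open>N\<close> must hold for that generator itself.
  Vanishing coordinates are inherited because the generators are nonnegative.\<close>

lemma generator_in_closed_class:
  fixes f g :: "('a :: zero, 'n :: finite) mpoly"
  assumes J: "finite J" and sub: "pos_cone J k \<subseteq> closed_class f g k0" and o: "\<And>j. j \<in> J \<Longrightarrow> k j \<in> orthant" and j: "j \<in> J"
  shows "k j \<in> closed_class f g k0"
proof -
  have mem: "(\<Sum>i\<in>J. k i) + real N *\<^sub>R k j \<in> closed_class f g k0" for N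
  proof -
    have "(\<Sum>i\<in>J. (if i = j then 1 + real N else 1) *\<^sub>R k i) = (\<Sum>i\<in>J. k i) + (\<Sum>i\<in>J. if i = j then real N *\<^sub>R k i else 0)"
      unfolding sum.distrib[symmetric] by (rule sum.cong) (auto simp: scaleR_left_distrib)
    also have "\<dots> = (\<Sum>i\<in>J. k i) + real N *\<^sub>R k j" using J j by simp
    finally have "(\<Sum>i\<in>J. k i) + real N *\<^sub>R k j = (\<Sum>i\<in>J. (if i = j then 1 + real N else 1) *\<^sub>R k i)" by simp
    then have "(\<Sum>i\<in>J. k i) + real N *\<^sub>R k j \<in> pos_cone J k"
      unfolding pos_cone_def by (intro CollectI exI[of _ "\<lambda>i. if i = j then 1 + real N else 1"]) auto
    then show ?thesis using sub by blast
  qed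
  have arch: "0 \<le> a" if "\<And>N. 0 \<le> b + real N * a" for a b :: real
  proof (rule ccontr)
    assume "\<not> 0 \<le> a"
    then obtain N where "b < real N * (- a)" using reals_Archimedean3[of "- a"] by auto
    then show False using that[of N] by simp
  qed
  have min: "min_exponents h k0 \<subseteq> min_exponents h (k j)" if h: "\<And>N. min_exponents h k0 \<subseteq> min_exponents h ((\<Sum>i\<in>J. k i) + real N *\<^sub>R k j)" for h :: "('a, 'n) mpoly"
  proof
    fix \<omega> assume w: "\<omega> \<in> min_exponents h k0"
    have "k j \<bullet> exponent_vec \<omega> \<le> k j \<bullet> exponent_vec \<omega>'" if w': "\<omega>' \<in> pkeys h" for \<omega>'
    proof -
      have "0 \<le> ((\<Sum>i\<in>J. k i) \<bullet> exponent_vec \<omega>' - (\<Sum>i\<in>J. k i) \<bullet> exponent_vec \<omega>) + real N * (k j \<bullet> exponent_vec \<omega>' - k j \<bullet> exponent_vec \<omega>)" for N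
      proof -
        have "\<omega> \<in> min_exponents h ((\<Sum>i\<in>J. k i) + real N *\<^sub>R k j)" using h w by blast
        with w' have "((\<Sum>i\<in>J. k i) + real N *\<^sub>R k j) \<bullet> exponent_vec \<omega> \<le> ((\<Sum>i\<in>J. k i) + real N *\<^sub>R k j) \<bullet> exponent_vec \<omega>'"
          unfolding min_exponents_def by blast
        then show ?thesis by (simp add: inner_add_left right_diff_distrib)
      qed
      from arch[OF this] show ?thesis by simp
    qed
    then show "\<omega> \<in> min_exponents h (k j)" using w by (auto simp: min_exponents_def)
  qed
  have z: "zero_coords k0 \<subseteq> zero_coords (k j)"
  proof
    fix i assume "i \<in> zero_coords k0"
    then have "vec_nth (\<Sum>i\<in>J. k i) i = 0" using mem[of 0] by (auto simp: closed_class_def zero_coords_def)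
    then have "(\<Sum>l\<in>J. k l $ i) = 0" by simp
    moreover have "\<forall>l\<in>J. 0 \<le> k l $ i" using o by (auto simp: orthant_def)
    ultimately show "i \<in> zero_coords (k j)" using J j by (simp add: sum_nonneg_eq_0_iff zero_coords_def)
  qed
  show ?thesis using mem o[OF j] min[of f] min[of g] z unfolding closed_class_def by blast
qed

text \<open>A linear extension of \<open>cone_exponent\<close> from the closed cone to the whole
  space. An exponent minimal for \<open>k0\<close> stays minimal on the whole closed cone, so any
  fixed choice computes \<open>newton_m\<close> there.\<close>

definition lin_exponent :: "('a::zero,'n::finite) mpoly \<Rightarrow> ('a,'n) mpoly \<Rightarrow> real^'n \<Rightarrow> complex \<Rightarrow> real^'n \<Rightarrow> complex" where
  "lin_exponent f g k0 s k = of_real (k \<bullet> exponent_vec (SOME \<omega>. \<omega> \<in> min_exponents f k0)) * s +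
     of_real (k \<bullet> exponent_vec (SOME \<omega>. \<omega> \<in> min_exponents g k0)) + of_real (sigma k)"

lemma linear_lin_exponent:
  fixes k0 :: "real ^ 'n :: finite"
  shows "linear (lin_exponent f g k0 s)"
proof (rule linearI)
  have "sigma (r *\<^sub>R b) = r * sigma b" for r and b :: "real ^ 'n" by (simp add: sigma_def sum_distrib_left)
  then show "lin_exponent f g k0 s (r *\<^sub>R b) = r *\<^sub>R lin_exponent f g k0 s b" for r b
    by (simp add: lin_exponent_def scaleR_conv_of_real[where 'a = complex] algebra_simps)
  have "sigma (b + c) = sigma b + sigma c" for b c :: "real ^ 'n" by (simp add: sigma_def sum.distrib)
  then show "lin_exponent f g k0 s (b + c) = lin_exponent f g k0 s b + lin_exponent f g k0 s c" for b c
    by (simp add: lin_exponent_def inner_add_left algebra_simps)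
qed

lemma cone_exponent_eq_lin:
  assumes "f \<noteq> 0" "g \<noteq> 0" "k \<in> closed_class f g k0"
  shows "cone_exponent f g s k = lin_exponent f g k0 s k"
proof -
  have "(SOME \<omega>. \<omega> \<in> min_exponents f k0) \<in> min_exponents f k0"
    by (rule min_exponents_nonempty[OF assms(1), of k0]) (rule someI)
  then have mf: "(SOME \<omega>. \<omega> \<in> min_exponents f k0) \<in> min_exponents f k" using assms(3) by (auto simp: closed_class_def)
  have "(SOME \<omega>. \<omega> \<in> min_exponents g k0) \<in> min_exponents g k0"
    by (rule min_exponents_nonempty[OF assms(2), of k0]) (rule someI)
  then have mg: "(SOME \<omega>. \<omega> \<in> min_exponents g k0) \<in> min_exponents g k" using assms(3) by (auto simp: closed_class_def)
  have ko: "k \<in> orthant" using assms(3) by (simp add: closed_class_def)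
  show ?thesis
    by (simp add: cone_exponent_def lin_exponent_def newton_m_eq[OF ko mf] newton_m_eq[OF ko mg])
qed

lemma sigma_pos: "k \<in> orthant \<Longrightarrow> k \<noteq> 0 \<Longrightarrow> 0 < sigma k"
proof -
  assume k: "k \<in> orthant" "k \<noteq> 0"
  then obtain i where "k $ i \<noteq> 0" by (auto simp: vec_eq_iff)
  then show "0 < sigma k" unfolding sigma_def
    using k by (intro sum_pos2[of UNIV i]) (auto simp: orthant_def less_le)
qed

lemma primitive_nonzero:
  assumes "primitive k"
  shows "k \<noteq> 0"
proof
  assume "k = 0"
  with assms obtain z :: "int ^ 'a" where z: "0 = (\<chi> i. real_of_int (z $ i))" "Gcd (range (\<lambda>i. z $ i)) = 1"
    by (auto simp: primitive_def)
  then have "z $ i = 0" for i by (simp add: vec_eq_iff)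
  then have "range (\<lambda>i. z $ i) \<subseteq> {0}" by auto
  then have "Gcd (range (\<lambda>i. z $ i)) = 0" by (simp only: Gcd_0_iff)
  with z(2) show False by simp
qed

lemma Re_cone_exponent_pos:
  assumes "f \<noteq> 0" "g \<noteq> 0" "k \<in> orthant" "k \<noteq> 0" "0 < Re s"
  shows "0 < Re (cone_exponent f g s k)"
  using newton_m_nonneg[OF assms(1,3)] newton_m_nonneg[OF assms(2,3)] sigma_pos[OF assms(3,4)] assms(5)
  unfolding cone_exponent_def by (simp add: add_nonneg_pos)

lemma infsum_finite_UN_disjoint:
  fixes F :: "'a \<Rightarrow> 'b :: banach"
  assumes "finite I" "F summable_on (\<Union>i\<in>I. A i)" "disjoint_family_on A I"
  shows "infsum F (\<Union>i\<in>I. A i) = (\<Sum>i\<in>I. infsum F (A i))"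
  using assms
proof (induction I)
  case (insert i I)
  have "F summable_on A i" "F summable_on (\<Union>i\<in>I. A i)"
    using insert.prems(1) by (auto intro: summable_on_subset_banach)
  moreover have "A i \<inter> (\<Union>i\<in>I. A i) = {}" using insert.prems(2) insert.hyps(2)
    by (auto simp: disjoint_family_on_def)
  moreover have "disjoint_family_on A I" using insert.prems(2) by (auto simp: disjoint_family_on_def)
  ultimately show ?case using insert.IH insert.hyps by (simp add: infsum_Un_disjoint)
qed simp

lemma natural_points_int: "natural_points = orthant \<inter> int_points"
  by (auto simp: natural_points_def int_points_def orthant_def Nats_altdef2)

lemma S_term_simplicial:
  fixes f g :: "('p :: prime_card padic_int, 'n :: finite) mpoly"
  assumes f: "f \<noteq> 0" and g: "g \<noteq> 0" and s: "0 < Re s" and d: "\<delta> \<in> cone_partition f g"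
    and summ: "S_summand f g s summable_on (natural_points \<inter> \<delta>)" and sp: "simplicial_partition \<delta> I r k"
  shows "S_term f g \<delta> s =
             (\<Sum>i\<in>I.
                (\<Sum>h\<in>half_open_parallelepiped_points (r i) (k i).
                   of_nat CARD('p) powr cone_exponent f g s h) /
                (\<Prod>j=1..r i. (of_nat CARD('p) powr cone_exponent f g s (k i j) - 1)))"
proof -
  obtain k0 where k0: "k0 \<in> orthant" "\<delta> = cone_class f g k0"
    using d unfolding cone_partition_eq[OF f g] by blast
  let ?K = "closed_class f g k0" and ?E = "lin_exponent f g k0 s"
  have dK: "\<delta> \<subseteq> ?K" unfolding k0 by (rule cone_class_subset_closed)
  have dO: "\<delta> \<subseteq> orthant" using dK closed_class_orthant by blast
  let ?A = "\<lambda>i. int_points \<inter> pos_cone {1..r i} (k i)"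
  have fin: "finite I" and U: "(\<Union>i\<in>I. pos_cone {1..r i} (k i)) = \<delta>"
    and disj: "disjoint_family_on (\<lambda>i. pos_cone {1..r i} (k i)) I"
    using sp by (auto simp: simplicial_partition_def)
  have UA: "natural_points \<inter> \<delta> = (\<Union>i\<in>I. ?A i)"
    using dO U by (auto simp: natural_points_int)
  have "S_term f g \<delta> s = (\<Sum>i\<in>I. infsum (S_summand f g s) (?A i))"
    unfolding S_term_def UA
  proof (rule infsum_finite_UN_disjoint[OF fin])
    show "S_summand f g s summable_on (\<Union>i\<in>I. ?A i)" using summ UA by simp
    show "disjoint_family_on ?A I" using disj by (auto simp: disjoint_family_on_def)
  qed
  also have "\<dots> = (\<Sum>i\<in>I. (\<Sum>h\<in>half_open_parallelepiped_points (r i) (k i).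
                   of_nat CARD('p) powr cone_exponent f g s h) /
                (\<Prod>j=1..r i. (of_nat CARD('p) powr cone_exponent f g s (k i j) - 1)))"
  proof (rule sum.cong[OF refl])
    fix i assume i: "i \<in> I"
    have prim: "primitive (k i j)" "k i j \<in> orthant" if "j \<in> {1..r i}" for j
      using sp i that unfolding simplicial_partition_def by blast+
    have inj: "inj_on (k i) {1..r i}" and ind: "independent (k i ` {1..r i})"
      using sp i unfolding simplicial_partition_def by blast+
    have pd: "pos_cone {1..r i} (k i) \<subseteq> \<delta>" using U i by blast
    then have pK: "pos_cone {1..r i} (k i) \<subseteq> ?K" using dK by blast
    have kK: "k i j \<in> ?K" if "j \<in> {1..r i}" for j
      using generator_in_closed_class[OF _ pK prim(2) that] by simp
    \<comment> \<open>Points of the parallelepiped may lie on the boundary of the cone; they remain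
      in its closure, where the linear exponent still agrees with
      \<open>cone_exponent\<close>.\<close>
    have hK: "h \<in> ?K" if h: "h \<in> half_open_parallelepiped_points (r i) (k i)" for h
    proof -
      obtain l where l: "\<forall>j\<in>{1..r i}. 0 \<le> l j \<and> l j < 1" "h = (\<Sum>j=1..r i. l j *\<^sub>R k i j)"
        using h unfolding half_open_parallelepiped_points_def by blast
      show ?thesis unfolding l(2)
        by (intro closed_class_sum f g closed_class_scaleR kK) (use l(1) in auto)
    qed
    have S: "S_summand f g s x = of_nat CARD('p) powr - ?E x" if "x \<in> ?A i" for x
    proof -
      have "x \<in> ?K" using that pK by blast
      then show ?thesis unfolding S_summand_def using cone_exponent_eq_lin[OF f g] by simp
    qed
    have "infsum (S_summand f g s) (?A i) = (\<Sum>\<^sub>\<infinity>x\<in>?A i. of_nat CARD('p) powr - ?E x)"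
      by (rule infsum_cong) (rule S)
    also have "\<dots> = (\<Sum>h\<in>half_open_parallelepiped_points (r i) (k i). of_nat CARD('p) powr ?E h) /
       (\<Prod>j=1..r i. of_nat CARD('p) powr ?E (k i j) - 1)"
    proof (rule simplicial_sum[OF _ linear_lin_exponent])
      show "1 < CARD('p)" using CARD_prime_gt[where ?'p = 'p] by simp
      show "0 < Re (?E (k i j))" if "j \<in> {1..r i}" for j
        using Re_cone_exponent_pos[OF f g prim(2)[OF that] primitive_nonzero[OF prim(1)[OF that]] s]
          cone_exponent_eq_lin[OF f g kK[OF that]] by simp
      show "k i j \<in> int_points" if "j \<in> {1..r i}" for j by (rule primitive_int_points[OF prim(1)[OF that]])
      have "S_summand f g s summable_on ?A i" using summ by (rule summable_on_subset_banach) (use UA i in blast)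
      also have "?this \<longleftrightarrow> (\<lambda>x. of_nat CARD('p) powr - ?E x) summable_on ?A i"
        by (rule summable_on_cong) (rule S)
      finally show "(\<lambda>x. of_nat CARD('p) powr - ?E x) summable_on ?A i" .
    qed (rule inj, rule ind)
    also have "\<dots> = (\<Sum>h\<in>half_open_parallelepiped_points (r i) (k i). of_nat CARD('p) powr cone_exponent f g s h) /
       (\<Prod>j=1..r i. of_nat CARD('p) powr cone_exponent f g s (k i j) - 1)"
      by (intro arg_cong2[of _ _ _ _ "(/)"] sum.cong prod.cong refl)
        (simp_all only: cone_exponent_eq_lin[OF f g hK] cone_exponent_eq_lin[OF f g kK])
    finally show "infsum (S_summand f g s) (?A i) = (\<Sum>h\<in>half_open_parallelepiped_points (r i) (k i). of_nat CARD('p) powr cone_exponent f g s h) /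
       (\<Prod>j=1..r i. of_nat CARD('p) powr cone_exponent f g s (k i j) - 1)" .
  qed
  finally show ?thesis .
qed

section \<open>Generating functions of lattice modules\<close>

inductive_set nspan :: "'v :: real_vector set \<Rightarrow> 'v set" for V where
  zero: "0 \<in> nspan V"
| add: "x \<in> nspan V \<Longrightarrow> v \<in> V \<Longrightarrow> x + v \<in> nspan V"

text \<open>The module generated by \<open>C\<close> over the additive monoid
  \<open>nspan V\<close>. Representations \<open>c + y\<close> are in general not unique.\<close>

definition translates :: "'v :: real_vector set \<Rightarrow> 'v set \<Rightarrow> 'v set" where
  "translates V C = {c + y | c y. c \<in> C \<and> y \<in> nspan V}"

definition stable :: "'v :: real_vector set \<Rightarrow> 'v set \<Rightarrow> bool" where
  "stable V B \<longleftrightarrow> (\<forall>x\<in>B. \<forall>v\<in>V. x + v \<in> B)"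

lemma stable_nspan:
  assumes "stable V B" "x \<in> B" "y \<in> nspan V"
  shows "x + y \<in> B"
  using assms(3)
proof (induction rule: nspan.induct)
  case (add y v)
  then have "(x + y) + v \<in> B" using assms(1) by (auto simp: stable_def)
  then show ?case by (simp add: add.assoc)
qed (simp add: assms(2))

lemma nspan_add: "x \<in> nspan V \<Longrightarrow> y \<in> nspan V \<Longrightarrow> x + y \<in> nspan V"
  by (rule stable_nspan[of V]) (auto simp: stable_def intro: nspan.add)

lemma nspan_mono: "V \<subseteq> W \<Longrightarrow> nspan V \<subseteq> nspan W"
proof
  fix x assume VW: "V \<subseteq> W" and "x \<in> nspan V"
  from this(2) show "x \<in> nspan W" by (induction rule: nspan.induct) (use VW in \<open>auto intro: nspan.intros\<close>)
qed

lemma nspan_of_nat: "v \<in> V \<Longrightarrow> real m *\<^sub>R v \<in> nspan V"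
proof (induction m)
  case (Suc m)
  then have "real m *\<^sub>R v + v \<in> nspan V" by (intro nspan.add)
  then show ?case by (simp add: scaleR_left_distrib add.commute)
qed (simp add: nspan.zero)

lemma nspan_sum:
  assumes "\<And>v. v \<in> J \<Longrightarrow> h v \<in> nspan V"
  shows "sum h J \<in> nspan V"
  using assms by (induction J rule: infinite_finite_induct) (auto intro: nspan.zero nspan_add)

lemma nspan_insertE:
  assumes "x \<in> nspan (insert v V)"
  obtains m y where "y \<in> nspan V" "x = y + real m *\<^sub>R v"
proof -
  have "\<exists>y m. y \<in> nspan V \<and> x = y + real m *\<^sub>R v"
    using assms
  proof (induction rule: nspan.induct)
    case zero
    then show ?case by (intro exI[of _ 0]) (simp add: nspan.zero)
  next
    case (add x w)
    then obtain y m where y: "y \<in> nspan V" "x = y + real m *\<^sub>R v" by blast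
    from add(2) show ?case
    proof
      assume "w = v"
      then have "x + w = y + real (Suc m) *\<^sub>R v" by (simp add: y scaleR_left_distrib algebra_simps)
      then show ?thesis using y(1) by blast
    next
      assume "w \<in> V"
      with y(1) have "y + w \<in> nspan V" by (rule nspan.add)
      moreover have "x + w = (y + w) + real m *\<^sub>R v" using y by (simp add: algebra_simps)
      ultimately show ?thesis by blast
    qed
  qed
  then show ?thesis using that by blast
qed

lemma translates_stable: "stable V (translates V C)"
  unfolding stable_def
proof (intro ballI)
  fix x v assume "x \<in> translates V C" "v \<in> V"
  then obtain c y where "c \<in> C" "y \<in> nspan V" "x = c + y" by (auto simp: translates_def)
  moreover from this have "y + v \<in> nspan V" using \<open>v \<in> V\<close> by (intro nspan.add)
  ultimately show "x + v \<in> translates V C"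
    unfolding translates_def by (intro CollectI exI[of _ c] exI[of _ "y + v"]) (simp add: add.assoc)
qed

lemma translates_base: "c \<in> C \<Longrightarrow> c \<in> translates V C"
  unfolding translates_def by (intro CollectI exI[of _ c] exI[of _ 0]) (simp add: nspan.zero)

lemma translates_subset: "stable V B \<Longrightarrow> C \<subseteq> B \<Longrightarrow> translates V C \<subseteq> B"
  unfolding translates_def using stable_nspan by blast

text \<open>Noetherianity of lattice modules (Dickson's lemma), by induction on the number of generators:
  the slices \<open>S m\<close> in direction of the last generator increase and become stationary.\<close>

lemma stable_finitely_generated:
  fixes V :: "'v :: real_vector set"
  assumes "finite V" "finite C" "B \<subseteq> translates V C" "stable V B"
  shows "\<exists>D. finite D \<and> B = translates V D"
  using assms
proof (induction V arbitrary: C B rule: finite_induct)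
  case empty
  have "nspan {} = {0 :: 'v}" by (auto elim: nspan.cases intro: nspan.zero)
  then have "translates {} D = D" for D :: "'v set" by (auto simp: translates_def)
  then show ?case using empty by (auto intro: finite_subset)
next
  case (insert v V)
  define S where "S = (\<lambda>m. {y \<in> translates V C. y + real m *\<^sub>R v \<in> B})"
  have BV: "x + w \<in> B" if "x \<in> B" "w \<in> insert v V" for x w using insert.prems(3) that by (auto simp: stable_def)
  have Sstable: "stable V (S m)" for m
    unfolding stable_def
  proof (intro ballI)
    fix x w assume x: "x \<in> S m" "w \<in> V"
    then have "x + w \<in> translates V C" using translates_stable[of V C] by (auto simp: S_def stable_def)
    moreover have "x + w + real m *\<^sub>R v \<in> B"
      using BV[of "x + real m *\<^sub>R v" w] x by (auto simp: S_def algebra_simps)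
    ultimately show "x + w \<in> S m" by (simp add: S_def)
  qed
  have SSuc: "S m \<subseteq> S (Suc m)" for m
  proof
    fix x assume x: "x \<in> S m"
    then have "x + real m *\<^sub>R v \<in> B" by (simp add: S_def)
    then have "x + real m *\<^sub>R v + v \<in> B" by (rule BV) simp
    then show "x \<in> S (Suc m)" using x by (simp add: S_def scaleR_left_distrib algebra_simps)
  qed
  then have Smono: "S m \<subseteq> S m'" if "m \<le> m'" for m m' using lift_Suc_mono_le that by metis
  have "\<exists>D. finite D \<and> S m = translates V D" for m
    by (rule insert.IH[OF insert.prems(1)]) (auto simp: Sstable, auto simp: S_def)
  then obtain D where D: "\<And>m. finite (D m)" "\<And>m. S m = translates V (D m)" by metis
  have "\<exists>D. finite D \<and> (\<Union>m. S m) = translates V D"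
  proof (rule insert.IH[OF insert.prems(1)])
    show "stable V (\<Union>m. S m)" using Sstable unfolding stable_def by blast
  qed (auto simp: S_def)
  then obtain E where E: "finite E" "(\<Union>m. S m) = translates V E" by blast
  \<comment> \<open>The union of the slices has finitely many generators; by monotonicity they all
    lie in one slice, which is then the union.\<close>
  have "\<exists>M. E \<subseteq> S M"
  proof -
    have "\<forall>e\<in>E. \<exists>m. e \<in> S m" using E(2) translates_base by blast
    then obtain m where m: "\<And>e. e \<in> E \<Longrightarrow> e \<in> S (m e)" by metis
    have "E \<subseteq> S (Max (insert 0 (m ` E)))"
    proof
      fix e assume e: "e \<in> E"
      have "m e \<le> Max (insert 0 (m ` E))" using e E(1) by (intro Max_ge) auto
      from Smono[OF this] m[OF e] show "e \<in> S (Max (insert 0 (m ` E)))" by blast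
    qed
    then show ?thesis by blast
  qed
  then obtain M where "E \<subseteq> S M" by blast
  then have SM: "S m \<subseteq> S M" for m using translates_subset[OF Sstable] E(2) by blast
  define G where "G = (\<Union>m\<le>M. (\<lambda>d. d + real m *\<^sub>R v) ` D m)"
  have "finite G" using D(1) by (auto simp: G_def)
  moreover have "B = translates (insert v V) G"
  proof
    have "G \<subseteq> B"
    proof
      fix x assume "x \<in> G"
      then obtain m d where "x = d + real m *\<^sub>R v" "d \<in> D m" by (auto simp: G_def)
      then have "d \<in> S m" using D(2) translates_base by blast
      then show "x \<in> B" using \<open>x = _\<close> by (simp add: S_def)
    qed
    then show "translates (insert v V) G \<subseteq> B" by (rule translates_subset[OF insert.prems(3)])
    show "B \<subseteq> translates (insert v V) G"
    proof
      fix x assume x: "x \<in> B"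
      then obtain c y where cy: "c \<in> C" "y \<in> nspan (insert v V)" "x = c + y"
        using insert.prems(2) by (auto simp: translates_def)
      obtain m z where mz: "z \<in> nspan V" "y = z + real m *\<^sub>R v" using nspan_insertE[OF cy(2)] by blast
      have "c + z \<in> translates V C" using cy mz by (auto simp: translates_def)
      then have cz: "c + z \<in> S m" using x by (simp add: S_def cy mz add.assoc)
      \<comment> \<open>Above height \<open>M\<close> nothing new appears: the point is taken from
        slice \<open>M\<close>, and the excess \<open>m - M\<close> is absorbed by copies of
        \<open>v\<close>.\<close>
      define l where "l = min m M"
      have "c + z \<in> S l" using cz SM[of m] by (auto simp: l_def min_def)
      then obtain d w where d: "d \<in> D l" "w \<in> nspan V" "c + z = d + w" using D(2) by (auto simp: translates_def)
      have "x = (d + real l *\<^sub>R v) + (w + real (m - l) *\<^sub>R v)"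
      proof -
        have "real m *\<^sub>R v = real l *\<^sub>R v + real (m - l) *\<^sub>R v"
          by (simp add: l_def of_nat_diff scaleR_left_distrib[symmetric])
        then have "x = (c + z) + (real l *\<^sub>R v + real (m - l) *\<^sub>R v)" by (simp add: cy mz add.assoc)
        then show ?thesis unfolding d(3) by (simp add: algebra_simps)
      qed
      moreover have "d + real l *\<^sub>R v \<in> G" using d(1) by (auto simp: G_def l_def)
      moreover have "w + real (m - l) *\<^sub>R v \<in> nspan (insert v V)"
        using nspan_mono[of V "insert v V"] d(2) by (intro nspan_add nspan_of_nat) auto
      ultimately show "x \<in> translates (insert v V) G" unfolding translates_def by blast
    qed
  qed
  ultimately show ?case by blast
qed

text \<open>Finite integral combinations of evaluations at points. The character
  \<open>\<psi>\<close> is kept as an argument, so that one combination, chosen before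
  \<open>s\<close>, works for all \<open>s\<close>; the inductive form makes analyticity in
  \<open>s\<close> an induction.\<close>

inductive_set char_combinations :: "(('v \<Rightarrow> complex) \<Rightarrow> complex) set" where
  zero: "(\<lambda>\<psi>. 0) \<in> char_combinations"
| add: "F \<in> char_combinations \<Longrightarrow> (\<lambda>\<psi>. F \<psi> + \<psi> c) \<in> char_combinations"
| diff: "F \<in> char_combinations \<Longrightarrow> G \<in> char_combinations \<Longrightarrow> (\<lambda>\<psi>. F \<psi> - G \<psi>) \<in> char_combinations"

lemma char_combinations_sum: "finite C \<Longrightarrow> (\<lambda>\<psi>. \<Sum>c\<in>C. \<psi> c) \<in> char_combinations"
proof (induction C rule: finite_induct)
  case (insert c C)
  from char_combinations.add[OF insert.IH, of c] show ?case using insert.hyps by (simp add: add.commute)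
qed (simp add: char_combinations.zero)

text \<open>Multiplying by \<open>1 - \<psi> v\<close> removes one generator: it replaces the sum over \<open>X\<close> by the sum over
  \<open>X - (X + v)\<close>, which is a difference of two modules over the remaining generators.\<close>

lemma generating_function_rational:
  fixes V C :: "'v :: real_vector set"
  assumes "finite V" "finite C"
  shows "\<exists>F\<in>char_combinations. \<forall>\<psi>. (\<forall>x y. \<psi> (x + y) = \<psi> x * \<psi> y) \<longrightarrow> \<psi> summable_on translates V C \<longrightarrow>
    infsum \<psi> (translates V C) * (\<Prod>v\<in>V. 1 - \<psi> v) = F \<psi>"
  using assms
proof (induction V arbitrary: C rule: finite_induct)
  case empty
  have "nspan {} = {0 :: 'v}" by (auto elim: nspan.cases intro: nspan.zero)
  then have "translates {} C = C" by (auto simp: translates_def)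
  then show ?case using char_combinations_sum[OF empty] empty by (auto simp: infsum_finite)
next
  case (insert v V)
  define X where "X = translates (insert v V) C"
  define X' where "X' = translates V C"
  define Xv where "Xv = (\<lambda>x. x + v) ` X"
  have st: "stable (insert v V) X" unfolding X_def by (rule translates_stable)
  then have XvX: "Xv \<subseteq> X" by (auto simp: Xv_def stable_def)
  have X'X: "X' \<subseteq> X" using nspan_mono[of V "insert v V"] by (auto simp: X_def X'_def translates_def)
  \<comment> \<open>The overlap of the two modules is again stable under the remaining generators,
    hence finitely generated, so that the induction hypothesis covers both terms of the
    difference.\<close>
  have stB: "stable V (X' \<inter> Xv)"
  proof -
    have "stable V X'" unfolding X'_def by (rule translates_stable)
    moreover have "stable V Xv"
      unfolding stable_def Xv_def
    proof (intro ballI)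
      fix x w assume "x \<in> (\<lambda>x. x + v) ` X" "w \<in> V"
      then obtain y where "x = y + v" "y \<in> X" by blast
      then show "x + w \<in> (\<lambda>x. x + v) ` X" using st \<open>w \<in> V\<close>
        by (intro rev_image_eqI[of "y + w"]) (auto simp: stable_def algebra_simps)
    qed
    ultimately show ?thesis by (auto simp: stable_def)
  qed
  then obtain D where D: "finite D" "X' \<inter> Xv = translates V D"
    using stable_finitely_generated[OF insert.hyps(1) insert.prems, of "X' \<inter> Xv"] by (auto simp: X'_def)
  \<comment> \<open>A point of \<open>X\<close> outside \<open>X + v\<close> cannot use
    \<open>v\<close> in any representation, so it already lies in \<open>X'\<close>.\<close>
  have diff: "X - Xv = X' - (X' \<inter> Xv)"
  proof -
    have "x \<in> X'" if x: "x \<in> X" "x \<notin> Xv" for x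
    proof -
      obtain c y where cy: "c \<in> C" "y \<in> nspan (insert v V)" "x = c + y" using x(1) by (auto simp: X_def translates_def)
      obtain m z where mz: "z \<in> nspan V" "y = z + real m *\<^sub>R v" using nspan_insertE[OF cy(2)] by blast
      show ?thesis
      proof (cases m)
        case 0
        then show ?thesis using cy mz by (auto simp: X'_def translates_def)
      next
        case (Suc n)
        have "c + (z + real n *\<^sub>R v) \<in> X"
          unfolding X_def translates_def
          using cy(1) nspan_add[OF subsetD[OF nspan_mono mz(1)] nspan_of_nat, of "insert v V" v n] by blast
        moreover have "x = (c + (z + real n *\<^sub>R v)) + v" unfolding cy(3) mz(2) Suc by (simp add: scaleR_left_distrib algebra_simps)
        ultimately have "x \<in> Xv" by (auto simp: Xv_def)
        with x show ?thesis by blast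
      qed
    qed
    then show ?thesis using X'X by blast
  qed
  obtain F where F: "F \<in> char_combinations" "\<forall>\<psi>. (\<forall>x y. \<psi> (x + y) = \<psi> x * \<psi> y) \<longrightarrow> \<psi> summable_on X' \<longrightarrow>
      infsum \<psi> X' * (\<Prod>v\<in>V. 1 - \<psi> v) = F \<psi>"
    using insert.IH[OF insert.prems] unfolding X'_def by (elim bexE)
  obtain G where G: "G \<in> char_combinations" "\<forall>\<psi>. (\<forall>x y. \<psi> (x + y) = \<psi> x * \<psi> y) \<longrightarrow> \<psi> summable_on (X' \<inter> Xv) \<longrightarrow>
      infsum \<psi> (X' \<inter> Xv) * (\<Prod>v\<in>V. 1 - \<psi> v) = G \<psi>"
    using insert.IH[OF D(1)] unfolding D(2) by (elim bexE)
  show ?case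
  proof (rule bexI[of _ "\<lambda>\<psi>. F \<psi> - G \<psi>"], intro allI impI)
    fix \<psi> :: "'v \<Rightarrow> complex"
    assume mult: "\<forall>x y. \<psi> (x + y) = \<psi> x * \<psi> y" and "\<psi> summable_on translates (insert v V) C"
    then have sX: "\<psi> summable_on X" by (simp add: X_def)
    have sub: "\<psi> summable_on Y" if "Y \<subseteq> X" for Y using sX that by (rule summable_on_subset_banach)
    have "infsum \<psi> Xv = infsum (\<lambda>x. \<psi> (x + v)) X"
      unfolding Xv_def by (subst infsum_reindex) (auto simp: inj_on_def o_def)
    also have "\<dots> = infsum \<psi> X * \<psi> v" unfolding mult[rule_format] by (rule infsum_cmult_left')
    finally have "infsum \<psi> X * (1 - \<psi> v) = infsum \<psi> X - infsum \<psi> Xv" by (simp add: algebra_simps)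
    also have "\<dots> = infsum \<psi> (X - Xv)"
      using infsum_Diff[OF sX sub[OF XvX] XvX] by simp
    also have "\<dots> = infsum \<psi> X' - infsum \<psi> (X' \<inter> Xv)"
      unfolding diff using X'X by (intro infsum_Diff sub) auto
    finally have *: "infsum \<psi> X * (1 - \<psi> v) = infsum \<psi> X' - infsum \<psi> (X' \<inter> Xv)" .
    have "infsum \<psi> X * (\<Prod>v\<in>insert v V. 1 - \<psi> v) = (infsum \<psi> X * (1 - \<psi> v)) * (\<Prod>v\<in>V. 1 - \<psi> v)"
      using insert.hyps by simp
    also have "\<dots> = F \<psi> - G \<psi>"
      unfolding * left_diff_distrib 
      using F(2)[rule_format, OF mult[rule_format] sub[OF X'X]] G(2)[rule_format, OF mult[rule_format] sub] X'X
      by (simp add: le_infI1)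
    finally show "infsum \<psi> (translates (insert v V) C) * (\<Prod>v\<in>insert v V. 1 - \<psi> v) = F \<psi> - G \<psi>"
      by (simp add: X_def)
  qed (rule char_combinations.diff[OF F(1) G(1)])
qed

section \<open>Rays of the partition\<close>

text \<open>Integer vectors whose signs against \<open>k\<close> decide the cone of
  \<open>k\<close>: differences from a minimal exponent record ties and strict inequalities, the
  axes record vanishing coordinates.\<close>

definition test_vectors :: "('a::zero,'n::finite) mpoly \<Rightarrow> ('a,'n) mpoly \<Rightarrow> real^'n \<Rightarrow> (real^'n) set" where
  "test_vectors f g k = (\<lambda>(\<omega>, \<omega>'). exponent_vec \<omega>' - exponent_vec \<omega>) ` (min_exponents f k \<times> pkeys f \<union> min_exponents g k \<times> pkeys g) \<union> range (\<lambda>i. axis i 1)"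

lemma finite_test_vectors: "finite (test_vectors f g k)"
  unfolding test_vectors_def by (simp add: finite_min_exponents)

lemma test_vectors_int: "test_vectors f g k \<subseteq> int_points"
  by (auto simp: test_vectors_def int_points_def exponent_vec_def axis_def)

lemma min_exponents_sgn:
  assumes h: "h \<noteq> 0" and s: "\<And>\<omega> \<omega>'. \<omega> \<in> min_exponents h k \<Longrightarrow> \<omega>' \<in> pkeys h \<Longrightarrow>
    sgn (k' \<bullet> (exponent_vec \<omega>' - exponent_vec \<omega>)) = sgn (k \<bullet> (exponent_vec \<omega>' - exponent_vec \<omega>))"
  shows "min_exponents h k' = min_exponents h k"
proof -
  have le: "k' \<bullet> exponent_vec \<omega> \<le> k' \<bullet> exponent_vec \<omega>' \<and> (k' \<bullet> exponent_vec \<omega> = k' \<bullet> exponent_vec \<omega>' \<longleftrightarrow> k \<bullet> exponent_vec \<omega> = k \<bullet> exponent_vec \<omega>')"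
    if w: "\<omega> \<in> min_exponents h k" and w': "\<omega>' \<in> pkeys h" for \<omega> \<omega>'
  proof -
    have "k \<bullet> exponent_vec \<omega> \<le> k \<bullet> exponent_vec \<omega>'" using w w' by (simp add: min_exponents_def)
    then show ?thesis using s[OF w w'] by (auto simp: inner_diff_right sgn_if split: if_splits)
  qed
  obtain \<omega>0 where w0: "\<omega>0 \<in> min_exponents h k" using min_exponents_nonempty[OF h] .
  show ?thesis
  proof (intro equalityI subsetI)
    fix \<eta> assume "\<eta> \<in> min_exponents h k"
    then show "\<eta> \<in> min_exponents h k'" using le by (simp add: min_exponents_def)
  next
    fix \<eta> assume e: "\<eta> \<in> min_exponents h k'"
    then have "\<eta> \<in> pkeys h" "k' \<bullet> exponent_vec \<eta> \<le> k' \<bullet> exponent_vec \<omega>0"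
      using w0 by (auto simp: min_exponents_def)
    with le[OF w0, of \<eta>] have "k \<bullet> exponent_vec \<omega>0 = k \<bullet> exponent_vec \<eta>" by auto
    then show "\<eta> \<in> min_exponents h k" using w0 \<open>\<eta> \<in> pkeys h\<close> by (auto simp: min_exponents_def)
  qed
qed

text \<open>Turns membership in a cone into a finite sign pattern, which is what perturbation and
  Diophantine approximation can preserve.\<close>

lemma cone_class_sgn:
  assumes fg: "f \<noteq> 0" "g \<noteq> 0" and k: "k \<in> orthant" and s: "\<And>d. d \<in> test_vectors f g k \<Longrightarrow> sgn (k' \<bullet> d) = sgn (k \<bullet> d)"
  shows "k' \<in> cone_class f g k"
proof -
  have "min_exponents f k' = min_exponents f k" by (rule min_exponents_sgn[OF fg(1)], rule s) (force simp: test_vectors_def)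
  moreover have "min_exponents g k' = min_exponents g k" by (rule min_exponents_sgn[OF fg(2)], rule s) (force simp: test_vectors_def)
  moreover have c: "sgn (k' $ i) = sgn (k $ i)" for i
    using s[of "axis i 1"] by (simp add: test_vectors_def inner_axis)
  have "k' $ i = 0 \<longleftrightarrow> k $ i = 0" for i using c[of i] by (metis sgn_zero_iff)
  then have "zero_coords k' = zero_coords k" by (simp add: zero_coords_def)
  moreover have "k' \<in> orthant"
    unfolding orthant_def
  proof (intro CollectI allI)
    fix i
    have "0 \<le> k $ i" using k by (simp add: orthant_def)
    then show "0 \<le> k' $ i" using c[of i] by (auto simp: sgn_if split: if_splits)
  qed
  ultimately show ?thesis by (simp add: cone_class_def)
qed

text \<open>A short step from \<open>k\<close> away from \<open>k'\<close> keeps the strict signs,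
  which are open conditions; the zeros survive because \<open>k'\<close> shares them.\<close>

lemma sgn_perturb:
  fixes k k' :: "'a :: real_inner"
  assumes T: "finite T" and s: "\<And>d. d \<in> T \<Longrightarrow> k \<bullet> d = 0 \<Longrightarrow> k' \<bullet> d = 0"
  shows "\<exists>\<epsilon>>0. \<forall>d\<in>T. sgn ((k - \<epsilon> *\<^sub>R (k' - k)) \<bullet> d) = sgn (k \<bullet> d)"
proof -
  have "\<forall>\<^sub>F \<epsilon> in at_right (0 :: real). \<forall>d\<in>T. sgn ((k - \<epsilon> *\<^sub>R (k' - k)) \<bullet> d) = sgn (k \<bullet> d)"
  proof (rule eventually_ball_finite[OF T], intro ballI)
    fix d assume d: "d \<in> T"
    have lim: "((\<lambda>\<epsilon>. (k - \<epsilon> *\<^sub>R (k' - k)) \<bullet> d) \<longlongrightarrow> (k - 0 *\<^sub>R (k' - k)) \<bullet> d) (at_right 0)"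
      by (intro tendsto_intros)
    consider "k \<bullet> d = 0" | "0 < k \<bullet> d" | "k \<bullet> d < 0" by linarith
    then show "\<forall>\<^sub>F \<epsilon> in at_right 0. sgn ((k - \<epsilon> *\<^sub>R (k' - k)) \<bullet> d) = sgn (k \<bullet> d)"
    proof cases
      case 1
      then show ?thesis using s[OF d] by (simp add: inner_diff_left)
    next
      case 2
      from order_tendstoD(1)[OF lim, of 0] 2 show ?thesis by (auto elim!: eventually_mono simp: sgn_if)
    next
      case 3
      from order_tendstoD(2)[OF lim, of 0] 3 show ?thesis by (auto elim!: eventually_mono simp: sgn_if)
    qed
  qed
  then have "\<forall>\<^sub>F \<epsilon> in at_right (0 :: real). \<epsilon> > 0 \<and> (\<forall>d\<in>T. sgn ((k - \<epsilon> *\<^sub>R (k' - k)) \<bullet> d) = sgn (k \<bullet> d))"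
    by (intro eventually_conj eventually_at_right_less)
  then show ?thesis using eventually_happens'[OF trivial_limit_at_right_real] by blast
qed

text \<open>An integer vector near a multiple of \<open>k\<close> has the same signs as \<open>k\<close> against integer test
  vectors: an integer of absolute value less than one vanishes.\<close>

lemma integer_vector_same_signs:
  fixes k :: "real ^ 'n :: finite"
  assumes T: "finite T" "T \<subseteq> int_points"
  shows "\<exists>z\<in>int_points. \<forall>d\<in>T. sgn (z \<bullet> d) = sgn (k \<bullet> d)"
proof -
  define D where "D = (\<lambda>d :: real ^ 'n. \<Sum>i\<in>UNIV. \<bar>d $ i\<bar>)"
  \<comment> \<open>\<open>D d\<close> is the sum norm of \<open>d\<close>, so an error of
    \<open>1 / N\<close> per coordinate changes the product with \<open>d\<close> by at most
    \<open>D d / N\<close>. This must be below one to recognize zeros, and below the size of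
    \<open>k \<bullet> d\<close> to keep signs.\<close>
  have "\<forall>\<^sub>F N in sequentially. \<forall>d\<in>T. D d / real N < 1 \<and> (k \<bullet> d \<noteq> 0 \<longrightarrow> D d / real N < \<bar>k \<bullet> d\<bar>)"
  proof (rule eventually_ball_finite[OF T(1)], intro ballI)
    fix d assume "d \<in> T"
    have "(\<lambda>N. D d / real N) \<longlonglongrightarrow> 0" by (rule lim_const_over_n)
    from order_tendstoD(2)[OF this, of 1] order_tendstoD(2)[OF this, of "\<bar>k \<bullet> d\<bar>"]
    show "\<forall>\<^sub>F N in sequentially. D d / real N < 1 \<and> (k \<bullet> d \<noteq> 0 \<longrightarrow> D d / real N < \<bar>k \<bullet> d\<bar>)"
      by (cases "k \<bullet> d = 0") (auto elim: eventually_elim2)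
  qed
  then have "\<forall>\<^sub>F N in sequentially. 0 < N \<and> (\<forall>d\<in>T. D d / real N < 1 \<and> (k \<bullet> d \<noteq> 0 \<longrightarrow> D d / real N < \<bar>k \<bullet> d\<bar>))"
    by (intro eventually_conj eventually_gt_at_top)
  then obtain N where N: "0 < N" "\<And>d. d \<in> T \<Longrightarrow> D d / real N < 1" "\<And>d. d \<in> T \<Longrightarrow> k \<bullet> d \<noteq> 0 \<Longrightarrow> D d / real N < \<bar>k \<bullet> d\<bar>"
    unfolding eventually_sequentially by blast
  obtain e :: "nat \<Rightarrow> 'n" where e: "bij_betw e {0..<CARD('n)} UNIV"
    using ex_bij_betw_nat_finite[of "UNIV :: 'n set"] by auto
  \<comment> \<open>Dirichlet's theorem keeps the error of the multiple \<open>q k\<close> itself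
    below \<open>1 / N\<close>. An arbitrary rational approximation of \<open>k\<close> would not
    do, since clearing its denominator magnifies the error.\<close>
  obtain q p where qp: "0 < q" "\<And>i. i < CARD('n) \<Longrightarrow> \<bar>of_int q * vec_nth k (e i) - of_int (p i)\<bar> < 1 / real N"
    using Dirichlet_approx_simult[OF N(1), of "CARD('n)" "\<lambda>i. vec_nth k (e i)"] by blast
  define z :: "real ^ 'n" where "z = (\<chi> i. of_int (p (the_inv_into {0..<CARD('n)} e i)))"
  have z: "\<bar>of_int q * k $ i - z $ i\<bar> \<le> 1 / real N" for i
  proof -
    have inj: "inj_on e {0..<CARD('n)}" and img: "i \<in> e ` {0..<CARD('n)}" using e by (auto simp: bij_betw_def)
    have "the_inv_into {0..<CARD('n)} e i < CARD('n)" "e (the_inv_into {0..<CARD('n)} e i) = i"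
      using the_inv_into_into[OF inj img order_refl] f_the_inv_into_f[OF inj img] by auto
    from qp(2)[OF this(1)] this(2) show ?thesis by (simp add: z_def less_imp_le)
  qed
  have zi: "z \<in> int_points" by (simp add: z_def int_points_def)
  have "sgn (z \<bullet> d) = sgn (k \<bullet> d)" if d: "d \<in> T" for d
  proof -
    have "\<bar>of_int q * (k \<bullet> d) - z \<bullet> d\<bar> = \<bar>\<Sum>i\<in>UNIV. (of_int q * k $ i - z $ i) * d $ i\<bar>"
      by (simp add: inner_vec_def sum_distrib_left sum_subtractf left_diff_distrib mult.assoc)
    also have "\<dots> \<le> (\<Sum>i\<in>UNIV. \<bar>(of_int q * k $ i - z $ i) * d $ i\<bar>)" by (rule sum_abs)
    also have "\<dots> \<le> (\<Sum>i\<in>UNIV. 1 / real N * \<bar>d $ i\<bar>)"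
      unfolding abs_mult by (intro sum_mono mult_right_mono z) auto
    also have "\<dots> = D d / real N" by (simp add: D_def sum_divide_distrib)
    finally have near: "\<bar>of_int q * (k \<bullet> d) - z \<bullet> d\<bar> \<le> D d / real N" .
    show ?thesis
    proof (cases "k \<bullet> d = 0")
      case True
      have "z \<bullet> d \<in> \<int>" using zi T(2) d unfolding inner_vec_def int_points_def by (auto intro!: Ints_sum Ints_mult)
      moreover have "\<bar>z \<bullet> d\<bar> < 1" using near N(2)[OF d] True by simp
      ultimately have "z \<bullet> d = 0" using Ints_nonzero_abs_less1 by blast
      then show ?thesis using True by simp
    next
      case False
      have "1 * \<bar>k \<bullet> d\<bar> \<le> of_int q * \<bar>k \<bullet> d\<bar>" using qp(1) by (intro mult_right_mono) auto
      with near N(3)[OF d False] have "\<bar>of_int q * (k \<bullet> d) - z \<bullet> d\<bar> < \<bar>of_int q * (k \<bullet> d)\<bar>"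
        using qp(1) by (simp add: abs_mult)
      then have "sgn (z \<bullet> d) = sgn (of_int q * (k \<bullet> d))" by (auto simp: sgn_if abs_if split: if_splits)
      then show ?thesis using qp(1) by (simp add: sgn_mult)
    qed
  qed
  then show ?thesis using zi by blast
qed

lemma primitive_multiple:
  fixes z :: "real ^ 'n :: finite"
  assumes "z \<in> int_points" "z \<noteq> 0"
  shows "\<exists>t>0. primitive (t *\<^sub>R z)"
proof -
  have "\<forall>i. \<exists>m. z $ i = real_of_int m" using assms(1) by (auto simp: int_points_def Ints_def)
  from choice[OF this] obtain m where m: "\<And>i. z $ i = real_of_int (m i)" by blast
  define c where "c = Gcd (range m)"
  have c: "c \<noteq> 0"
  proof
    assume "c = 0"
    then have "range m \<subseteq> {0}" by (simp add: c_def Gcd_0_iff)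
    then have "m i = 0" for i by blast
    then have "z = 0" using m by (simp add: vec_eq_iff)
    with assms(2) show False by simp
  qed
  have "0 \<le> c" unfolding c_def by simp
  with c have c0: "0 < c" by simp
  have dv: "c dvd m i" for i unfolding c_def by (rule Gcd_dvd) simp
  define y :: "int ^ 'n" where "y = (\<chi> i. m i div c)"
  have my: "m i = c * y $ i" for i using dv[of i] by (simp add: y_def)
  have "c = Gcd ((*) c ` range (\<lambda>i. y $ i))"
    unfolding c_def[symmetric] image_image my[symmetric] by (simp add: c_def)
  also have "\<dots> = c * Gcd (range (\<lambda>i. y $ i))" using \<open>0 \<le> c\<close> by (simp add: Gcd_mult)
  finally have "Gcd (range (\<lambda>i. y $ i)) = 1" using c by simp
  moreover have "(1 / real_of_int c) *\<^sub>R z = (\<chi> i. of_int (y $ i))"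
    using c by (simp add: vec_eq_iff m my)
  ultimately have "primitive ((1 / real_of_int c) *\<^sub>R z)" unfolding primitive_def by blast
  then show ?thesis using c0 by (intro exI[of _ "1 / real_of_int c"]) auto
qed

lemma pos_cone_single: "pos_cone {k} (\<lambda>v. v) = {t *\<^sub>R k | t. 0 < t}"
proof -
  have "t *\<^sub>R k \<in> pos_cone {k} (\<lambda>v. v)" if "0 < t" for t
    unfolding pos_cone_def using that by (intro CollectI exI[of _ "\<lambda>_. t"]) simp
  then show ?thesis by (auto simp: pos_cone_def)
qed

section \<open>A compact section of the closed cone and its extreme points\<close>

definition slice :: "('a::zero,'n::finite) mpoly \<Rightarrow> ('a,'n) mpoly \<Rightarrow> real^'n \<Rightarrow> (real^'n) set" where
  "slice f g k0 = {k \<in> closed_class f g k0. sigma k = 1}"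

lemma sigma_linear: "sigma (a + b) = sigma a + sigma b" "sigma (c *\<^sub>R a) = c * sigma a" "sigma (a - b) = sigma a - sigma b"
  by (simp_all add: sigma_def sum.distrib sum_distrib_left sum_subtractf)

lemma closed_closed_class: "closed (closed_class f g k0)"
proof -
  have eq: "closed_class f g k0 = {k. \<forall>i. 0 \<le> k $ i} \<inter> (\<Inter>\<omega>\<in>min_exponents f k0. \<Inter>\<omega>'\<in>pkeys f. {k. k \<bullet> exponent_vec \<omega> \<le> k \<bullet> exponent_vec \<omega>'}) \<inter>
    (\<Inter>\<omega>\<in>min_exponents g k0. \<Inter>\<omega>'\<in>pkeys g. {k. k \<bullet> exponent_vec \<omega> \<le> k \<bullet> exponent_vec \<omega>'}) \<inter> (\<Inter>i\<in>zero_coords k0. {k. k $ i = 0})"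
    using min_exponents_subset[of f k0] min_exponents_subset[of g k0]
    by (auto simp: closed_class_def orthant_def zero_coords_def min_exponents_def)
  show ?thesis unfolding eq
    by (intro closed_Int closed_INT ballI closed_Collect_le closed_Collect_eq closed_Collect_all continuous_intros)
qed

lemma compact_slice:
  fixes k0 :: "real ^ 'n :: finite"
  shows "compact (slice f g k0)"
proof -
  have "slice f g k0 = closed_class f g k0 \<inter> {k. sigma k = 1} \<inter> cbox 0 (\<chi> i. 1)"
  proof -
    have "k $ i \<le> 1" if k: "k \<in> closed_class f g k0" "sigma k = 1" for k i
    proof -
      have "k $ i \<le> sigma k" unfolding sigma_def
        using k closed_class_orthant[of f g k0] by (intro member_le_sum) (auto simp: orthant_def)
      with k show ?thesis by simp
    qed
    moreover have "0 \<le> k $ i" if "k \<in> closed_class f g k0" for k i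
      using that closed_class_orthant[of f g k0] by (auto simp: orthant_def)
    ultimately show ?thesis by (auto simp: slice_def mem_box_cart)
  qed
  moreover have "closed {k :: real ^ 'n. sigma k = 1}" unfolding sigma_def
    by (intro closed_Collect_eq continuous_intros)
  ultimately show ?thesis
    by (simp add: compact_Int_closed closed_Int closed_closed_class Int_commute closed_Int_compact compact_cbox)
qed

lemma convex_slice:
  assumes "f \<noteq> 0" "g \<noteq> 0"
  shows "convex (slice f g k0)"
  unfolding convex_def slice_def
  by (auto intro!: closed_class_add assms closed_class_scaleR simp: sigma_linear)

text \<open>Two points of one cone of the partition can both be moved past each other inside the cone, so
  the cone of an extreme point of the slice is a ray.\<close>

lemma extreme_point_class:
  fixes f g :: "('a :: zero, 'n :: finite) mpoly"
  assumes fg: "f \<noteq> 0" "g \<noteq> 0" and w: "w extreme_point_of slice f g k0"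
    and x: "x \<in> cone_class f g w" "sigma x = 1"
  shows "x = w"
proof (rule ccontr)
  assume ne: "x \<noteq> w"
  have wS: "w \<in> slice f g k0" using w by (simp add: extreme_point_of_def)
  then have wo: "w \<in> orthant" and w1: "sigma w = 1" by (auto simp: slice_def closed_class_def)
  have cc: "cone_class f g w \<subseteq> closed_class f g k0"
    using wS by (auto simp: slice_def closed_class_def cone_class_def)
  \<comment> \<open>A test vector orthogonal to \<open>w\<close> marks a tie between exponents or a
    vanishing coordinate, and both are shared by all points of the cone.\<close>
  have "x \<bullet> d = 0" if d: "d \<in> test_vectors f g w" "w \<bullet> d = 0" for d
  proof -
    have min: "x \<bullet> exponent_vec \<omega>' = x \<bullet> exponent_vec \<omega>"
      if "min_exponents h x = min_exponents h w" "\<omega> \<in> min_exponents h w" "\<omega>' \<in> pkeys h" "w \<bullet> exponent_vec \<omega>' = w \<bullet> exponent_vec \<omega>" for h :: "('a, 'n) mpoly" and \<omega> \<omega>'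
    proof -
      have "\<omega>' \<in> min_exponents h w" using that by (auto simp: min_exponents_def)
      then have "\<omega>' \<in> min_exponents h x" "\<omega> \<in> min_exponents h x" using that by auto
      then show ?thesis by (auto simp: min_exponents_def intro: antisym)
    qed
    have m: "min_exponents f x = min_exponents f w" "min_exponents g x = min_exponents g w" "zero_coords x = zero_coords w" using x(1) by (auto simp: cone_class_def)
    from d(1) consider \<omega> \<omega>' where "\<omega> \<in> min_exponents f w" "\<omega>' \<in> pkeys f" "d = exponent_vec \<omega>' - exponent_vec \<omega>"
      | \<omega> \<omega>' where "\<omega> \<in> min_exponents g w" "\<omega>' \<in> pkeys g" "d = exponent_vec \<omega>' - exponent_vec \<omega>"
      | i where "d = axis i 1"
      by (auto simp: test_vectors_def)
    then show ?thesis
    proof cases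
      case 1
      then show ?thesis using min[OF m(1) 1(1,2)] d(2) by (simp add: inner_diff_right)
    next
      case 2
      then show ?thesis using min[OF m(2) 2(1,2)] d(2) by (simp add: inner_diff_right)
    next
      case 3
      then have "i \<in> zero_coords w" using d(2) by (simp add: zero_coords_def inner_axis)
      then have "i \<in> zero_coords x" using m(3) by simp
      then show ?thesis using 3 by (simp add: zero_coords_def inner_axis)
    qed
  qed
  then obtain \<epsilon> where e: "\<epsilon> > 0" "\<And>d. d \<in> test_vectors f g w \<Longrightarrow> sgn ((w - \<epsilon> *\<^sub>R (x - w)) \<bullet> d) = sgn (w \<bullet> d)"
    using sgn_perturb[OF finite_test_vectors, of f g w w x] by blast
  \<comment> \<open>The point beyond \<open>w\<close> as seen from \<open>x\<close>. It stays in the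
    slice, so \<open>w\<close> would be interior to a segment, against extremality.\<close>
  define y where "y = w - \<epsilon> *\<^sub>R (x - w)"
  have "y \<in> cone_class f g w" unfolding y_def by (rule cone_class_sgn[OF fg wo e(2)])
  then have yS: "y \<in> slice f g k0" using cc w1 x(2) by (auto simp: slice_def y_def sigma_linear)
  have xS: "x \<in> slice f g k0" using cc x by (auto simp: slice_def)
  have "(1 + \<epsilon>) *\<^sub>R w = y + \<epsilon> *\<^sub>R x" by (simp add: y_def algebra_simps)
  then have "(1 / (1 + \<epsilon>)) *\<^sub>R ((1 + \<epsilon>) *\<^sub>R w) = (1 / (1 + \<epsilon>)) *\<^sub>R (y + \<epsilon> *\<^sub>R x)" by simp
  then have "w = (1 / (1 + \<epsilon>)) *\<^sub>R y + (\<epsilon> / (1 + \<epsilon>)) *\<^sub>R x" using e(1) by (simp add: scaleR_right_distrib)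
  moreover have "1 / (1 + \<epsilon>) = 1 - \<epsilon> / (1 + \<epsilon>)" "0 < \<epsilon> / (1 + \<epsilon>)" "\<epsilon> / (1 + \<epsilon>) < 1"
    using e(1) by (auto simp: field_simps)
  moreover have "y \<noteq> x"
  proof
    assume "y = x"
    then have "(1 + \<epsilon>) *\<^sub>R (w - x) = 0" by (simp add: y_def algebra_simps)
    then show False using ne e(1) by simp
  qed
  ultimately have "w \<in> open_segment y x" unfolding in_segment by metis
  then show False using w xS yS by (auto simp: extreme_point_of_def)
qed

section \<open>Meromorphic continuation\<close>

lemma cone_class_scaleR: "k \<in> cone_class f g k0 \<Longrightarrow> 0 < c \<Longrightarrow> c *\<^sub>R k \<in> cone_class f g k0"
  by (simp add: cone_class_def min_exponents_scaleR zero_coords_scaleR orthant_scaleR)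

text \<open>Every point of the cone of \<open>w\<close>, rescaled to \<open>\<sigma> = 1\<close>, is
  \<open>w\<close> itself, so this cone is the open ray through \<open>w\<close>. It also contains
  an integer vector with the sign pattern of \<open>w\<close>; hence the ray is rational and has a
  primitive generator.\<close>

lemma extreme_point_ray:
  fixes f g :: "('a :: zero, 'n :: finite) mpoly"
  assumes fg: "f \<noteq> 0" "g \<noteq> 0" and w: "w extreme_point_of slice f g k0"
  shows "\<exists>v t. primitive v \<and> v \<in> closed_class f g k0 \<and> pos_cone {v} (\<lambda>v. v) \<in> cone_partition f g \<and> 0 < t \<and> w = t *\<^sub>R v"
proof -
  have wS: "w \<in> slice f g k0" using w by (simp add: extreme_point_of_def)
  then have wo: "w \<in> orthant" and w1: "sigma w = 1" and wK: "w \<in> closed_class f g k0" by (auto simp: slice_def closed_class_def)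
  have w0: "w \<noteq> 0" using w1 by (auto simp: sigma_def)
  have on_ray: "x = sigma x *\<^sub>R w \<and> 0 < sigma x" if x: "x \<in> cone_class f g w" for x
  proof -
    have "zero_coords x = zero_coords w" "x \<in> orthant" using x by (auto simp: cone_class_def)
    then have "x \<noteq> 0" using w0 by (auto simp: zero_coords_def vec_eq_iff)
    then have pos: "0 < sigma x" using sigma_pos \<open>x \<in> orthant\<close> by blast
    have "(1 / sigma x) *\<^sub>R x \<in> cone_class f g w" using pos by (intro cone_class_scaleR x) simp
    moreover have "sigma ((1 / sigma x) *\<^sub>R x) = 1" using pos by (simp add: sigma_linear)
    ultimately have "(1 / sigma x) *\<^sub>R x = w" by (rule extreme_point_class[OF fg w])
    then have "x = sigma x *\<^sub>R w" using pos by auto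
    then show ?thesis using pos by blast
  qed
  obtain z where z: "z \<in> int_points" "\<forall>d\<in>test_vectors f g w. sgn (z \<bullet> d) = sgn (w \<bullet> d)"
    using integer_vector_same_signs[OF finite_test_vectors test_vectors_int] by blast
  then have zc: "z \<in> cone_class f g w" using cone_class_sgn[OF fg wo] by blast
  have zw: "z = sigma z *\<^sub>R w" "0 < sigma z" using on_ray[OF zc] by auto
  then have "z \<noteq> 0" by (auto simp: sigma_def)
  then obtain t where t: "0 < t" "primitive (t *\<^sub>R z)" using primitive_multiple[OF z(1)] by blast
  define c where "c = t * sigma z"
  have c: "0 < c" using t(1) zw(2) by (simp add: c_def)
  have v: "t *\<^sub>R z = c *\<^sub>R w" unfolding c_def using zw(1) by (metis scaleR_scaleR)
  have "pos_cone {c *\<^sub>R w} (\<lambda>v. v) = cone_class f g w"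
    unfolding pos_cone_single
  proof (intro equalityI subsetI)
    fix x assume "x \<in> {s *\<^sub>R c *\<^sub>R w | s. 0 < s}"
    then show "x \<in> cone_class f g w" using c by (auto intro!: cone_class_scaleR cone_class_refl wo)
  next
    fix x assume "x \<in> cone_class f g w"
    then have "x = (sigma x / c) *\<^sub>R c *\<^sub>R w \<and> 0 < sigma x / c" using on_ray[of x] c by simp
    then show "x \<in> {s *\<^sub>R c *\<^sub>R w | s. 0 < s}" by blast
  qed
  moreover have "cone_class f g w \<in> cone_partition f g" using wo by (simp add: cone_partition_eq[OF fg])
  moreover have "c *\<^sub>R w \<in> closed_class f g k0" using c by (intro closed_class_scaleR wK) simp
  moreover have "w = (1 / c) *\<^sub>R c *\<^sub>R w" using c by simp
  ultimately show ?thesis using t(2) c unfolding v by (intro exI[of _ "c *\<^sub>R w"] exI[of _ "1 / c"]) simp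
qed

text \<open>Distinct extreme points lie in distinct cones of the finite partition.\<close>

lemma finite_extreme_points:
  fixes f g :: "('a :: zero, 'n :: finite) mpoly"
  assumes fg: "f \<noteq> 0" "g \<noteq> 0"
  shows "finite {w. w extreme_point_of slice f g k0}"
proof (rule inj_on_finite[OF _ _ finite_cone_partition[OF fg]])
  let ?E = "{w. w extreme_point_of slice f g k0}"
  have E: "w \<in> orthant" "sigma w = 1" if "w \<in> ?E" for w
    using that by (auto simp: extreme_point_of_def slice_def closed_class_def)
  show "cone_class f g ` ?E \<subseteq> cone_partition f g" using E by (auto simp: cone_partition_eq[OF fg])
  show "inj_on (cone_class f g) ?E"
  proof (rule inj_onI)
    fix w w' assume w: "w \<in> ?E" "w' \<in> ?E" "cone_class f g w = cone_class f g w'"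
    then have "w' \<in> cone_class f g w" using cone_class_refl[OF E(1)[OF w(2)]] by simp
    then show "w = w'" using extreme_point_class[OF fg, of w k0 w'] w E(2) by auto
  qed
qed

text \<open>A variant of Gordan's lemma. By Minkowski's theorem every point of the closed cone is a
  nonnegative combination of the rays; the integral parts of the coefficients lie in
  \<open>nspan V\<close>, the fractional parts leave a bounded lattice point. An inclusion suffices,
  because \<open>stable_finitely_generated\<close> passes to stable subsets.\<close>

lemma closed_class_finitely_generated:
  fixes f g :: "('a :: zero, 'n :: finite) mpoly"
  assumes fg: "f \<noteq> 0" "g \<noteq> 0"
  shows "\<exists>V P. finite V \<and> finite P \<and>
     (\<forall>v\<in>V. primitive v \<and> v \<in> closed_class f g k0 \<and> pos_cone {v} (\<lambda>v. v) \<in> cone_partition f g) \<and>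
     int_points \<inter> closed_class f g k0 \<subseteq> translates V P"
proof -
  define E where "E = {w. w extreme_point_of slice f g k0}"
  have fin: "finite E" unfolding E_def by (rule finite_extreme_points[OF fg])
  have "\<forall>w\<in>E. \<exists>v. \<exists>t. primitive v \<and> v \<in> closed_class f g k0 \<and> pos_cone {v} (\<lambda>v. v) \<in> cone_partition f g \<and> 0 < t \<and> w = t *\<^sub>R v"
    using extreme_point_ray[OF fg] by (auto simp: E_def)
  from bchoice[OF this] obtain v where v: "\<forall>w\<in>E. \<exists>t. primitive (v w) \<and> v w \<in> closed_class f g k0 \<and> pos_cone {v w} (\<lambda>v. v) \<in> cone_partition f g \<and> 0 < t \<and> w = t *\<^sub>R v w"
    by blast
  from bchoice[OF this] obtain t where vt: "\<And>w. w \<in> E \<Longrightarrow> primitive (v w) \<and> v w \<in> closed_class f g k0 \<and> pos_cone {v w} (\<lambda>v. v) \<in> cone_partition f g \<and> 0 < t w \<and> w = t w *\<^sub>R v w"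
    by blast
  define B where "B = (\<Sum>w\<in>E. \<Sum>i\<in>UNIV. \<bar>v w $ i\<bar>)"
  define P :: "(real ^ 'n) set" where "P = {x \<in> int_points. \<forall>i. \<bar>x $ i\<bar> \<le> B}"
  have "int_points \<inter> closed_class f g k0 \<subseteq> translates (v ` E) P"
  proof
    fix x assume x: "x \<in> int_points \<inter> closed_class f g k0"
    have "\<exists>c. (\<forall>w\<in>E. 0 \<le> c w) \<and> x = (\<Sum>w\<in>E. c w *\<^sub>R v w)"
    proof (cases "x = 0")
      case True
      then show ?thesis by (intro exI[of _ "\<lambda>_. 0"]) simp
    next
      case False
      then have pos: "0 < sigma x" using x sigma_pos closed_class_orthant by blast
      have "(1 / sigma x) *\<^sub>R x \<in> slice f g k0"
        using pos x by (auto simp: slice_def sigma_linear intro!: closed_class_scaleR)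
      then have "(1 / sigma x) *\<^sub>R x \<in> convex hull E"
        using Krein_Milman_Minkowski[OF compact_slice convex_slice[OF fg], of k0] by (simp add: E_def)
      then obtain u where u: "\<forall>w\<in>E. 0 \<le> u w" "(\<Sum>w\<in>E. u w *\<^sub>R w) = (1 / sigma x) *\<^sub>R x"
        unfolding convex_hull_finite[OF fin] by auto
      have "x = sigma x *\<^sub>R (\<Sum>w\<in>E. u w *\<^sub>R w)" using u(2) pos by simp
      also have "\<dots> = (\<Sum>w\<in>E. (sigma x * u w * t w) *\<^sub>R v w)"
        unfolding scaleR_sum_right
      proof (rule sum.cong[OF refl])
        fix w assume "w \<in> E"
        then have "w = t w *\<^sub>R v w" using vt by blast
        then have "sigma x *\<^sub>R u w *\<^sub>R w = sigma x *\<^sub>R u w *\<^sub>R t w *\<^sub>R v w" by (rule arg_cong)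
        then show "sigma x *\<^sub>R u w *\<^sub>R w = (sigma x * u w * t w) *\<^sub>R v w" by (simp add: mult.assoc)
      qed
      finally have "x = (\<Sum>w\<in>E. (sigma x * u w * t w) *\<^sub>R v w)" .
      moreover have "\<forall>w\<in>E. 0 \<le> sigma x * u w * t w" 
        using pos u(1) vt by (auto intro!: mult_nonneg_nonneg intro: less_imp_le)
      ultimately show ?thesis by (intro exI[of _ "\<lambda>w. sigma x * u w * t w"]) blast
    qed
    then obtain c where c: "\<And>w. w \<in> E \<Longrightarrow> 0 \<le> c w" "x = (\<Sum>w\<in>E. c w *\<^sub>R v w)" by blast
    define n where "n = (\<lambda>w. nat \<lfloor>c w\<rfloor>)"
    have n: "real (n w) = of_int \<lfloor>c w\<rfloor>" if "w \<in> E" for w using c(1)[OF that] by (simp add: n_def)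
    define y where "y = (\<Sum>w\<in>E. real (n w) *\<^sub>R v w)"
    have "y \<in> nspan (v ` E)" unfolding y_def by (intro nspan_sum nspan_of_nat) auto
    moreover have "x - y \<in> P"
    proof -
      have "x - y = (\<Sum>w\<in>E. (c w - real (n w)) *\<^sub>R v w)"
        unfolding y_def c(2) by (simp add: scaleR_diff_left sum_subtractf)
      moreover have "\<bar>vec_nth (\<Sum>w\<in>E. (c w - real (n w)) *\<^sub>R v w) i\<bar> \<le> B" for i
        unfolding B_def
      proof (rule bounded_combination)
        fix w assume "w \<in> E"
        then show "0 \<le> c w - real (n w) \<and> c w - real (n w) \<le> 1" using n[of w] floor_correct[of "c w"] by linarith
      qed
      moreover have "x - y \<in> int_points"
      proof (rule int_points_diff)
        show "y \<in> int_points"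
          unfolding y_def by (intro int_points_sum int_points_of_nat primitive_int_points) (use vt in blast)
      qed (use x in blast)
      ultimately show ?thesis by (simp add: P_def)
    qed
    ultimately show "x \<in> translates (v ` E) P"
      unfolding translates_def by (intro CollectI exI[of _ "x - y"] exI[of _ y]) simp
  qed
  moreover have "finite P" unfolding P_def by (rule finite_int_points_bounded)
  ultimately show ?thesis using fin vt by (intro exI[of _ "v ` E"] exI[of _ P]) auto
qed

text \<open>The generators \<open>V\<close> and the combination \<open>F\<close> do not depend on
  \<open>s\<close>; only therefore can the identity, valid for \<open>Re s > 0\<close>, define a
  continuation. Linearity of \<open>lin_exponent\<close> makes the summand a character.\<close>

lemma S_term_rational:
  fixes f g :: "('p :: prime_card padic_int, 'n :: finite) mpoly"
  assumes fg: "f \<noteq> 0" "g \<noteq> 0" and summ: "\<And>s. 0 < Re s \<Longrightarrow> S_summand f g s summable_on (natural_points \<inter> cone_class f g k0)"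
  shows "\<exists>V. finite V \<and> (\<forall>v\<in>V. primitive v \<and> v \<in> orthant \<and> pos_cone {v} (\<lambda>v. v) \<in> cone_partition f g) \<and>
     (\<exists>F\<in>char_combinations. \<forall>s. 0 < Re s \<longrightarrow>
        S_term f g (cone_class f g k0) s * (\<Prod>v\<in>V. 1 - of_nat CARD('p) powr - cone_exponent f g s v) =
        F (\<lambda>x. of_nat CARD('p) powr - lin_exponent f g k0 s x))"
proof -
  obtain V P where VP: "finite V" "finite P"
     "\<And>v. v \<in> V \<Longrightarrow> primitive v \<and> v \<in> closed_class f g k0 \<and> pos_cone {v} (\<lambda>v. v) \<in> cone_partition f g"
     "int_points \<inter> closed_class f g k0 \<subseteq> translates V P"
    using closed_class_finitely_generated[OF fg, of k0] by blast
  define A where "A = natural_points \<inter> cone_class f g k0"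
  have AI: "A = int_points \<inter> cone_class f g k0"
    unfolding A_def natural_points_int by (auto simp: cone_class_def)
  have "A \<subseteq> translates V P" using VP(4) cone_class_subset_closed[of f g k0] unfolding AI by blast
  moreover have "stable V A"
    unfolding stable_def AI
  proof (intro ballI)
    fix x v assume x: "x \<in> int_points \<inter> cone_class f g k0" and v: "v \<in> V"
    have "v \<in> int_points" "v \<in> closed_class f g k0" using VP(3)[OF v] primitive_int_points by auto
    then show "x + v \<in> int_points \<inter> cone_class f g k0"
      using x cone_class_add_closed[OF fg, of x k0 v] int_points_add[of x v] by blast
  qed
  ultimately obtain D where D: "finite D" "A = translates V D"
    using stable_finitely_generated[OF VP(1,2)] by blast
  obtain F where F: "F \<in> char_combinations" "\<forall>\<psi>. (\<forall>x y. \<psi> (x + y) = \<psi> x * \<psi> y) \<longrightarrow> \<psi> summable_on A \<longrightarrow>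
    infsum \<psi> A * (\<Prod>v\<in>V. 1 - \<psi> v) = F \<psi>"
    using generating_function_rational[OF VP(1) D(1)] unfolding D(2) by (elim bexE)
  have "S_term f g (cone_class f g k0) s * (\<Prod>v\<in>V. 1 - of_nat CARD('p) powr - cone_exponent f g s v) =
        F (\<lambda>x. of_nat CARD('p) powr - lin_exponent f g k0 s x)" if s: "0 < Re s" for s
  proof -
    let ?\<psi> = "\<lambda>x. of_nat CARD('p) powr - lin_exponent f g k0 s x"
    have S: "S_summand f g s x = ?\<psi> x" if "x \<in> A" for x
    proof -
      have "x \<in> closed_class f g k0" using that cone_class_subset_closed[of f g k0] unfolding A_def by blast
      then show ?thesis unfolding S_summand_def using cone_exponent_eq_lin[OF fg] by simp
    qed
    have "S_summand f g s summable_on A" unfolding A_def by (rule summ[OF s])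
    also have "?this \<longleftrightarrow> ?\<psi> summable_on A" by (rule summable_on_cong) (rule S)
    finally have sA: "?\<psi> summable_on A" .
    have mult: "?\<psi> (x + y) = ?\<psi> x * ?\<psi> y" for x y
      by (simp add: linear_add[OF linear_lin_exponent] powr_add[symmetric])
    have "infsum ?\<psi> A = S_term f g (cone_class f g k0) s"
      unfolding S_term_def A_def[symmetric] by (rule infsum_cong) (rule S[symmetric])
    moreover have "(\<Prod>v\<in>V. 1 - ?\<psi> v) = (\<Prod>v\<in>V. 1 - of_nat CARD('p) powr - cone_exponent f g s v)"
    proof (rule prod.cong[OF refl])
      fix v assume "v \<in> V"
      then have "v \<in> closed_class f g k0" using VP(3) by blast
      then show "1 - ?\<psi> v = 1 - of_nat CARD('p) powr - cone_exponent f g s v"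
        by (simp only: cone_exponent_eq_lin[OF fg])
    qed
    ultimately show ?thesis using F(2)[rule_format, OF mult sA] by simp
  qed
  moreover have "v \<in> orthant" if "v \<in> V" for v using VP(3)[OF that] closed_class_orthant by blast
  ultimately show ?thesis using VP(1,3) F(1) by (intro exI[of _ V] conjI bexI[of _ F]) auto
qed

section \<open>Analyticity and the location of the poles\<close>

lemma analytic_powr:
  assumes "0 < p" "h analytic_on A"
  shows "(\<lambda>s. of_nat p powr h s) analytic_on A"
proof -
  have "(\<lambda>s. of_nat p powr h s) = (\<lambda>s. exp (h s * Ln (of_nat p)))" using assms(1) by (simp add: powr_def fun_eq_iff)
  then show ?thesis using assms(2) by (simp add: analytic_intros)
qed

lemma analytic_char_combination:
  assumes "F \<in> char_combinations" "\<And>x. (\<lambda>s. \<psi> s x) analytic_on A"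
  shows "(\<lambda>s. F (\<psi> s)) analytic_on A"
  using assms(1) by (induction rule: char_combinations.induct) (auto intro!: analytic_intros assms(2))

text \<open>Zeros of \<open>p^z - 1\<close> lie on a single vertical line, which is why only real
  parts of poles are determined.\<close>

lemma powr_eq_1_imp_Re:
  assumes "1 < p" "of_nat p powr z = 1"
  shows "Re z = 0"
proof -
  have "real p powr Re z = norm (of_nat p powr z)"
    using assms(1) norm_powr_real_powr[of "real p" z] by simp
  then have "real p powr Re z = 1" using assms(2) by simp
  then show ?thesis using assms(1) by (simp add: powr_eq_one_iff)
qed

lemma candidate_real_parts_rational:
  fixes f g :: "('p :: prime_card padic_int, 'n :: finite) mpoly"
  assumes fg: "f \<noteq> 0" "g \<noteq> 0"
  shows "candidate_real_parts f g \<subseteq> \<rat>"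
proof
  fix x assume "x \<in> candidate_real_parts f g"
  then consider "x = - 1" | k where "x = - (newton_m g k + sigma k) / newton_m f k" "primitive k" "pos_cone {k} (\<lambda>v. v) \<in> cone_partition f g"
    unfolding candidate_real_parts_def by blast
  then show "x \<in> \<rat>"
  proof cases
    case 2
    have "k \<in> pos_cone {k} (\<lambda>v. v)" unfolding pos_cone_single by (intro CollectI exI[of _ 1]) simp
    then have "k \<in> orthant" using 2(3) unfolding cone_partition_eq[OF fg] by (auto simp: cone_class_def)
    then have "k \<in> natural_points" using primitive_int_points[OF 2(2)] by (simp add: natural_points_int)
    then obtain m where "k = exponent_vec m" by (auto simp: natural_points_eq)
    show ?thesis
      unfolding 2(1) \<open>k = exponent_vec m\<close> newton_m_exponent_vec[OF fg(1)] newton_m_exponent_vec[OF fg(2)] sigma_exponent_vec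
      by (intro Rats_divide Rats_minus_iff[THEN iffD2] Rats_add Rats_of_nat)
  qed simp
qed

text \<open>The only denominator depending on \<open>s\<close> is \<open>p^(s+1) - 1\<close>; its
  zeros have real part \<open>-1\<close>, the origin of that candidate.\<close>

lemma L_term_analytic:
  "L_term f g \<delta> meromorphic_on UNIV"
  "Re z \<noteq> - 1 \<Longrightarrow> L_term f g \<delta> analytic_on {z}"
  for f g :: "('p :: prime_card padic_int, 'n :: finite) mpoly"
proof -
  have p: "1 < CARD('p)" using CARD_prime_gt[where ?'p = 'p] by simp
  have a: "(\<lambda>s. of_nat CARD('p) powr s) analytic_on A" "(\<lambda>s. of_nat CARD('p) powr (s + 1)) analytic_on A" for A
    using p by (intro analytic_powr analytic_intros; simp)+
  show "L_term f g \<delta> meromorphic_on UNIV"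
    unfolding L_term_def Let_def
    by (intro meromorphic_intros analytic_on_imp_meromorphic_on[OF a(1)] analytic_on_imp_meromorphic_on[OF a(2)])
  assume z: "Re z \<noteq> - 1"
  have nz: "of_nat CARD('p) powr (z + 1) - 1 \<noteq> (0 :: complex)"
  proof
    assume "of_nat CARD('p) powr (z + 1) - 1 = (0 :: complex)"
    then have "Re (z + 1) = 0" by (intro powr_eq_1_imp_Re[OF p]) simp
    then show False using z by simp
  qed
  have p1: "of_nat CARD('p) + (1 :: complex) \<noteq> 0"
    using of_nat_neq_0[of "CARD('p)", where 'a = complex] by (simp add: add.commute)
  show "L_term f g \<delta> analytic_on {z}"
    unfolding L_term_def Let_def by (intro analytic_intros a) (use nz p1 in auto)
qed

lemma S_term_continuation:
  fixes f g :: "('p :: prime_card padic_int, 'n :: finite) mpoly"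
  assumes fg: "f \<noteq> 0" "g \<noteq> 0" and d: "\<delta> \<in> cone_partition f g"
    and summ: "\<And>s. 0 < Re s \<Longrightarrow> S_summand f g s summable_on (natural_points \<inter> \<delta>)"
  shows "\<exists>R. R meromorphic_on UNIV \<and> (\<forall>s. 0 < Re s \<longrightarrow> R s = S_term f g \<delta> s) \<and>
     (\<forall>z. Re z \<notin> candidate_real_parts f g \<longrightarrow> R analytic_on {z})"
proof -
  have p: "1 < CARD('p)" using CARD_prime_gt[where ?'p = 'p] by simp
  obtain k0 where k0: "\<delta> = cone_class f g k0" using d unfolding cone_partition_eq[OF fg] by blast
  obtain V F where V: "finite V" "\<And>v. v \<in> V \<Longrightarrow> primitive v \<and> v \<in> orthant \<and> pos_cone {v} (\<lambda>v. v) \<in> cone_partition f g"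
    and F: "F \<in> char_combinations" "\<And>s. 0 < Re s \<Longrightarrow>
        S_term f g \<delta> s * (\<Prod>v\<in>V. 1 - of_nat CARD('p) powr - cone_exponent f g s v) =
        F (\<lambda>x. of_nat CARD('p) powr - lin_exponent f g k0 s x)"
    using S_term_rational[OF fg summ[unfolded k0]] unfolding k0 by blast
  let ?N = "\<lambda>s. F (\<lambda>x. of_nat CARD('p) powr - lin_exponent f g k0 s x)"
  let ?D = "\<lambda>s. \<Prod>v\<in>V. 1 - of_nat CARD('p) powr - cone_exponent f g s v"
  have aN: "?N analytic_on A" for A
    using p by (intro analytic_char_combination[OF F(1)] analytic_powr) (auto simp: lin_exponent_def intro!: analytic_intros)
  have aD: "?D analytic_on A" for A
    using p by (intro analytic_intros analytic_powr) (auto simp: cone_exponent_def intro!: analytic_intros)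
  have nz: "?D z \<noteq> 0" if z: "\<And>v. v \<in> V \<Longrightarrow> Re (cone_exponent f g z v) \<noteq> 0" for z
  proof
    assume "?D z = 0"
    then obtain v where v: "v \<in> V" "1 - of_nat CARD('p) powr - cone_exponent f g z v = 0" using V(1) by auto
    then have "Re (- cone_exponent f g z v) = 0" by (intro powr_eq_1_imp_Re[OF p]) simp
    then show False using z[OF v(1)] by simp
  qed
  show ?thesis
  proof (intro exI[of _ "\<lambda>s. ?N s / ?D s"] conjI allI impI)
    show "(\<lambda>s. ?N s / ?D s) meromorphic_on UNIV"
      by (intro meromorphic_on_divide analytic_on_imp_meromorphic_on aN aD)
  next
    fix s assume s: "0 < Re s"
    \<comment> \<open>In this half-plane all exponents have positive real part, so no factor
      vanishes and the quotient is the sum itself.\<close>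
    have "Re (cone_exponent f g s v) \<noteq> 0" if "v \<in> V" for v
      using Re_cone_exponent_pos[OF fg _ primitive_nonzero s] V(2)[OF that] by force
    then show "?N s / ?D s = S_term f g \<delta> s" unfolding F(2)[OF s, symmetric] using nz[of s] by simp
  next
    fix z assume z: "Re z \<notin> candidate_real_parts f g"
    have "Re (cone_exponent f g z v) \<noteq> 0" if v: "v \<in> V" for v
    proof
      assume "Re (cone_exponent f g z v) = 0"
      then have eq: "newton_m f v * Re z + newton_m g v + sigma v = 0" by (simp add: cone_exponent_def)
      have "0 < sigma v" "0 \<le> newton_m g v" using V(2)[OF v] sigma_pos primitive_nonzero newton_m_nonneg[OF fg(2)] by auto
      \<comment> \<open>If \<open>newton_m f v\<close> were zero, the exponent would have the
        positive real part \<open>newton_m g v + sigma v\<close> for every \<open>z\<close>. Such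
        rays produce no pole, which explains the restriction in
        \<open>candidate_real_parts\<close>.\<close>
      with eq have m: "newton_m f v \<noteq> 0" by auto
      then have "Re z = - (newton_m g v + sigma v) / newton_m f v" using eq by (simp add: field_simps)
      then have "Re z \<in> candidate_real_parts f g" unfolding candidate_real_parts_def using V(2)[OF v] m by blast
      with z show False by simp
    qed
    then have "?D z \<noteq> 0" by (rule nz)
    then show "(\<lambda>s. ?N s / ?D s) analytic_on {z}" by (intro analytic_on_divide aN aD) auto
  qed
qed

theorem theorem4p3:
  fixes f g :: "('p :: prime_card padic_int, 'n :: finite) mpoly"
    and \<mu> :: "('p padic_int ^ 'n) measure"
  assumes "CARD('n) \<ge> 2"
    and "f \<noteq> 0" and "g \<noteq> 0"
    and "Poly_Mapping.lookup f 0 = 0" and "Poly_Mapping.lookup g 0 = 0"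
    and "nondegenerate f" and "nondegenerate g"
    and "nondegenerate_pair f g"
    and "normalized_haar \<mu>"
  shows
    "finite (cone_partition f g) \<and>
     (\<forall>s. Re s > 0 \<longrightarrow>
        integrable \<mu> (zeta_integrand f g s) \<and>
        (\<forall>\<delta>\<in>cone_partition f g. S_summand f g s summable_on (natural_points \<inter> \<delta>)) \<and>
        zeta_fun \<mu> f g s = (\<Sum>\<delta>\<in>cone_partition f g. L_term f g \<delta> s * S_term f g \<delta> s) \<and>
        (\<forall>\<delta>\<in>cone_partition f g. \<forall>(I :: 'i set) r k. simplicial_partition \<delta> I r k \<longrightarrow>
           S_term f g \<delta> s =
             (\<Sum>i\<in>I.
                (\<Sum>h\<in>half_open_parallelepiped_points (r i) (k i).
                   of_nat CARD('p) powr cone_exponent f g s h) /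
                (\<Prod>j=1..r i. (of_nat CARD('p) powr cone_exponent f g s (k i j) - 1))))) \<and>
     candidate_real_parts f g \<subseteq> \<rat> \<and>
     (\<exists>F. F meromorphic_on UNIV \<and>
        (\<forall>s. Re s > 0 \<longrightarrow> F s = zeta_fun \<mu> f g s) \<and>
        (\<forall>z. is_pole F z \<longrightarrow> Re z \<in> candidate_real_parts f g))"
proof -
  note f = assms(2,6) and g = assms(3,7) and fg = assms(2,3)
  interpret haar \<mu> by standard (rule assms(9))
  have summ: "S_summand f g s summable_on (natural_points \<inter> \<delta>)" if "0 < Re s" for s \<delta>
  proof -
    have "(\<lambda>k. norm (S_summand f g s k)) summable_on (natural_points \<inter> \<delta>)"
      using S_summand_summable_natural[OF fg that] by (rule summable_on_subset_banach) auto
    then show ?thesis by (rule abs_summable_summable)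
  qed
  have zeta: "zeta_fun \<mu> f g s = (\<Sum>\<delta>\<in>cone_partition f g. L_term f g \<delta> s * S_term f g \<delta> s)" if "0 < Re s" for s
    by (rule zeta_formula[OF f g assms(8) that])
  have "\<forall>\<delta>\<in>cone_partition f g. \<exists>R. R meromorphic_on UNIV \<and> (\<forall>s. 0 < Re s \<longrightarrow> R s = S_term f g \<delta> s) \<and>
     (\<forall>z. Re z \<notin> candidate_real_parts f g \<longrightarrow> R analytic_on {z})"
    using S_term_continuation[OF fg _ summ] by blast
  from bchoice[OF this] obtain R where R: "\<And>\<delta>. \<delta> \<in> cone_partition f g \<Longrightarrow> R \<delta> meromorphic_on UNIV"
    "\<And>\<delta> s. \<delta> \<in> cone_partition f g \<Longrightarrow> 0 < Re s \<Longrightarrow> R \<delta> s = S_term f g \<delta> s"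
    "\<And>\<delta> z. \<delta> \<in> cone_partition f g \<Longrightarrow> Re z \<notin> candidate_real_parts f g \<Longrightarrow> R \<delta> analytic_on {z}"
    by blast
  \<comment> \<open>The formula for the zeta function with each \<open>S_term\<close> replaced by
    its continuation. Off the candidate lines all factors are analytic, and a finite sum of their
    products has no pole there.\<close>
  define F where "F = (\<lambda>s. \<Sum>\<delta>\<in>cone_partition f g. L_term f g \<delta> s * R \<delta> s)"
  have "F meromorphic_on UNIV"
    unfolding F_def by (intro meromorphic_on_sum meromorphic_on_mult L_term_analytic(1) R(1))
  moreover have "F s = zeta_fun \<mu> f g s" if "0 < Re s" for s
    unfolding F_def zeta[OF that] using R(2)[OF _ that] by simp
  moreover have "Re z \<in> candidate_real_parts f g" if "is_pole F z" for z
  proof (rule ccontr)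
    assume z: "Re z \<notin> candidate_real_parts f g"
    then have "Re z \<noteq> - 1" by (auto simp: candidate_real_parts_def)
    then have "F analytic_on {z}"
      unfolding F_def by (intro analytic_on_sum analytic_on_mult L_term_analytic(2) R(3) z)
    then show False using that analytic_at_imp_no_pole by blast
  qed
  ultimately show ?thesis
    using finite_cone_partition[OF fg] integrable_zeta_integrand summ zeta candidate_real_parts_rational[OF fg]
      S_term_simplicial[OF fg _ _ summ]
    by (intro conjI allI impI ballI exI[of _ F]) auto
qed

end
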